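(* Let $\alpha>0$ and let $X=\{(\lambda,m_\lambda)\}_{\lambda\in\Lambda}$ be a divisor. (a) If $X$ is an interpolating divisor for $\mathcal F_\alpha^2$, then there exists $C>0$ such that the discs $\bigl\{D\bigl(\lambda,\sqrt{m_\lambda/\alpha}-C\bigr)\bigr\}_{\lambda\in\Lambda,\; m_\lambda>\alpha C^2}$ are pairwise disjoint. (b) Conversely, if the discs $\bigl\{D\bigl(\lambda,\sqrt{m_\lambda/\alpha}+C\bigr)\bigr\}_{\lambda\in\Lambda}$ are pairwise disjoint for some $C>0$, then $X$ is an interpolating divisor for $\mathcal F_\alpha^2$.
   Context: For $\alpha>0$, the Fock space is $$\mathcal F_\alpha^2=\Bigl\{f\in \operatorname{Hol}(\mathbb C): \|f\|_2^2:=\frac{\alpha}{\pi}\int_{\mathbb C}|f(z)|^2e^{-\alpha|z|^2}\,dm(z)<\infty\Bigr\},$$ where $\operatorname{Hol}(\mathbb C)$ is the set of entire functions and $m$ is planar Lebesgue measure. It is a Hilbert space with inner product $\langle f,g\rangle=\frac{\alpha}{\pi}\int_{\mathbb C} f(z)\overline{g(z)}e^{-\alpha|z|^2}\,dm(z)$, and $e_k(z)=\frac{\sqrt{\alpha^k}}{\sqrt{k!}}z^k$, $k\ge 0$, is an orthonormal basis of it. For $z\in\mathbb C$, the translation $T_z$, acting isometrically on $\mathcal F_\alpha^2$, is $T_zf(\zeta)=e^{\alpha\bar z\zeta-\frac{\alpha}{2}|z|^2}f(\zeta-z)$. A divisor $X=\{(\lambda,m_\lambda)\}_{\lambda\in\Lambda}$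 consists of a sequence $\Lambda$ of (distinct) points in $\mathbb C$ and, for each $\lambda\in\Lambda$, a positive integer $m_\lambda$ (the multiplicity associated with $\lambda$); the multiplicities may be unbounded. $X$ is called interpolating for $\mathcal F_\alpha^2$ if for every family of complex numbers $v=\{v_\lambda^{(k)}\}_{\lambda\in\Lambda,\;0\le k<m_\lambda}$ with $$\|v\|_2^2:=\sum_{\lambda\in\Lambda}\sum_{k=0}^{m_\lambda-1}|v_\lambda^{(k)}|^2<\infty$$ there exists $f\in\mathcal F_\alpha^2$ such that $\langle f,T_\lambda e_k\rangle=v_\lambda^{(k)}$ for all $\lambda\in\Lambda$ and $0\le k<m_\lambda$. $D(z,r)$ denotes the disc of radius $r$ centered at $z$. *)

theory Defs
  imports "HOL-Analysis.Analysis"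
begin

(* For entire f the integrand below is continuous and nonnegative, so integrability is
   exactly finiteness of the norm of f. *)
definition fock_space :: "real \<Rightarrow> (complex \<Rightarrow> complex) set" where
  "fock_space \<alpha> = {f. f holomorphic_on UNIV \<and>
     integrable lborel (\<lambda>z. (cmod (f z))\<^sup>2 * exp (- \<alpha> * (cmod z)\<^sup>2))}"

(* Meaningful for f, g in fock_space; the Bochner integral is 0 when the integrand is not
   integrable. *)
definition fock_inner :: "real \<Rightarrow> (complex \<Rightarrow> complex) \<Rightarrow> (complex \<Rightarrow> complex) \<Rightarrow> complex" where
  "fock_inner \<alpha> f g = complex_of_real (\<alpha> / pi) *
     (LINT z|lborel. f z * cnj (g z) * complex_of_real (exp (- \<alpha> * (cmod z)\<^sup>2)))"

definition fock_basis :: "real \<Rightarrow> nat \<Rightarrow> complex \<Rightarrow> complex" where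
  "fock_basis \<alpha> k z = complex_of_real (sqrt (\<alpha> ^ k) / sqrt (fact k)) * z ^ k"

definition fock_translation ::
  "real \<Rightarrow> complex \<Rightarrow> (complex \<Rightarrow> complex) \<Rightarrow> complex \<Rightarrow> complex" where
  "fock_translation \<alpha> z f \<zeta> =
     exp (complex_of_real \<alpha> * cnj z * \<zeta> - complex_of_real (\<alpha> / 2 * (cmod z)\<^sup>2)) * f (\<zeta> - z)"

(* The sequence of distinct points is given by its (finite or infinite) range \<Lambda>; the values of
   m outside \<Lambda> are irrelevant. *)
definition is_divisor :: "complex set \<Rightarrow> (complex \<Rightarrow> nat) \<Rightarrow> bool" where
  "is_divisor \<Lambda> m \<longleftrightarrow> countable \<Lambda> \<and> (\<forall>l\<in>\<Lambda>. 0 < m l)"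

definition interpolating_divisor :: "real \<Rightarrow> complex set \<Rightarrow> (complex \<Rightarrow> nat) \<Rightarrow> bool" where
  "interpolating_divisor \<alpha> \<Lambda> m \<longleftrightarrow>
     (\<forall>v :: complex \<Rightarrow> nat \<Rightarrow> complex.
        (\<lambda>l. \<Sum>k<m l. (cmod (v l k))\<^sup>2) summable_on \<Lambda> \<longrightarrow>
        (\<exists>f\<in>fock_space \<alpha>. \<forall>l\<in>\<Lambda>. \<forall>k<m l.
           fock_inner \<alpha> f (fock_translation \<alpha> l (fock_basis \<alpha> k)) = v l k))"

end

theory Submission
  imports Defs "HOL-Complex_Analysis.Complex_Analysis" "HOL-Probability.Distributions"
begin

text \<open>
  Throughout, \<open>gauss \<alpha> z\<close> is the weight $e^{-\alpha|z|^2}$, the jet of \<open>f\<close> at \<open>l\<close> is the family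
  of numbers \<open>fock_inner \<alpha> f (fock_translation \<alpha> l (fock_basis \<alpha> k))\<close>, and
  $\rho_l = \sqrt{m_l/\alpha}$. After translation to the origin the jet is the sequence of
  normalised Taylor coefficients, so prescribing it to order $m_l$ controls \<open>f\<close> in the disc of radius
  $\rho_l$ about \<open>l\<close> and hardly at all beyond it.

  Why overlapping discs obstruct interpolation. If \<open>w\<close> lies at depth \<open>C\<close> inside the disc of
  radius $\rho_l$ about \<open>l\<close>, then the jet of order $m_l$ at \<open>l\<close> determines $f(w)e^{-\alpha|w|^2/2}$ up to an error
  $e^{-\alpha C^2/2}\|f\|$; this is a tail bound for the Poisson distribution with parameter
  $\alpha|w-l|^2$ (\<open>poisson_tail\<close>, \<open>jet_determines_value\<close>). When \<open>w\<close> is that deep in two discs, a zero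
  jet at one centre and a jet at the other that forces this value to be of size \<open>t\<close> are compatible only if
  the norm of \<open>f\<close> is at least a multiple of $t e^{\alpha C^2/2}$ (\<open>overlap_forces_large_norm\<close>).
  If every \<open>C\<close> admits such a pair of discs, a gliding hump puts sizes $2^{-n}$ on infinitely many
  pairs with rapidly growing \<open>C\<close>: the data are square summable, but no single \<open>f\<close> interpolates them.

  Why separated discs suffice. Let $f = \sum_l p_l$ with $p_l$ in the span of the translated basis
  functions of order less than $m_l$ at \<open>l\<close>, for finitely many \<open>l\<close>. By duality everything follows
  from $\sum_l \|p_l\|^2 \le K \|f\|^2$ with \<open>K\<close> depending on $\alpha$ and \<open>C\<close> only
  (\<open>riesz_lower_bound\<close>). Each $\overline{p_l}\, e^{-\alpha|z|^2}$ is $\bar\partial$ of an explicit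
  Gaussian-decaying function $\Psi_l$ with a pole of order at most $m_l$ at \<open>l\<close>. Let $\chi_l$ be
  a cutoff that is 1 on the disc of radius $\rho_l$ and vanishes beyond $\rho_l + C$. Integrating by parts,
  $$\|p_l\|^2 = \int \chi_l\, p_l \bar f e^{-\alpha|z|^2} + \int \bar\partial\chi_l\, p_l \Psi,
    \qquad \Psi = \sum_l \Psi_l,$$
  up to normalisation (\<open>pairing\<close>), and by the separation hypothesis the second integral only sees
  $\Psi$ outside all discs of radius $\rho_l$. There $\Psi$ is controlled by \<open>f\<close> through an a priori
  inequality of Hoermander type,
  $\int \Delta\psi\,|\Psi|^2 e^{\psi} \le 4\int |\bar\partial\Psi|^2 e^{\psi}$
  (\<open>weighted_dbar_inequality\<close>), for the weight $\psi$ that equals $\alpha|z|^2$ outside the discs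
  and $m_l \log|z-l|^2$ plus a harmonic function inside. This $\psi$ is $C^1$, lies below $\alpha|z|^2$,
  is subharmonic with $\Delta\psi = 4\alpha$ exactly where it is needed, and $e^\psi$ cancels the poles.

  The dual interpolation problem for finitely many points is linear algebra (\<open>gram_solvable\<close>), and a
  normal families argument passes to the whole divisor (\<open>fock_weak_limit\<close>). The explicit form of
  $\Psi$ keeps every integration by parts within one class of Lipschitz functions
  (\<open>tame\<close>, \<open>integral_dbar_eq_0\<close>), where it rests on translation invariance alone.
\<close>

section \<open>Wirtinger derivatives\<close>

definition has_wirtinger :: "(complex \<Rightarrow> complex) \<Rightarrow> complex \<Rightarrow> complex \<Rightarrow> complex \<Rightarrow> bool" where
  "has_wirtinger f a b z \<longleftrightarrow> (f has_derivative (\<lambda>h. a * h + b * cnj h)) (at z)"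

text \<open>Only the coefficient of \<open>cnj h\<close> enters the integration by parts below. Hiding the other one
  spares the cutoff functions a formula for their holomorphic derivative.\<close>
definition has_dbar :: "(complex \<Rightarrow> complex) \<Rightarrow> complex \<Rightarrow> complex \<Rightarrow> bool" where
  "has_dbar f b z \<longleftrightarrow> (\<exists>a. has_wirtinger f a b z)"

lemma has_wirtinger_const: "has_wirtinger (\<lambda>_. c) 0 0 z"
  by (simp add: has_wirtinger_def)

lemma has_wirtinger_ident: "has_wirtinger (\<lambda>z. z) 1 0 z"
  by (simp add: has_wirtinger_def)

lemma has_wirtinger_cnj:
  assumes "has_wirtinger f a b z"
  shows "has_wirtinger (\<lambda>z. cnj (f z)) (cnj b) (cnj a) z"
proof -
  have "((\<lambda>z. cnj (f z)) has_derivative (\<lambda>h. cnj (a * h + b * cnj h))) (at z)"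
    using assms unfolding has_wirtinger_def by (rule has_derivative_cnj)
  then show ?thesis by (simp add: has_wirtinger_def algebra_simps)
qed

lemma has_wirtinger_add:
  assumes "has_wirtinger f a b z" "has_wirtinger g c d z"
  shows "has_wirtinger (\<lambda>z. f z + g z) (a + c) (b + d) z"
  using has_derivative_add[OF assms[unfolded has_wirtinger_def]]
  by (simp add: has_wirtinger_def algebra_simps)

lemma has_wirtinger_mult:
  assumes "has_wirtinger f a b z" "has_wirtinger g c d z"
  shows "has_wirtinger (\<lambda>z. f z * g z) (a * g z + f z * c) (b * g z + f z * d) z"
  using has_derivative_mult[OF assms[unfolded has_wirtinger_def]]
  by (simp add: has_wirtinger_def algebra_simps)

lemma has_wirtinger_holomorphic_compose:
  assumes "(F has_field_derivative F') (at (f z))" "has_wirtinger f a b z"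
  shows "has_wirtinger (\<lambda>z. F (f z)) (F' * a) (F' * b) z"
  using has_derivative_compose[OF assms(2)[unfolded has_wirtinger_def]
      assms(1)[unfolded has_field_derivative_def]]
  by (simp add: has_wirtinger_def algebra_simps)

lemma has_wirtinger_field_derivative:
  "(f has_field_derivative a) (at z) \<Longrightarrow> has_wirtinger f a 0 z"
  by (simp add: has_wirtinger_def has_field_derivative_def)

lemma has_wirtinger_unique:
  assumes "has_wirtinger f a b z" "has_wirtinger f a' b' z"
  shows "a = a'" "b = b'"
proof -
  have eq: "(\<lambda>h. a * h + b * cnj h) = (\<lambda>h. a' * h + b' * cnj h)"
    using assms unfolding has_wirtinger_def by (rule has_derivative_unique)
  have 1: "a + b = a' + b'" using fun_cong[OF eq, of 1] by simp
  have "a * \<i> - b * \<i> = a' * \<i> - b' * \<i>" using fun_cong[OF eq, of \<i>] by simp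
  then have "\<i> * (a - b) = \<i> * (a' - b')" by (simp add: algebra_simps)
  then have 2: "a - b = a' - b'" by simp
  have "2 * a = 2 * a'" using 1 2 by algebra
  then show "a = a'" by simp
  then show "b = b'" using 1 by simp
qed

lemma has_wirtinger_eq_near:
  assumes "has_wirtinger f a b z" "open U" "z \<in> U" "\<And>w. w \<in> U \<Longrightarrow> f w = g w"
  shows "has_wirtinger g a b z"
  using has_derivative_transform_within_open[OF assms(1)[unfolded has_wirtinger_def] assms(2-4)]
  unfolding has_wirtinger_def .

lemma has_dbar_mult:
  assumes "has_dbar f b z" "has_dbar g d z"
  shows "has_dbar (\<lambda>z. f z * g z) (b * g z + f z * d) z"
proof -
  obtain a c where "has_wirtinger f a b z" "has_wirtinger g c d z"
    using assms unfolding has_dbar_def by auto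
  from has_wirtinger_mult[OF this] show ?thesis unfolding has_dbar_def by (rule exI)
qed

lemma has_dbar_add:
  assumes "has_dbar f b z" "has_dbar g d z"
  shows "has_dbar (\<lambda>z. f z + g z) (b + d) z"
proof -
  obtain a c where "has_wirtinger f a b z" "has_wirtinger g c d z"
    using assms unfolding has_dbar_def by auto
  from has_wirtinger_add[OF this] show ?thesis unfolding has_dbar_def by (rule exI)
qed

lemma has_dbar_sum:
  assumes "\<And>i. i \<in> I \<Longrightarrow> has_dbar (f i) (b i) z"
  shows "has_dbar (\<lambda>z. \<Sum>i\<in>I. f i z) (\<Sum>i\<in>I. b i) z"
  using assms
proof (induction I rule: infinite_finite_induct)
  case (insert x F)
  then show ?case using has_dbar_add[of "f x" "b x" z "\<lambda>z. \<Sum>i\<in>F. f i z" "\<Sum>i\<in>F. b i"] by simp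
qed (use has_wirtinger_const in \<open>simp_all add: has_dbar_def, blast+\<close>)

lemma has_dbar_field_derivative:
  "(f has_field_derivative a) (at z) \<Longrightarrow> has_dbar f 0 z"
  unfolding has_dbar_def by (rule exI, rule has_wirtinger_field_derivative)

lemma has_dbar_eq_near:
  assumes "has_dbar f b z" "open U" "z \<in> U" "\<And>w. w \<in> U \<Longrightarrow> f w = g w"
  shows "has_dbar g b z"
proof -
  obtain a where "has_wirtinger f a b z" using assms(1) unfolding has_dbar_def by auto
  from has_wirtinger_eq_near[OF this assms(2-4)] show ?thesis unfolding has_dbar_def by (rule exI)
qed

lemma has_dbar_unique: "has_dbar f b z \<Longrightarrow> has_dbar f b' z \<Longrightarrow> b = b'"
  unfolding has_dbar_def by (elim exE) (rule has_wirtinger_unique(2))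

section \<open>Functions of exponential type with local Lipschitz control\<close>

text \<open>Against a Gaussian, the difference quotients of such a function have one integrable majorant.
  Differentiability is not built in, since the weights and cutoffs below have corners along circles.\<close>
definition tame :: "(complex \<Rightarrow> complex) \<Rightarrow> bool" where
  "tame f \<longleftrightarrow> (\<exists>A\<ge>0. \<exists>B\<ge>0. \<forall>z. cmod (f z) \<le> A * exp (B * cmod z) \<and>
      (\<forall>w. cmod (z - w) \<le> 1 \<longrightarrow> cmod (f z - f w) \<le> A * exp (B * cmod z) * cmod (z - w)))"

lemma tameI:
  assumes "\<And>z. cmod (f z) \<le> A * exp (B * cmod z)"
    and "\<And>z w. cmod (z - w) \<le> 1 \<Longrightarrow> cmod (f z - f w) \<le> A' * exp (B' * cmod z) * cmod (z - w)"
  shows "tame f"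
proof -
  define C where "C = max \<bar>A\<bar> \<bar>A'\<bar>"
  define D where "D = max \<bar>B\<bar> \<bar>B'\<bar>"
  have CD: "C \<ge> 0" "D \<ge> 0" by (auto simp: C_def D_def)
  have 1: "A * exp (B * cmod z) \<le> C * exp (D * cmod z)" for z
  proof (rule mult_mono)
    have "B * cmod z \<le> D * cmod z" by (rule mult_right_mono) (auto simp: D_def)
    then show "exp (B * cmod z) \<le> exp (D * cmod z)" by simp
  qed (auto simp: C_def)
  have 2: "A' * exp (B' * cmod z) \<le> C * exp (D * cmod z)" for z
  proof (rule mult_mono)
    have "B' * cmod z \<le> D * cmod z" by (rule mult_right_mono) (auto simp: D_def)
    then show "exp (B' * cmod z) \<le> exp (D * cmod z)" by simp
  qed (auto simp: C_def)
  have "cmod (f z) \<le> C * exp (D * cmod z)" for z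
    using assms(1)[of z] 1[of z] by linarith
  moreover have "cmod (f z - f w) \<le> C * exp (D * cmod z) * cmod (z - w)" if "cmod (z - w) \<le> 1" for z w
    using assms(2)[OF that] mult_right_mono[OF 2[of z] norm_ge_zero, of "z - w"] by linarith
  ultimately show ?thesis unfolding tame_def using CD by blast
qed

lemma tameE:
  assumes "tame f"
  obtains A B where "A \<ge> 0" "B \<ge> 0" "\<And>z. cmod (f z) \<le> A * exp (B * cmod z)"
    and "\<And>z w. cmod (z - w) \<le> 1 \<Longrightarrow> cmod (f z - f w) \<le> A * exp (B * cmod z) * cmod (z - w)"
  using assms unfolding tame_def by blast

lemma tame_const: "tame (\<lambda>_. c)"
  by (rule tameI[of _ "cmod c" 0 0 0]) auto

lemma tame_ident: "tame (\<lambda>z. z)"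
proof (rule tameI[of _ 1 1 1 0])
  fix z :: complex
  show "cmod z \<le> 1 * exp (1 * cmod z)" using exp_ge_add_one_self[of "cmod z"] by (simp del: exp_ge_add_one_self)
qed auto

lemma tame_cnj: assumes "tame f" shows "tame (\<lambda>z. cnj (f z))"
proof -
  have "cmod (cnj (f z) - cnj (f w)) = cmod (f z - f w)" for z w
    by (metis complex_cnj_diff complex_mod_cnj)
  then show ?thesis using assms unfolding tame_def by simp
qed

lemma tame_mult:
  assumes "tame f" "tame g" shows "tame (\<lambda>z. f z * g z)"
proof -
  obtain A B where f: "A \<ge> 0" "B \<ge> 0" "\<And>z. cmod (f z) \<le> A * exp (B * cmod z)"
    "\<And>z w. cmod (z - w) \<le> 1 \<Longrightarrow> cmod (f z - f w) \<le> A * exp (B * cmod z) * cmod (z - w)"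
    using assms(1) by (rule tameE) blast
  obtain A' B' where g: "A' \<ge> 0" "B' \<ge> 0" "\<And>z. cmod (g z) \<le> A' * exp (B' * cmod z)"
    "\<And>z w. cmod (z - w) \<le> 1 \<Longrightarrow> cmod (g z - g w) \<le> A' * exp (B' * cmod z) * cmod (z - w)"
    using assms(2) by (rule tameE) blast
  show ?thesis
  proof (rule tameI)
    fix z
    have "cmod (f z * g z) \<le> (A * exp (B * cmod z)) * (A' * exp (B' * cmod z))"
      unfolding norm_mult by (rule mult_mono[OF f(3) g(3)]) (use f in auto)
    then show "cmod (f z * g z) \<le> (A * A') * exp ((B + B') * cmod z)"
      by (simp add: exp_add algebra_simps)
  next
    fix z w assume zw: "cmod (z - w) \<le> 1"
    have "cmod w \<le> cmod z + 1" using zw norm_triangle_sub[of w z] by (simp add: norm_minus_commute)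
    then have "B' * cmod w \<le> B' * (cmod z + 1)" using g(2) by (rule mult_left_mono)
    then have "A' * exp (B' * cmod w) \<le> A' * exp (B' * (cmod z + 1))"
      using g(1) by (intro mult_left_mono) auto
    then have gw: "cmod (g w) \<le> A' * exp (B' * (cmod z + 1))" using g(3)[of w] by linarith
    have eq: "f z * g z - f w * g w = f z * (g z - g w) + (f z - f w) * g w" by (simp add: algebra_simps)
    have "cmod (f z * g z - f w * g w) \<le> cmod (f z * (g z - g w)) + cmod ((f z - f w) * g w)"
      unfolding eq by (rule norm_triangle_ineq)
    also have "\<dots> \<le> (A * exp (B * cmod z)) * (A' * exp (B' * cmod z) * cmod (z - w))
        + (A * exp (B * cmod z) * cmod (z - w)) * (A' * exp (B' * (cmod z + 1)))"
      unfolding norm_mult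
      by (intro add_mono mult_mono f(3) g(4)[OF zw] f(4)[OF zw] gw) (use f g in auto)
    also have "\<dots> = (A * A' * (1 + exp B')) * exp ((B + B') * cmod z) * cmod (z - w)"
      by (simp add: exp_add algebra_simps)
    finally show "cmod (f z * g z - f w * g w)
        \<le> (A * A' * (1 + exp B')) * exp ((B + B') * cmod z) * cmod (z - w)" .
  qed
qed

lemma tame_add:
  assumes "tame f" "tame g" shows "tame (\<lambda>z. f z + g z)"
proof -
  obtain A B where f: "A \<ge> 0" "B \<ge> 0" "\<And>z. cmod (f z) \<le> A * exp (B * cmod z)"
    "\<And>z w. cmod (z - w) \<le> 1 \<Longrightarrow> cmod (f z - f w) \<le> A * exp (B * cmod z) * cmod (z - w)"
    using assms(1) by (rule tameE) blast
  obtain A' B' where g: "A' \<ge> 0" "B' \<ge> 0" "\<And>z. cmod (g z) \<le> A' * exp (B' * cmod z)"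
    "\<And>z w. cmod (z - w) \<le> 1 \<Longrightarrow> cmod (g z - g w) \<le> A' * exp (B' * cmod z) * cmod (z - w)"
    using assms(2) by (rule tameE) blast
  have e: "A * exp (B * cmod z) + A' * exp (B' * cmod z) \<le> (A + A') * exp ((B + B') * cmod z)" for z
  proof -
    have "exp (B * cmod z) \<le> exp ((B + B') * cmod z)" "exp (B' * cmod z) \<le> exp ((B + B') * cmod z)"
      using f(2) g(2) by (auto intro!: mult_right_mono)
    then show ?thesis using f(1) g(1) by (simp add: distrib_right add_mono mult_left_mono)
  qed
  show ?thesis
  proof (rule tameI)
    fix z show "cmod (f z + g z) \<le> (A + A') * exp ((B + B') * cmod z)"
      using norm_triangle_ineq[of "f z" "g z"] f(3)[of z] g(3)[of z] e[of z] by linarith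
  next
    fix z w assume zw: "cmod (z - w) \<le> 1"
    have eq: "f z + g z - (f w + g w) = (f z - f w) + (g z - g w)" by simp
    have "cmod (f z + g z - (f w + g w)) \<le> (A * exp (B * cmod z) + A' * exp (B' * cmod z)) * cmod (z - w)"
      unfolding eq distrib_right using norm_triangle_ineq[of "f z - f w" "g z - g w"] f(4)[OF zw] g(4)[OF zw]
      by linarith
    also have "\<dots> \<le> (A + A') * exp ((B + B') * cmod z) * cmod (z - w)"
      by (rule mult_right_mono[OF e]) simp
    finally show "cmod (f z + g z - (f w + g w)) \<le> (A + A') * exp ((B + B') * cmod z) * cmod (z - w)" .
  qed
qed

lemma tame_diff: "tame f \<Longrightarrow> tame g \<Longrightarrow> tame (\<lambda>z. f z - g z)"
  using tame_add[of f "\<lambda>z. (-1) * g z"] tame_mult[OF tame_const[of "-1"], of g] by simp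

lemma tame_sum:
  assumes "\<And>i. i \<in> I \<Longrightarrow> tame (f i)" shows "tame (\<lambda>z. \<Sum>i\<in>I. f i z)"
  using assms
  by (induction I rule: infinite_finite_induct) (auto intro: tame_const tame_add)

lemma tame_prod:
  assumes "\<And>i. i \<in> I \<Longrightarrow> tame (f i)" shows "tame (\<lambda>z. \<Prod>i\<in>I. f i z)"
  using assms
  by (induction I rule: infinite_finite_induct) (auto intro: tame_const tame_mult)

lemma tame_power: "tame f \<Longrightarrow> tame (\<lambda>z. f z ^ n)"
  by (induction n) (auto intro: tame_const tame_mult)

lemma tame_exp: "tame (\<lambda>z. exp (c * z))"
proof (rule tameI)
  have b: "cmod (exp (c * z)) \<le> exp (cmod c * cmod z)" for z
    by (metis norm_exp norm_mult)
  then show "cmod (exp (c * z)) \<le> 1 * exp (cmod c * cmod z)" for z by simp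
  fix z w assume zw: "cmod (z - w) \<le> 1"
  define S where "S = cball z 1"
  have "cmod (exp (c * z) - exp (c * w)) \<le> (cmod c * exp (cmod c * (cmod z + 1))) * cmod (z - w)"
  proof (rule field_differentiable_bound[where S=S])
    show "convex S" "z \<in> S" "w \<in> S" using zw by (auto simp: S_def dist_norm)
    fix u assume "u \<in> S"
    then have "cmod u \<le> cmod z + 1" using norm_triangle_sub[of u z]
      by (simp add: S_def dist_norm norm_minus_commute)
    then have "cmod c * cmod u \<le> cmod c * (cmod z + 1)" by (simp add: mult_left_mono)
    then have "exp (cmod c * cmod u) \<le> exp (cmod c * (cmod z + 1))" by simp
    with b[of u] have "cmod (exp (c * u)) \<le> exp (cmod c * (cmod z + 1))" by linarith
    then show "cmod (exp (c * u) * c) \<le> cmod c * exp (cmod c * (cmod z + 1))"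
      by (simp add: norm_mult mult.commute mult_left_mono)
    show "((\<lambda>z. exp (c * z)) has_field_derivative exp (c * u) * c) (at u within S)"
      by (auto intro!: derivative_eq_intros)
  qed
  then show "cmod (exp (c * z) - exp (c * w)) \<le> (cmod c * exp (cmod c)) * exp (cmod c * cmod z) * cmod (z - w)"
    by (simp add: exp_add algebra_simps)
qed

lemma tame_exp_cnj: "tame (\<lambda>z. exp (c * cnj z))"
  using tame_cnj[OF tame_exp[of "cnj c"]] by (simp add: exp_cnj)

lemma tame_shift: "tame (\<lambda>z. z - l)"
  by (intro tame_diff tame_ident tame_const)

lemma tame_imp_continuous: assumes "tame f" shows "continuous_on UNIV f"
proof -
  obtain A B where f: "A \<ge> 0" "B \<ge> 0"
    "\<And>z w. cmod (z - w) \<le> 1 \<Longrightarrow> cmod (f z - f w) \<le> A * exp (B * cmod z) * cmod (z - w)"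
    using assms by (rule tameE) blast
  have "isCont f z" for z
  proof -
    have "((\<lambda>w. A * exp (B * cmod z) * cmod (z - w)) \<longlongrightarrow> A * exp (B * cmod z) * cmod (z - z)) (at z)"
      by (intro tendsto_intros)
    then have lim: "((\<lambda>w. A * exp (B * cmod z) * cmod (z - w)) \<longlongrightarrow> 0) (at z)" by simp
    have "eventually (\<lambda>w. w \<in> ball z 1) (at z)"
      by (rule eventually_at_in_open'[OF open_ball]) simp
    then have "eventually (\<lambda>w. norm (f w - f z) \<le> A * exp (B * cmod z) * cmod (z - w)) (at z)"
      by eventually_elim (use f(3)[of z] in \<open>auto simp: dist_norm norm_minus_commute\<close>)
    from Lim_null_comparison[OF this lim] show ?thesis
      unfolding isCont_def by (simp add: LIM_zero_iff)
  qed
  then show ?thesis by (simp add: continuous_at_imp_continuous_on)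
qed

lemma tame_measurable: "tame f \<Longrightarrow> f \<in> borel_measurable borel"
  using tame_imp_continuous borel_measurable_continuous_onI by blast

section \<open>The Gaussian weight\<close>

definition gauss :: "real \<Rightarrow> complex \<Rightarrow> real" where
  "gauss \<alpha> z = exp (- \<alpha> * (cmod z)\<^sup>2)"

lemma gauss_pos: "gauss \<alpha> z > 0" by (simp add: gauss_def)

lemma gauss_nonneg [simp]: "0 \<le> gauss \<alpha> z" by (simp add: gauss_def)

lemma gauss_measurable [measurable]: "gauss \<alpha> \<in> borel_measurable borel"
  unfolding gauss_def[abs_def] by measurable

lemma of_real_gauss: "complex_of_real (gauss \<alpha> z) = exp (- of_real \<alpha> * z * cnj z)"
proof -
  have "complex_of_real (gauss \<alpha> z) = exp (of_real (- \<alpha> * (cmod z)\<^sup>2))"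
    unfolding gauss_def by (simp only: exp_of_real)
  also have "of_real (- \<alpha> * (cmod z)\<^sup>2) = - of_real \<alpha> * z * cnj z"
    by (simp only: of_real_mult complex_norm_square of_real_minus mult.assoc)
  finally show ?thesis .
qed

text \<open>Writing $e^{-\alpha|z|^2}$ as the integral of $\alpha e^{-\alpha t}$ over $t \ge |z|^2$ and
  exchanging the integrals leaves the area of a disc of radius $\sqrt t$, and hence the total mass of a
  Gamma density.\<close>
lemma nn_integral_gauss:
  assumes "\<alpha> > 0"
  shows "(\<integral>\<^sup>+z. ennreal (gauss \<alpha> z) \<partial>lborel) = ennreal (pi / \<alpha>)"
proof -
  have 1: "(\<integral>\<^sup>+t. ennreal (\<alpha> * exp (- \<alpha> * t)) * indicator {s..} t \<partial>lborel) = ennreal (exp (- \<alpha> * s))"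
    if "s \<ge> 0" for s
  proof -
    have "(\<integral>\<^sup>+t. ennreal (\<alpha> * exp (- \<alpha> * t)) * indicator {s..} t \<partial>lborel) = ennreal (0 - (- exp (- \<alpha> * s)))"
    proof (rule nn_integral_FTC_atLeast)
      fix x assume "s \<le> x"
      show "((\<lambda>t. - exp (- \<alpha> * t)) has_real_derivative \<alpha> * exp (- \<alpha> * x)) (at x)"
        by (auto intro!: derivative_eq_intros)
      show "0 \<le> \<alpha> * exp (- \<alpha> * x)" using assms by simp
    next
      show "((\<lambda>t. - exp (- \<alpha> * t)) \<longlongrightarrow> 0) at_top" using assms by real_asymp
    qed measurable
    then show ?thesis by simp
  qed
  have "(\<integral>\<^sup>+z. ennreal (gauss \<alpha> z) \<partial>lborel)
      = (\<integral>\<^sup>+z. (\<integral>\<^sup>+t. ennreal (\<alpha> * exp (- \<alpha> * t)) * indicator {t. (cmod z)\<^sup>2 \<le> t} t \<partial>lborel) \<partial>(lborel :: complex measure))"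
    using 1 by (intro nn_integral_cong) (simp only: gauss_def atLeast_def[symmetric] zero_le_power2)
  also have "\<dots> = (\<integral>\<^sup>+t. (\<integral>\<^sup>+z. ennreal (\<alpha> * exp (- \<alpha> * t)) * indicator {z. (cmod z)\<^sup>2 \<le> t} z \<partial>(lborel :: complex measure)) \<partial>lborel)"
    by (subst lborel_pair.Fubini') (auto simp: indicator_def)
  also have "\<dots> = (\<integral>\<^sup>+t. ennreal (pi / \<alpha>) * ennreal (erlang_density 1 \<alpha> t) \<partial>lborel)"
  proof (rule nn_integral_cong)
    fix t :: real
    have m: "{z::complex. (cmod z)\<^sup>2 \<le> t} \<in> sets lborel" by measurable
    have "emeasure lborel {z::complex. (cmod z)\<^sup>2 \<le> t} = ennreal (if t < 0 then 0 else pi * t)"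
    proof (cases "t < 0")
      case True
      then have "{z::complex. (cmod z)\<^sup>2 \<le> t} = {}"
        by (auto simp: not_le intro: less_le_trans)
      then show ?thesis using True by simp
    next
      case False
      then have "{z::complex. (cmod z)\<^sup>2 \<le> t} = cball 0 (sqrt t)"
        by (auto simp: real_le_rsqrt sqrt_ge_absD)
      then show ?thesis using False by (simp add: emeasure_cball unit_ball_vol_2)
    qed
    then have "(\<integral>\<^sup>+z. ennreal (\<alpha> * exp (- \<alpha> * t)) * indicator {z. (cmod z)\<^sup>2 \<le> t} z \<partial>(lborel :: complex measure))
        = ennreal (\<alpha> * exp (- \<alpha> * t)) * ennreal (if t < 0 then 0 else pi * t)"
      using m by (simp add: nn_integral_cmult_indicator)
    also have "\<dots> = ennreal (pi / \<alpha>) * ennreal (erlang_density 1 \<alpha> t)"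
      using assms by (auto simp: erlang_density_def ennreal_mult'[symmetric] field_simps power2_eq_square)
    finally show "(\<integral>\<^sup>+z. ennreal (\<alpha> * exp (- \<alpha> * t)) * indicator {z. (cmod z)\<^sup>2 \<le> t} z \<partial>(lborel :: complex measure))
      = ennreal (pi / \<alpha>) * ennreal (erlang_density 1 \<alpha> t)" .
  qed
  also have "\<dots> = ennreal (pi / \<alpha>) * (\<integral>\<^sup>+t. ennreal (erlang_density 1 \<alpha> t) \<partial>lborel)"
    by (rule nn_integral_cmult) simp
  also have "(\<integral>\<^sup>+t. ennreal (erlang_density 1 \<alpha> t) \<partial>lborel) = 1"
    using prob_space.emeasure_space_1[OF prob_space_erlang_density[OF assms, of 1]]
    by (simp add: emeasure_density)
  finally show ?thesis by simp
qed

lemma integrable_gauss: "\<alpha> > 0 \<Longrightarrow> integrable lborel (gauss \<alpha>)"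
  by (rule integrableI_bounded) (auto simp: gauss_pos less_imp_le nn_integral_gauss)

lemma integral_gauss: "\<alpha> > 0 \<Longrightarrow> (LINT z|lborel. gauss \<alpha> z) = pi / \<alpha>"
  by (subst integral_eq_nn_integral) (auto simp: gauss_pos less_imp_le nn_integral_gauss)

lemma integrable_exp_gauss:
  assumes "\<alpha> > 0"
  shows "integrable lborel (\<lambda>z. exp (B * cmod z) * gauss \<alpha> z)"
proof (rule Bochner_Integration.integrable_bound)
  show "integrable lborel (\<lambda>z. exp (B\<^sup>2 / (2 * \<alpha>)) * gauss (\<alpha> / 2) z)"
    using assms by (intro integrable_mult_right integrable_gauss) auto
  show "AE z in lborel. norm (exp (B * cmod z) * gauss \<alpha> z) \<le> norm (exp (B\<^sup>2 / (2 * \<alpha>)) * gauss (\<alpha> / 2) z)"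
  proof (rule AE_I2)
    fix z :: complex
    have "0 \<le> (\<alpha> * cmod z - B)\<^sup>2 / (2 * \<alpha>)" using assms by simp
    also have "\<dots> = B\<^sup>2 / (2 * \<alpha>) + (- (\<alpha> / 2) * (cmod z)\<^sup>2) - (B * cmod z - \<alpha> * (cmod z)\<^sup>2)"
      using assms by (simp add: field_simps power2_eq_square)
    finally have "exp (B * cmod z + (- \<alpha> * (cmod z)\<^sup>2)) \<le> exp (B\<^sup>2 / (2 * \<alpha>) + (- (\<alpha> / 2) * (cmod z)\<^sup>2))"
      by simp
    then show "norm (exp (B * cmod z) * gauss \<alpha> z) \<le> norm (exp (B\<^sup>2 / (2 * \<alpha>)) * gauss (\<alpha> / 2) z)"
      by (simp add: gauss_def exp_add[symmetric])
  qed
qed measurable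

lemma tame_integrable_gauss:
  assumes "\<alpha> > 0" "tame f"
  shows "integrable lborel (\<lambda>z. f z * of_real (gauss \<alpha> z))"
proof -
  obtain A B where f: "A \<ge> 0" "\<And>z. cmod (f z) \<le> A * exp (B * cmod z)"
    using assms(2) by (rule tameE) blast
  note [measurable] = tame_measurable[OF assms(2)]
  show ?thesis
  proof (rule Bochner_Integration.integrable_bound)
    show "integrable lborel (\<lambda>z. A * (exp (B * cmod z) * gauss \<alpha> z))"
      using assms by (intro integrable_mult_right integrable_exp_gauss) auto
    show "AE z in lborel. norm (f z * of_real (gauss \<alpha> z)) \<le> norm (A * (exp (B * cmod z) * gauss \<alpha> z))"
      using f mult_right_mono[OF f(2), of "gauss \<alpha> _"]
      by (auto simp: norm_mult gauss_pos less_imp_le abs_mult mult.assoc)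
  qed measurable
qed

section \<open>Integration by parts against the Gaussian\<close>

lemma lborel_translation:
  fixes c :: complex and f :: "complex \<Rightarrow> 'b :: {banach, second_countable_topology}"
  assumes [measurable]: "f \<in> borel_measurable borel"
  shows "integrable lborel (\<lambda>z. f (z + c)) \<longleftrightarrow> integrable lborel f"
    and "(LINT z|lborel. f (z + c)) = (LINT z|lborel. f z)"
proof -
  have "integrable lborel f \<longleftrightarrow> integrable (distr lborel borel ((+) c)) f"
    by (simp only: lborel_distr_plus)
  also have "\<dots> \<longleftrightarrow> integrable lborel (\<lambda>z. f (c + z))"
    by (rule integrable_distr_eq) measurable
  finally show "integrable lborel (\<lambda>z. f (z + c)) \<longleftrightarrow> integrable lborel f" by (simp add: add.commute)
  have "(LINT z|lborel. f z) = (LINT z|distr lborel borel ((+) c). f z)"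
    by (simp only: lborel_distr_plus)
  also have "\<dots> = (LINT z|lborel. f (c + z))"
    by (rule integral_distr) measurable
  finally show "(LINT z|lborel. f (z + c)) = (LINT z|lborel. f z)" by (simp add: add.commute)
qed

lemma abs_exp_diff_le:
  fixes u v :: real
  shows "\<bar>exp u - exp v\<bar> \<le> \<bar>u - v\<bar> * exp (max u v)"
proof -
  have *: "exp a - exp b \<le> (a - b) * exp a" for a b :: real
  proof -
    have "exp a * (1 + (b - a)) \<le> exp a * exp (b - a)"
      by (rule mult_left_mono[OF exp_ge_add_one_self]) simp
    also have "\<dots> = exp b" by (simp add: exp_add[symmetric])
    finally show ?thesis by (simp add: algebra_simps)
  qed
  show ?thesis
  proof (cases "u \<le> v")
    case True then show ?thesis using *[of v u] by (simp add: max_def abs_if)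
  next
    case False then show ?thesis using *[of u v] by (simp add: max_def abs_if)
  qed
qed

text \<open>A unit shift changes the exponent by at most a multiple of \<open>cmod z\<close>, which functions of
  exponential type absorb.\<close>
lemma gauss_shift:
  assumes "\<alpha> > 0" "cmod h \<le> 1"
  shows "gauss \<alpha> (z + h) \<le> exp (2 * \<alpha> * cmod z) * gauss \<alpha> z"
    and "\<bar>gauss \<alpha> (z + h) - gauss \<alpha> z\<bar> \<le> cmod h * (\<alpha> * exp ((2 + 2 * \<alpha>) * cmod z) * gauss \<alpha> z)"
proof -
  have t1: "cmod (z + h) \<le> cmod z + cmod h" "cmod z \<le> cmod (z + h) + cmod h"
    using norm_triangle_ineq[of z h] norm_diff_ineq[of z h] by linarith+
  have "(cmod z - cmod h)\<^sup>2 \<le> (cmod (z + h))\<^sup>2"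
  proof (rule power2_le_iff_abs_le[THEN iffD2])
    show "\<bar>cmod z - cmod h\<bar> \<le> cmod (z + h)"
      using norm_diff_ineq[of z h] norm_diff_ineq[of h z] by (simp add: add.commute abs_le_iff)
  qed simp
  moreover have "(cmod z - cmod h)\<^sup>2 \<ge> (cmod z)\<^sup>2 - 2 * cmod z"
  proof -
    have "cmod z * cmod h \<le> cmod z * 1" by (rule mult_left_mono) (use assms in auto)
    moreover have "(cmod z - cmod h)\<^sup>2 = (cmod z)\<^sup>2 - 2 * (cmod z * cmod h) + (cmod h)\<^sup>2"
      by (simp add: power2_diff algebra_simps)
    moreover have "0 \<le> (cmod h)\<^sup>2" by simp
    ultimately show ?thesis by linarith
  qed
  ultimately have low: "(cmod z)\<^sup>2 - 2 * cmod z \<le> (cmod (z + h))\<^sup>2" by linarith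
  have ex: "- \<alpha> * (cmod (z + h))\<^sup>2 \<le> 2 * \<alpha> * cmod z + (- \<alpha> * (cmod z)\<^sup>2)"
    using mult_left_mono[OF low, of \<alpha>] assms(1) by (simp add: algebra_simps)
  then show 1: "gauss \<alpha> (z + h) \<le> exp (2 * \<alpha> * cmod z) * gauss \<alpha> z"
    unfolding gauss_def exp_add[symmetric] by simp
  have "\<bar>gauss \<alpha> (z + h) - gauss \<alpha> z\<bar>
      \<le> \<bar>- \<alpha> * (cmod (z + h))\<^sup>2 - (- \<alpha> * (cmod z)\<^sup>2)\<bar> * exp (max (- \<alpha> * (cmod (z + h))\<^sup>2) (- \<alpha> * (cmod z)\<^sup>2))"
    unfolding gauss_def by (rule abs_exp_diff_le)
  also have "\<dots> \<le> (\<alpha> * (cmod h * exp (2 * cmod z))) * exp (2 * \<alpha> * cmod z + (- \<alpha> * (cmod z)\<^sup>2))"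
  proof (rule mult_mono)
    have eq: "- \<alpha> * (cmod (z + h))\<^sup>2 - (- \<alpha> * (cmod z)\<^sup>2) = \<alpha> * ((cmod z - cmod (z + h)) * (cmod z + cmod (z + h)))"
      by (simp add: algebra_simps power2_eq_square)
    have "\<bar>- \<alpha> * (cmod (z + h))\<^sup>2 - (- \<alpha> * (cmod z)\<^sup>2)\<bar>
        = \<alpha> * (\<bar>cmod z - cmod (z + h)\<bar> * (cmod z + cmod (z + h)))"
      unfolding eq abs_mult using assms(1) by simp
    also have "\<dots> \<le> \<alpha> * (cmod h * (1 + 2 * cmod z))"
      using t1 assms by (intro mult_left_mono mult_mono) auto
    also have "\<dots> \<le> \<alpha> * (cmod h * exp (2 * cmod z))"
      using assms(1) by (intro mult_left_mono exp_ge_add_one_self) auto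
    finally show "\<bar>- \<alpha> * (cmod (z + h))\<^sup>2 - (- \<alpha> * (cmod z)\<^sup>2)\<bar> \<le> \<alpha> * (cmod h * exp (2 * cmod z))" .
    show "exp (max (- \<alpha> * (cmod (z + h))\<^sup>2) (- \<alpha> * (cmod z)\<^sup>2)) \<le> exp (2 * \<alpha> * cmod z + (- \<alpha> * (cmod z)\<^sup>2))"
      using ex assms(1) by simp
  qed (use assms in auto)
  also have "\<dots> = cmod h * (\<alpha> * exp ((2 + 2 * \<alpha>) * cmod z) * gauss \<alpha> z)"
    unfolding gauss_def distrib_right exp_add by (simp only: mult_ac)
  finally show "\<bar>gauss \<alpha> (z + h) - gauss \<alpha> z\<bar> \<le> cmod h * (\<alpha> * exp ((2 + 2 * \<alpha>) * cmod z) * gauss \<alpha> z)" .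
qed

lemma tame_gauss_lipschitz:
  assumes "\<alpha> > 0" "tame g"
  shows "\<exists>A B. \<forall>z h. cmod h \<le> 1 \<longrightarrow>
    cmod (g (z + h) * of_real (gauss \<alpha> (z + h)) - g z * of_real (gauss \<alpha> z))
      \<le> cmod h * (A * (exp (B * cmod z) * gauss \<alpha> z))"
proof -
  obtain A B where g: "A \<ge> 0" "B \<ge> 0" "\<And>z. cmod (g z) \<le> A * exp (B * cmod z)"
    "\<And>z w. cmod (z - w) \<le> 1 \<Longrightarrow> cmod (g z - g w) \<le> A * exp (B * cmod z) * cmod (z - w)"
    using assms(2) by (rule tameE) blast
  have "cmod (g (z + h) * of_real (gauss \<alpha> (z + h)) - g z * of_real (gauss \<alpha> z))
      \<le> cmod h * ((A * (1 + \<alpha>)) * (exp ((B + 2 + 2 * \<alpha>) * cmod z) * gauss \<alpha> z))"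
    if h: "cmod h \<le> 1" for z h
  proof -
    have "g (z + h) * of_real (gauss \<alpha> (z + h)) - g z * of_real (gauss \<alpha> z)
      = (g (z + h) - g z) * of_real (gauss \<alpha> (z + h)) + g z * of_real (gauss \<alpha> (z + h) - gauss \<alpha> z)"
      by (simp add: algebra_simps)
    then have "cmod (g (z + h) * of_real (gauss \<alpha> (z + h)) - g z * of_real (gauss \<alpha> z))
      \<le> cmod (g (z + h) - g z) * gauss \<alpha> (z + h) + cmod (g z) * \<bar>gauss \<alpha> (z + h) - gauss \<alpha> z\<bar>"
      by (smt (verit) norm_triangle_ineq norm_mult norm_of_real gauss_pos)
    also have "\<dots> \<le> (A * exp (B * cmod z) * cmod h) * (exp (2 * \<alpha> * cmod z) * gauss \<alpha> z)
        + (A * exp (B * cmod z)) * (cmod h * (\<alpha> * exp ((2 + 2 * \<alpha>) * cmod z) * gauss \<alpha> z))"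
    proof (intro add_mono mult_mono g(3) gauss_shift[OF assms(1) h])
      show "cmod (g (z + h) - g z) \<le> A * exp (B * cmod z) * cmod h"
        using g(4)[of z "z + h"] h by (simp add: norm_minus_commute)
    qed (use g in auto)
    also have "\<dots> \<le> (A * exp (B * cmod z) * cmod h) * (exp ((2 + 2 * \<alpha>) * cmod z) * gauss \<alpha> z)
        + (A * exp (B * cmod z)) * (cmod h * (\<alpha> * exp ((2 + 2 * \<alpha>) * cmod z) * gauss \<alpha> z))"
      using g(1) by (intro add_right_mono mult_left_mono mult_right_mono)
        (auto simp: gauss_pos less_imp_le mult_right_mono)
    also have "\<dots> = cmod h * ((A * (1 + \<alpha>)) * (exp (B * cmod z + (2 + 2 * \<alpha>) * cmod z) * gauss \<alpha> z))"
      unfolding exp_add by (simp add: algebra_simps)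
    also have "B * cmod z + (2 + 2 * \<alpha>) * cmod z = (B + 2 + 2 * \<alpha>) * cmod z"
      by (simp add: algebra_simps)
    finally show ?thesis .
  qed
  then show ?thesis by blast
qed

lemma has_wirtinger_gauss:
  "has_wirtinger (\<lambda>z. of_real (gauss \<alpha> z)) (- of_real \<alpha> * cnj z * of_real (gauss \<alpha> z))
     (- of_real \<alpha> * z * of_real (gauss \<alpha> z)) z"
proof -
  have 1: "has_wirtinger (\<lambda>z. - of_real \<alpha> * z) (- of_real \<alpha>) 0 z"
    using has_wirtinger_mult[OF has_wirtinger_const[of "- of_real \<alpha>"] has_wirtinger_ident] by simp
  have 2: "has_wirtinger cnj 0 1 z"
    using has_wirtinger_cnj[OF has_wirtinger_ident] by simp
  have 3: "has_wirtinger (\<lambda>z. - of_real \<alpha> * z * cnj z) (- of_real \<alpha> * cnj z) (- of_real \<alpha> * z) z"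
    using has_wirtinger_mult[OF 1 2] by simp
  show ?thesis
    using has_wirtinger_holomorphic_compose[OF DERIV_exp 3]
    unfolding of_real_gauss by (simp add: mult.commute)
qed

lemma has_wirtinger_difference_quotient:
  assumes "has_wirtinger G a b z"
  shows "(\<lambda>n. of_real (real (Suc n)) * (G (z + c * of_real (1 / real (Suc n))) - G z)) \<longlonglongrightarrow> a * c + b * cnj c"
proof (cases "c = 0")
  case False
  define h where "h = (\<lambda>n. c * of_real (1 / real (Suc n)))"
  have "((\<lambda>h. cmod (G (z + h) - G z - (a * h + b * cnj h)) / cmod h) \<longlongrightarrow> 0) (at 0)"
    using assms unfolding has_wirtinger_def has_derivative_at by simp
  moreover have "filterlim h (at 0) sequentially"
  proof (rule filterlim_atI)
    have "(\<lambda>n. c * of_real (inverse (real (Suc n)))) \<longlonglongrightarrow> c * of_real 0"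
      by (intro tendsto_intros LIMSEQ_inverse_real_of_nat)
    then show "h \<longlonglongrightarrow> 0" by (simp add: h_def inverse_eq_divide)
    show "\<forall>\<^sub>F n in sequentially. h n \<noteq> 0" using False by (simp add: h_def del: of_nat_Suc)
  qed
  ultimately have "(\<lambda>n. cmod (G (z + h n) - G z - (a * h n + b * cnj (h n))) / cmod (h n)) \<longlonglongrightarrow> 0"
    by (rule filterlim_compose)
  then have "(\<lambda>n. cmod c * (cmod (G (z + h n) - G z - (a * h n + b * cnj (h n))) / cmod (h n))) \<longlonglongrightarrow> cmod c * 0"
    by (intro tendsto_intros)
  moreover have "cmod c * (cmod (G (z + h n) - G z - (a * h n + b * cnj (h n))) / cmod (h n))
      = cmod (of_real (real (Suc n)) * (G (z + h n) - G z) - (a * c + b * cnj c))" for n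
  proof -
    have hn: "of_real (real (Suc n)) * h n = c" by (simp add: h_def del: of_nat_Suc)
    then have chn: "of_real (real (Suc n)) * cnj (h n) = cnj c"
      by (metis complex_cnj_complex_of_real complex_cnj_mult)
    have "of_real (real (Suc n)) * (G (z + h n) - G z) - (a * c + b * cnj c)
      = of_real (real (Suc n)) * (G (z + h n) - G z - (a * h n + b * cnj (h n)))"
      unfolding hn[symmetric] chn[symmetric] by (simp add: algebra_simps)
    then have "cmod (of_real (real (Suc n)) * (G (z + h n) - G z) - (a * c + b * cnj c))
      = real (Suc n) * cmod (G (z + h n) - G z - (a * h n + b * cnj (h n)))"
      by (simp only: norm_mult norm_of_real abs_of_nat)
    moreover have "cmod (h n) = cmod c / real (Suc n)"
      by (simp add: h_def norm_mult norm_divide del: of_nat_Suc)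
    ultimately show ?thesis using False by (simp del: of_nat_Suc)
  qed
  ultimately have "(\<lambda>n. cmod (of_real (real (Suc n)) * (G (z + h n) - G z) - (a * c + b * cnj c))) \<longlonglongrightarrow> 0"
    by simp
  then have "(\<lambda>n. of_real (real (Suc n)) * (G (z + h n) - G z) - (a * c + b * cnj c)) \<longlonglongrightarrow> 0"
    by (rule tendsto_norm_zero_cancel)
  then show ?thesis unfolding h_def by (rule LIM_zero_cancel)
qed simp

text \<open>The integrand is $\bar\partial(g\, e^{-\alpha|z|^2})$. By translation invariance every
  difference quotient of \<open>g * gauss \<alpha>\<close> has integral zero, and these quotients converge almost
  everywhere under the majorant given by tameness.\<close>
lemma integral_dbar_eq_0:
  assumes \<alpha>: "\<alpha> > 0" and g: "tame g" and b [measurable]: "b \<in> borel_measurable borel"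
    and d: "AE z in lborel. has_dbar g (b z) z"
  shows "integrable lborel (\<lambda>z. (b z - of_real \<alpha> * z * g z) * of_real (gauss \<alpha> z))"
    and "(LINT z|lborel. (b z - of_real \<alpha> * z * g z) * of_real (gauss \<alpha> z)) = 0"
proof -
  define G where "G = (\<lambda>z. g z * of_real (gauss \<alpha> z))"
  define G' where "G' = (\<lambda>z. (b z - of_real \<alpha> * z * g z) * of_real (gauss \<alpha> z))"
  note [measurable] = tame_measurable[OF g]
  have Gm [measurable]: "G \<in> borel_measurable borel" "G' \<in> borel_measurable borel"
    unfolding G_def G'_def by measurable
  have Gi: "integrable lborel G" unfolding G_def by (rule tame_integrable_gauss[OF \<alpha> g])
  obtain A B where AB: "\<And>z h. cmod h \<le> 1 \<Longrightarrow>
    cmod (G (z + h) - G z) \<le> cmod h * (A * (exp (B * cmod z) * gauss \<alpha> z))"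
    using tame_gauss_lipschitz[OF \<alpha> g] unfolding G_def by blast
  define X where "X = (\<lambda>c n z. of_real (real (Suc n)) * (G (z + c * of_real (1 / real (Suc n))) - G z))"
  \<comment> \<open>the combination of the quotients in the directions 1 and \<open>\<i>\<close> that tends to the d-bar derivative\<close>
  define D where "D = (\<lambda>n z. (X 1 n z + \<i> * X \<i> n z) / 2)"
  define M where "M = (\<lambda>z. A * (exp (B * cmod z) * gauss \<alpha> z))"
  have [measurable]: "X c n \<in> borel_measurable borel" "D n \<in> borel_measurable borel" for c n
    unfolding D_def X_def by measurable
  have Xi: "integrable lborel (X c n)" "(LINT z|lborel. X c n z) = 0" for c n
    using Gi lborel_translation[of G "c * of_real (1 / real (Suc n))"] unfolding X_def by simp_all
  have Xb: "cmod (X c n z) \<le> M z" if "cmod c = 1" for c n z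
  proof -
    have "cmod (X c n z) = real (Suc n) * cmod (G (z + c * of_real (1 / real (Suc n))) - G z)"
      unfolding X_def norm_mult by (simp del: of_nat_Suc)
    also have "\<dots> \<le> real (Suc n) * (1 / real (Suc n) * M z)"
      using AB[of "c * of_real (1 / real (Suc n))" z] that
      by (intro mult_left_mono) (auto simp: norm_mult norm_divide M_def simp del: of_nat_Suc)
    finally show ?thesis by simp
  qed
  have Db: "cmod (D n z) \<le> M z" for n z
  proof -
    have "cmod (X 1 n z + \<i> * X \<i> n z) \<le> M z + M z"
      using norm_triangle_ineq[of "X 1 n z" "\<i> * X \<i> n z"] Xb[of 1 n z] Xb[of \<i> n z]
      by (simp add: norm_mult)
    then show ?thesis by (simp add: D_def norm_divide)
  qed
  have Mi: "integrable lborel M" unfolding M_def by (intro integrable_mult_right integrable_exp_gauss \<alpha>)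
  have conv: "AE z in lborel. (\<lambda>n. D n z) \<longlonglongrightarrow> G' z"
    using d
  proof eventually_elim
    case (elim z)
    then obtain a where "has_wirtinger g a (b z) z" unfolding has_dbar_def by auto
    from has_wirtinger_mult[OF this has_wirtinger_gauss[of \<alpha>]]
    obtain a' where w: "has_wirtinger G a' (G' z) z"
      unfolding G_def G'_def by (auto simp: algebra_simps)
    have "(\<lambda>n. (X 1 n z + \<i> * X \<i> n z) / 2) \<longlonglongrightarrow> ((a' * 1 + G' z * cnj 1) + \<i> * (a' * \<i> + G' z * cnj \<i>)) / 2"
      unfolding X_def by (intro tendsto_intros has_wirtinger_difference_quotient[OF w]) simp
    then show ?case by (simp add: D_def algebra_simps)
  qed
  have "integrable lborel G'"
    by (rule integrable_dominated_convergence[where s=D and w=M]) (use Mi conv Db in auto)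
  then show "integrable lborel (\<lambda>z. (b z - of_real \<alpha> * z * g z) * of_real (gauss \<alpha> z))"
    by (simp add: G'_def)
  have "(\<lambda>n. LINT z|lborel. D n z) \<longlonglongrightarrow> (LINT z|lborel. G' z)"
    by (rule integral_dominated_convergence[where w=M]) (use Mi conv Db in auto)
  moreover have "(LINT z|lborel. D n z) = 0" for n
    unfolding D_def using Xi by simp
  ultimately have "(LINT z|lborel. G' z) = 0" by (simp add: LIMSEQ_const_iff)
  then show "(LINT z|lborel. (b z - of_real \<alpha> * z * g z) * of_real (gauss \<alpha> z)) = 0"
    by (simp add: G'_def)
qed

section \<open>Radial cutoffs\<close>

definition ramp :: "real \<Rightarrow> real \<Rightarrow> complex \<Rightarrow> real" where
  "ramp a c z = max 0 (min 1 ((a + c - cmod z) / c))"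

text \<open>The value on the two circles where \<open>ramp\<close> has corners is immaterial; zero keeps the function
  measurable and supported in the closed annulus.\<close>
definition dbar_ramp :: "real \<Rightarrow> real \<Rightarrow> complex \<Rightarrow> complex" where
  "dbar_ramp a c z = (if a < cmod z \<and> cmod z < a + c then - z / of_real (2 * c * cmod z) else 0)"

lemma ramp_nonneg: "0 \<le> ramp a c z" and ramp_le_1: "ramp a c z \<le> 1"
  by (auto simp: ramp_def)

lemma ramp_eq_1: "c > 0 \<Longrightarrow> cmod z \<le> a \<Longrightarrow> ramp a c z = 1"
  by (simp add: ramp_def min_def max_def field_simps)

lemma ramp_eq_0: "c > 0 \<Longrightarrow> a + c \<le> cmod z \<Longrightarrow> ramp a c z = 0"
  by (simp add: ramp_def min_def max_def field_simps)

lemma ramp_lipschitz: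
  assumes "c > 0" shows "\<bar>ramp a c z - ramp a c w\<bar> \<le> cmod (z - w) / c"
proof -
  have "\<bar>ramp a c z - ramp a c w\<bar> \<le> \<bar>(a + c - cmod z) / c - (a + c - cmod w) / c\<bar>"
    unfolding ramp_def by (auto simp: min_def max_def)
  also have "\<dots> = \<bar>cmod w - cmod z\<bar> / c"
    using assms by (simp add: diff_divide_distrib[symmetric])
  also have "\<dots> \<le> cmod (z - w) / c"
    using assms norm_triangle_ineq3[of w z] by (simp add: divide_right_mono norm_minus_commute)
  finally show ?thesis .
qed

lemma tame_ramp: assumes "c > 0" shows "tame (\<lambda>z. of_real (ramp a c z))"
proof (rule tameI)
  fix z show "cmod (of_real (ramp a c z)) \<le> 1 * exp (0 * cmod z)"
    using ramp_nonneg[of a c z] ramp_le_1[of a c z] by simp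
next
  fix z w assume "cmod (z - w) \<le> 1"
  show "cmod (of_real (ramp a c z) - of_real (ramp a c w)) \<le> (1 / c) * exp (0 * cmod z) * cmod (z - w)"
    using ramp_lipschitz[OF assms, of a z w] by (simp flip: of_real_diff)
qed

lemma has_wirtinger_cmod:
  assumes "z \<noteq> 0"
  shows "has_wirtinger (\<lambda>z. of_real (cmod z)) (cnj z / of_real (2 * cmod z)) (z / of_real (2 * cmod z)) z"
proof -
  have "(norm has_derivative (\<lambda>h. h \<bullet> sgn z)) (at z)"
    using has_derivative_norm[OF assms] by simp
  then have "((\<lambda>z. complex_of_real (cmod z)) has_derivative (\<lambda>h. of_real (h \<bullet> sgn z))) (at z)"
    by (rule has_derivative_of_real)
  moreover have "complex_of_real (h \<bullet> sgn z) = cnj z / of_real (2 * cmod z) * h + z / of_real (2 * cmod z) * cnj h" for h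
  proof -
    have "complex_of_real (h \<bullet> sgn z) = of_real ((h \<bullet> z) / cmod z)"
      by (simp add: sgn_div_norm inverse_eq_divide)
    also have "complex_of_real ((h \<bullet> z) / cmod z) = (h * cnj z + cnj h * z) / 2 / of_real (cmod z)"
    proof -
      have e: "of_real (h \<bullet> z) = (h * cnj z + cnj h * z) / 2"
        by (simp add: complex_eq_iff inner_complex_def)
      show ?thesis by (simp only: of_real_divide e)
    qed
    also have "\<dots> = cnj z / of_real (2 * cmod z) * h + z / of_real (2 * cmod z) * cnj h"
      using assms by (simp add: field_simps)
    finally show ?thesis .
  qed
  ultimately show ?thesis by (simp add: has_wirtinger_def)
qed

lemma has_dbar_ramp:
  assumes "c > 0" "a \<ge> 0" "cmod z \<noteq> a" "cmod z \<noteq> a + c"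
  shows "has_dbar (\<lambda>z. of_real (ramp a c z)) (dbar_ramp a c z) z"
proof -
  consider "cmod z < a" | "a + c < cmod z" | "a < cmod z" "cmod z < a + c" using assms by linarith
  then show ?thesis
  proof cases
    case 1
    have "has_dbar (\<lambda>_. 1) 0 z" unfolding has_dbar_def using has_wirtinger_const by blast
    then have "has_dbar (\<lambda>z. of_real (ramp a c z)) 0 z"
      by (rule has_dbar_eq_near[where U="ball 0 a"]) (use 1 ramp_eq_1[OF assms(1)] in auto)
    then show ?thesis using 1 by (simp add: dbar_ramp_def)
  next
    case 2
    have "has_dbar (\<lambda>_. 0) 0 z" unfolding has_dbar_def using has_wirtinger_const by blast
    then have "has_dbar (\<lambda>z. of_real (ramp a c z)) 0 z"
      by (rule has_dbar_eq_near[where U="- cball 0 (a + c)"]) (use 2 ramp_eq_0[OF assms(1)] in auto)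
    then show ?thesis using 2 by (simp add: dbar_ramp_def)
  next
    case 3
    have z: "z \<noteq> 0" using 3 assms by auto
    have "has_wirtinger (\<lambda>z. of_real ((a + c) / c) + (- 1 / of_real c) * of_real (cmod z))
      (0 + (0 * of_real (cmod z) + (- 1 / of_real c) * (cnj z / of_real (2 * cmod z))))
      (0 + (0 * of_real (cmod z) + (- 1 / of_real c) * (z / of_real (2 * cmod z)))) z"
      by (intro has_wirtinger_add has_wirtinger_mult has_wirtinger_const has_wirtinger_cmod z)
    then have "has_dbar (\<lambda>z. of_real ((a + c) / c) + (- 1 / of_real c) * of_real (cmod z)) (dbar_ramp a c z) z"
      unfolding has_dbar_def using 3 by (auto simp: dbar_ramp_def mult_ac)
    then show ?thesis
    proof (rule has_dbar_eq_near[where U="ball 0 (a + c) - cball 0 a"])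
      fix w assume "w \<in> ball 0 (a + c) - cball (0::complex) a"
      then have "ramp a c w = (a + c) / c + (- 1 / c) * cmod w"
        using assms by (simp add: ramp_def field_simps)
      then show "of_real ((a + c) / c) + (- 1 / of_real c) * of_real (cmod w) = complex_of_real (ramp a c w)"
        by simp
    qed (use 3 in auto)
  qed
qed

lemma dbar_ramp_measurable [measurable]: "dbar_ramp a c \<in> borel_measurable borel"
  unfolding dbar_ramp_def[abs_def] by measurable

lemma dbar_ramp_eq_0: "cmod z \<le> a \<or> a + c \<le> cmod z \<Longrightarrow> dbar_ramp a c z = 0"
  by (auto simp: dbar_ramp_def)

lemma cmod_dbar_ramp: assumes "c > 0" shows "cmod (dbar_ramp a c z) \<le> 1 / (2 * c)"
proof (cases "z = 0")
  case False
  then show ?thesis using assms by (simp add: dbar_ramp_def norm_divide norm_mult)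
qed (use assms in \<open>simp add: dbar_ramp_def\<close>)

lemma AE_not_on_circle: "AE z in lborel. cmod (z - l) \<noteq> r"
proof (rule AE_I')
  have "negligible (sphere l r)" by (rule negligible_sphere)
  then have "sphere l r \<in> null_sets lebesgue" by (simp add: negligible_iff_null_sets)
  then show "sphere l r \<in> null_sets lborel"
    by (simp add: null_sets_completion_iff null_sets_completion_iff2[symmetric])
  show "{z \<in> space lborel. \<not> cmod (z - l) \<noteq> r} \<subseteq> sphere l r"
    by (auto simp: dist_norm norm_minus_commute)
qed

text \<open>This brings an arbitrary entire function, of whatever growth, into the scope of the integration
  by parts.\<close>
lemma tame_holomorphic_mult_ramp:
  assumes "f holomorphic_on UNIV" "c > 0" "a \<ge> 0"
  shows "tame (\<lambda>z. f z * of_real (ramp a c z))"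
proof -
  define S where "S = cball (0::complex) (a + c + 1)"
  have fS: "continuous_on S f" "continuous_on S (deriv f)"
    using assms(1) holomorphic_deriv[OF assms(1)]
    by (auto intro!: holomorphic_on_imp_continuous_on intro: holomorphic_on_subset)
  have "bounded (f ` S)"
    by (rule compact_imp_bounded[OF compact_continuous_image[OF fS(1)]]) (simp add: S_def)
  then obtain M where M: "\<And>z. z \<in> S \<Longrightarrow> cmod (f z) \<le> M"
    unfolding bounded_iff by blast
  have "bounded (deriv f ` S)"
    by (rule compact_imp_bounded[OF compact_continuous_image[OF fS(2)]]) (simp add: S_def)
  then obtain L where L: "\<And>z. z \<in> S \<Longrightarrow> cmod (deriv f z) \<le> L"
    unfolding bounded_iff by blast
  have "0 \<in> S" using assms by (simp add: S_def)
  then have nn: "M \<ge> 0" "L \<ge> 0" using M L norm_ge_zero order_trans by blast+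
  have lip: "cmod (f z - f w) \<le> L * cmod (z - w)" if "z \<in> S" "w \<in> S" for z w
  proof (rule field_differentiable_bound[where S=S])
    fix u assume "u \<in> S"
    show "(f has_field_derivative deriv f u) (at u within S)"
      using holomorphic_derivI[OF assms(1), of u] by (auto intro: has_field_derivative_at_within)
  qed (use that L in \<open>auto simp: S_def\<close>)
  show ?thesis
  proof (rule tameI)
    fix z
    show "cmod (f z * of_real (ramp a c z)) \<le> M * exp (0 * cmod z)"
    proof (cases "z \<in> S")
      case True
      have "cmod (f z * of_real (ramp a c z)) \<le> M * 1"
        unfolding norm_mult using M[OF True] ramp_le_1[of a c z] ramp_nonneg[of a c z] nn
        by (intro mult_mono) auto
      then show ?thesis by simp
    next
      case False
      then show ?thesis using ramp_eq_0[OF assms(2), of a z] nn by (simp add: S_def)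
    qed
  next
    fix z w :: complex assume zw: "cmod (z - w) \<le> 1"
    show "cmod (f z * of_real (ramp a c z) - f w * of_real (ramp a c w)) \<le> (L + M / c) * exp (0 * cmod z) * cmod (z - w)"
    proof (cases "cmod z < a + c \<or> cmod w < a + c")
      case True
      then have S: "z \<in> S" "w \<in> S"
        using zw norm_triangle_sub[of z w] norm_triangle_sub[of w z] by (auto simp: S_def norm_minus_commute)
      have "f z * of_real (ramp a c z) - f w * of_real (ramp a c w)
          = (f z - f w) * of_real (ramp a c z) + f w * of_real (ramp a c z - ramp a c w)"
        by (simp add: algebra_simps)
      then have "cmod (f z * of_real (ramp a c z) - f w * of_real (ramp a c w))
          \<le> cmod (f z - f w) * ramp a c z + cmod (f w) * \<bar>ramp a c z - ramp a c w\<bar>"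
        by (smt (verit) norm_triangle_ineq norm_mult norm_of_real ramp_nonneg)
      also have "\<dots> \<le> (L * cmod (z - w)) * 1 + M * (cmod (z - w) / c)"
        using lip[OF S] M[OF S(2)] nn ramp_le_1 ramp_nonneg ramp_lipschitz[OF assms(2)]
        by (intro add_mono mult_mono) auto
      also have "\<dots> = (L + M / c) * exp (0 * cmod z) * cmod (z - w)" by (simp add: algebra_simps)
      finally show ?thesis .
    next
      case False
      then show ?thesis using ramp_eq_0[OF assms(2), of a] nn assms by simp
    qed
  qed
qed

section \<open>Taylor coefficients in the Fock space\<close>

lemma cnj_measurable [measurable]: "cnj \<in> borel_measurable borel"
  by (intro borel_measurable_continuous_onI continuous_intros)

lemma fock_space_iff:
  "f \<in> fock_space \<alpha> \<longleftrightarrow> f holomorphic_on UNIV \<and> integrable lborel (\<lambda>z. (cmod (f z))\<^sup>2 * gauss \<alpha> z)"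
  by (simp add: fock_space_def gauss_def)

lemma fock_inner_gauss:
  "fock_inner \<alpha> f g = of_real (\<alpha> / pi) * (LINT z|lborel. f z * cnj (g z) * of_real (gauss \<alpha> z))"
  by (simp add: fock_inner_def gauss_def)

lemma holomorphic_measurable:
  "f holomorphic_on UNIV \<Longrightarrow> f \<in> borel_measurable borel"
  by (intro borel_measurable_continuous_onI holomorphic_on_imp_continuous_on)

lemma fock_space_measurable: "f \<in> fock_space \<alpha> \<Longrightarrow> f \<in> borel_measurable borel"
  using holomorphic_measurable by (auto simp: fock_space_iff)

lemma square_integrable_mult:
  fixes f g :: "complex \<Rightarrow> complex"
  assumes [measurable]: "f \<in> borel_measurable borel" "g \<in> borel_measurable borel"
    and "integrable lborel (\<lambda>z. (cmod (f z))\<^sup>2 * gauss \<alpha> z)"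
    and "integrable lborel (\<lambda>z. (cmod (g z))\<^sup>2 * gauss \<alpha> z)"
  shows "integrable lborel (\<lambda>z. f z * g z * of_real (gauss \<alpha> z))"
proof (rule Bochner_Integration.integrable_bound)
  show "integrable lborel (\<lambda>z. (cmod (f z))\<^sup>2 * gauss \<alpha> z + (cmod (g z))\<^sup>2 * gauss \<alpha> z)"
    using assms by (intro Bochner_Integration.integrable_add)
  show "AE z in lborel. norm (f z * g z * of_real (gauss \<alpha> z))
      \<le> norm ((cmod (f z))\<^sup>2 * gauss \<alpha> z + (cmod (g z))\<^sup>2 * gauss \<alpha> z)"
  proof (rule AE_I2)
    fix z
    have "0 \<le> (cmod (f z) - cmod (g z))\<^sup>2" by simp
    then have "2 * (cmod (f z) * cmod (g z)) \<le> (cmod (f z))\<^sup>2 + (cmod (g z))\<^sup>2"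
      by (simp add: power2_diff)
    moreover have "0 \<le> cmod (f z) * cmod (g z)" by simp
    ultimately have "cmod (f z) * cmod (g z) \<le> (cmod (f z))\<^sup>2 + (cmod (g z))\<^sup>2" by linarith
    then have "cmod (f z) * cmod (g z) * gauss \<alpha> z \<le> ((cmod (f z))\<^sup>2 + (cmod (g z))\<^sup>2) * gauss \<alpha> z"
      by (intro mult_right_mono) auto
    then show "norm (f z * g z * of_real (gauss \<alpha> z))
      \<le> norm ((cmod (f z))\<^sup>2 * gauss \<alpha> z + (cmod (g z))\<^sup>2 * gauss \<alpha> z)"
      by (simp add: norm_mult distrib_right)
  qed
qed measurable

lemma tame_square_integrable:
  assumes "\<alpha> > 0" "tame f"
  shows "integrable lborel (\<lambda>z. (cmod (f z))\<^sup>2 * gauss \<alpha> z)"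
proof -
  have "integrable lborel (\<lambda>z. (f z * cnj (f z)) * of_real (gauss \<alpha> z))"
    by (intro tame_integrable_gauss assms tame_mult tame_cnj)
  then have "integrable lborel (\<lambda>z. complex_of_real ((cmod (f z))\<^sup>2 * gauss \<alpha> z))"
    by (simp flip: complex_norm_square)
  then show ?thesis by (simp only: complex_of_real_integrable_eq)
qed

lemma fock_space_tame:
  "\<alpha> > 0 \<Longrightarrow> tame f \<Longrightarrow> f holomorphic_on UNIV \<Longrightarrow> f \<in> fock_space \<alpha>"
  by (simp add: fock_space_iff tame_square_integrable)

lemma fock_space_add:
  assumes "f \<in> fock_space \<alpha>" "g \<in> fock_space \<alpha>"
  shows "(\<lambda>z. f z + g z) \<in> fock_space \<alpha>"
  unfolding fock_space_iff
proof
  show "(\<lambda>z. f z + g z) holomorphic_on UNIV"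
    using assms by (auto simp: fock_space_iff intro: holomorphic_intros)
  note [measurable] = assms[THEN fock_space_measurable]
  show "integrable lborel (\<lambda>z. (cmod (f z + g z))\<^sup>2 * gauss \<alpha> z)"
  proof (rule Bochner_Integration.integrable_bound)
    show "integrable lborel (\<lambda>z. 2 * ((cmod (f z))\<^sup>2 * gauss \<alpha> z) + 2 * ((cmod (g z))\<^sup>2 * gauss \<alpha> z))"
      using assms by (auto simp: fock_space_iff)
    show "AE z in lborel. norm ((cmod (f z + g z))\<^sup>2 * gauss \<alpha> z)
      \<le> norm (2 * ((cmod (f z))\<^sup>2 * gauss \<alpha> z) + 2 * ((cmod (g z))\<^sup>2 * gauss \<alpha> z))"
    proof (rule AE_I2)
      fix z
      have "(cmod (f z + g z))\<^sup>2 \<le> (cmod (f z) + cmod (g z))\<^sup>2"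
        by (intro power_mono norm_triangle_ineq) simp
      also have "\<dots> \<le> 2 * (cmod (f z))\<^sup>2 + 2 * (cmod (g z))\<^sup>2"
        using sum_squares_bound[of "cmod (f z)" "cmod (g z)"] by (simp add: power2_sum)
      finally have "(cmod (f z + g z))\<^sup>2 * gauss \<alpha> z \<le> (2 * (cmod (f z))\<^sup>2 + 2 * (cmod (g z))\<^sup>2) * gauss \<alpha> z"
        by (intro mult_right_mono) auto
      then show "norm ((cmod (f z + g z))\<^sup>2 * gauss \<alpha> z)
        \<le> norm (2 * ((cmod (f z))\<^sup>2 * gauss \<alpha> z) + 2 * ((cmod (g z))\<^sup>2 * gauss \<alpha> z))"
        by (simp add: algebra_simps)
    qed
  qed measurable
qed

lemma fock_space_cmult:
  assumes "f \<in> fock_space \<alpha>" shows "(\<lambda>z. c * f z) \<in> fock_space \<alpha>"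
  using assms
  by (auto simp: fock_space_iff norm_mult power_mult_distrib mult.assoc intro!: holomorphic_intros)

lemma fock_space_sum:
  assumes "\<And>i. i \<in> I \<Longrightarrow> f i \<in> fock_space \<alpha>"
  shows "(\<lambda>z. \<Sum>i\<in>I. f i z) \<in> fock_space \<alpha>"
  using assms
proof (induction I rule: infinite_finite_induct)
  case (insert x F)
  then show ?case using fock_space_add[of "f x" \<alpha> "\<lambda>z. \<Sum>i\<in>F. f i z"] by simp
qed (simp_all add: fock_space_iff)

lemma fock_space_diff:
  assumes "f \<in> fock_space \<alpha>" "g \<in> fock_space \<alpha>"
  shows "(\<lambda>z. f z - g z) \<in> fock_space \<alpha>"
  using fock_space_add[OF assms(1) fock_space_cmult[OF assms(2), of "-1"]] by simp

lemma fock_inner_integrable: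
  assumes "f \<in> fock_space \<alpha>" "g \<in> fock_space \<alpha>"
  shows "integrable lborel (\<lambda>z. f z * cnj (g z) * of_real (gauss \<alpha> z))"
proof -
  note [measurable] = assms[THEN fock_space_measurable]
  show ?thesis using assms by (intro square_integrable_mult) (simp_all add: fock_space_iff)
qed

lemma fock_inner_sum_left:
  assumes "\<And>i. i \<in> I \<Longrightarrow> f i \<in> fock_space \<alpha>" "g \<in> fock_space \<alpha>"
  shows "fock_inner \<alpha> (\<lambda>z. \<Sum>i\<in>I. c i * f i z) g = (\<Sum>i\<in>I. c i * fock_inner \<alpha> (f i) g)"
proof -
  have "(LINT z|lborel. (\<Sum>i\<in>I. c i * f i z) * cnj (g z) * of_real (gauss \<alpha> z))
      = (LINT z|lborel. (\<Sum>i\<in>I. c i * (f i z * cnj (g z) * of_real (gauss \<alpha> z))))"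
    by (simp add: sum_distrib_right mult.assoc)
  also have "\<dots> = (\<Sum>i\<in>I. c i * (LINT z|lborel. f i z * cnj (g z) * of_real (gauss \<alpha> z)))"
    using fock_inner_integrable assms by (subst Bochner_Integration.integral_sum) auto
  finally show ?thesis
    unfolding fock_inner_gauss by (simp add: sum_distrib_left mult.left_commute)
qed

lemma fock_inner_commute: "fock_inner \<alpha> g f = cnj (fock_inner \<alpha> f g)"
  using Bochner_Integration.integral_cnj[of lborel "\<lambda>z. f z * cnj (g z) * of_real (gauss \<alpha> z)"]
  unfolding fock_inner_gauss by (simp add: mult.commute)

lemma fock_inner_sum_right:
  assumes "\<And>i. i \<in> I \<Longrightarrow> f i \<in> fock_space \<alpha>" "g \<in> fock_space \<alpha>"
  shows "fock_inner \<alpha> g (\<lambda>z. \<Sum>i\<in>I. c i * f i z) = (\<Sum>i\<in>I. cnj (c i) * fock_inner \<alpha> g (f i))"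
  by (subst fock_inner_commute, subst fock_inner_sum_left) (use assms in \<open>auto simp: fock_inner_commute[of _ g]\<close>)

lemma fock_inner_diff_left:
  assumes "f \<in> fock_space \<alpha>" "h \<in> fock_space \<alpha>" "g \<in> fock_space \<alpha>"
  shows "fock_inner \<alpha> (\<lambda>z. f z - h z) g = fock_inner \<alpha> f g - fock_inner \<alpha> h g"
  unfolding fock_inner_gauss using fock_inner_integrable assms
  by (simp add: left_diff_distrib right_diff_distrib)

definition fock_normsq :: "real \<Rightarrow> (complex \<Rightarrow> complex) \<Rightarrow> real" where
  "fock_normsq \<alpha> f = \<alpha> / pi * (LINT z|lborel. (cmod (f z))\<^sup>2 * gauss \<alpha> z)"

lemma fock_inner_self: "fock_inner \<alpha> f f = of_real (fock_normsq \<alpha> f)"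
proof -
  have "(\<lambda>z. f z * cnj (f z) * of_real (gauss \<alpha> z)) = (\<lambda>z. complex_of_real ((cmod (f z))\<^sup>2 * gauss \<alpha> z))"
    by (simp flip: complex_norm_square)
  then show ?thesis unfolding fock_inner_gauss fock_normsq_def of_real_mult[of "\<alpha> / pi"]
    by (simp only: integral_complex_of_real)
qed

lemma fock_normsq_nonneg: "\<alpha> > 0 \<Longrightarrow> 0 \<le> fock_normsq \<alpha> f"
  unfolding fock_normsq_def by (intro mult_nonneg_nonneg integral_nonneg) auto

lemma tame_cnj_power: "tame (\<lambda>z. cnj z ^ k)"
  by (intro tame_power tame_cnj tame_ident)

lemma has_dbar_cnj_power: "has_dbar (\<lambda>z. cnj z ^ k) (of_nat k * cnj z ^ (k - 1)) z"
proof -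
  have "((\<lambda>z. z ^ k) has_field_derivative of_nat k * z ^ (k - 1)) (at z)"
    by (auto intro!: derivative_eq_intros)
  from has_wirtinger_cnj[OF has_wirtinger_field_derivative[OF this]]
  show ?thesis unfolding has_dbar_def by auto
qed

text \<open>On the Fock space, multiplication by \<open>z\<close> and $\alpha^{-1}\,d/dz$ are adjoint: integrate
  $\bar\partial(f\,\bar z^k e^{-\alpha|z|^2})$ after cutting off at radius \<open>n\<close>. For a general \<open>f\<close> in
  the space only the cut-off function is tame, and the limit $n\to\infty$ uses square integrability of \<open>f\<close>.\<close>
lemma integral_mult_cnj_power:
  assumes \<alpha>: "\<alpha> > 0" and f: "f \<in> fock_space \<alpha>"
  shows "of_real \<alpha> * (LINT z|lborel. z * f z * cnj z ^ k * of_real (gauss \<alpha> z))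
    = of_nat k * (LINT z|lborel. f z * cnj z ^ (k - 1) * of_real (gauss \<alpha> z))"
proof -
  have hol: "f holomorphic_on UNIV" using f by (simp add: fock_space_iff)
  note [measurable] = fock_space_measurable[OF f]
  have int: "integrable lborel (\<lambda>z. f z * p z * of_real (gauss \<alpha> z))" if "tame p" for p
    using f that tame_measurable tame_square_integrable[OF \<alpha>]
    by (intro square_integrable_mult) (auto simp: fock_space_iff)
  define b where "b = (\<lambda>n z. (0 * of_real (ramp (real n) 1 z) + f z * dbar_ramp (real n) 1 z) * cnj z ^ k
      + (f z * of_real (ramp (real n) 1 z)) * (of_nat k * cnj z ^ (k - 1)))"
  define g where "g = (\<lambda>n z. (f z * of_real (ramp (real n) 1 z)) * cnj z ^ k)"
  define s where "s = (\<lambda>n z. (b n z - of_real \<alpha> * z * g n z) * of_real (gauss \<alpha> z))"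
  have [measurable]: "ramp a c \<in> borel_measurable borel" for a c
    unfolding ramp_def[abs_def] by measurable
  have bm [measurable]: "b n \<in> borel_measurable borel" "g n \<in> borel_measurable borel" for n
    unfolding b_def g_def by measurable
  have s0: "(LINT z|lborel. s n z) = 0" for n
    unfolding s_def
  proof (rule integral_dbar_eq_0[OF \<alpha>])
    show "tame (g n)" unfolding g_def
      by (intro tame_mult[OF _ tame_cnj_power] tame_holomorphic_mult_ramp hol) auto
    show "AE z in lborel. has_dbar (g n) (b n z) z"
      using AE_not_on_circle[of 0 "real n"] AE_not_on_circle[of 0 "real n + 1"]
    proof eventually_elim
      case (elim z)
      have "has_dbar f 0 z"
        using holomorphic_derivI[OF hol, of z] by (intro has_dbar_field_derivative[of _ "deriv f z"]) auto
      then show ?case unfolding g_def b_def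
        by (intro has_dbar_mult has_dbar_cnj_power has_dbar_ramp) (use elim in auto)
    qed
  qed measurable
  define l where "l = (\<lambda>z. f z * (of_nat k * cnj z ^ (k - 1)) * of_real (gauss \<alpha> z)
      - f z * (of_real \<alpha> * z * cnj z ^ k) * of_real (gauss \<alpha> z))"
  define M where "M = (\<lambda>z. cmod (f z * cnj z ^ k * of_real (gauss \<alpha> z))
     + cmod (f z * (of_nat k * cnj z ^ (k - 1)) * of_real (gauss \<alpha> z))
     + cmod (f z * (of_real \<alpha> * z * cnj z ^ k) * of_real (gauss \<alpha> z)))"
  have t: "tame (\<lambda>z. of_nat k * cnj z ^ (k - 1))" "tame (\<lambda>z. of_real \<alpha> * z * cnj z ^ k)"
    by (intro tame_mult tame_const tame_ident tame_cnj_power)+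
  have Mi: "integrable lborel M" unfolding M_def
    by (intro Bochner_Integration.integrable_add integrable_norm int t tame_cnj_power)
  have lim: "(\<lambda>n. s n z) \<longlonglongrightarrow> l z" for z
  proof (rule tendsto_eventually)
    obtain N where N: "cmod z < real N" using reals_Archimedean2 by blast
    have "s n z = l z" if "n \<ge> N" for n
    proof -
      have "cmod z \<le> real n" using N that by linarith
      then have "ramp (real n) 1 z = 1" "dbar_ramp (real n) 1 z = 0"
        by (auto intro: ramp_eq_1 dbar_ramp_eq_0)
      then show ?thesis unfolding s_def l_def b_def g_def by (simp add: algebra_simps)
    qed
    then show "\<forall>\<^sub>F n in sequentially. s n z = l z" using eventually_sequentially by auto
  qed
  have bd: "norm (s n z) \<le> M z" for n z
  proof -
    let ?r = "complex_of_real (ramp (real n) 1 z)" and ?d = "dbar_ramp (real n) 1 z"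
    have "s n z = ?d * (f z * cnj z ^ k * of_real (gauss \<alpha> z))
      + ?r * (f z * (of_nat k * cnj z ^ (k - 1)) * of_real (gauss \<alpha> z))
      - ?r * (f z * (of_real \<alpha> * z * cnj z ^ k) * of_real (gauss \<alpha> z))"
      unfolding s_def b_def g_def by (simp add: algebra_simps)
    then have "norm (s n z) \<le> cmod ?d * cmod (f z * cnj z ^ k * of_real (gauss \<alpha> z))
      + cmod ?r * cmod (f z * (of_nat k * cnj z ^ (k - 1)) * of_real (gauss \<alpha> z))
      + cmod ?r * cmod (f z * (of_real \<alpha> * z * cnj z ^ k) * of_real (gauss \<alpha> z))"
      by (smt (verit) norm_triangle_ineq norm_triangle_ineq4 norm_mult)
    also have "\<dots> \<le> M z"
      unfolding M_def
      using cmod_dbar_ramp[of 1 "real n" z] ramp_le_1[of "real n" 1 z] ramp_nonneg[of "real n" 1 z]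
      by (intro add_mono mult_left_le_one_le) auto
    finally show ?thesis .
  qed
  have "(\<lambda>n. LINT z|lborel. s n z) \<longlonglongrightarrow> (LINT z|lborel. l z)"
    by (rule integral_dominated_convergence[where w=M])
      (use Mi lim bd in \<open>auto simp: s_def l_def\<close>)
  then have "(LINT z|lborel. l z) = 0" unfolding s0 by (simp add: LIMSEQ_const_iff)
  moreover have "(LINT z|lborel. l z) = of_nat k * (LINT z|lborel. f z * cnj z ^ (k - 1) * of_real (gauss \<alpha> z))
     - of_real \<alpha> * (LINT z|lborel. z * f z * cnj z ^ k * of_real (gauss \<alpha> z))"
  proof -
    have "(LINT z|lborel. l z) = (LINT z|lborel. f z * (of_nat k * cnj z ^ (k - 1)) * of_real (gauss \<alpha> z))
      - (LINT z|lborel. f z * (of_real \<alpha> * z * cnj z ^ k) * of_real (gauss \<alpha> z))"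
      unfolding l_def by (intro Bochner_Integration.integral_diff int t)
    also have "(LINT z|lborel. f z * (of_nat k * cnj z ^ (k - 1)) * of_real (gauss \<alpha> z))
      = of_nat k * (LINT z|lborel. f z * cnj z ^ (k - 1) * of_real (gauss \<alpha> z))"
      by (subst integral_mult_right_zero[symmetric]) (simp add: mult_ac)
    also have "(LINT z|lborel. f z * (of_real \<alpha> * z * cnj z ^ k) * of_real (gauss \<alpha> z))
      = of_real \<alpha> * (LINT z|lborel. z * f z * cnj z ^ k * of_real (gauss \<alpha> z))"
      by (subst integral_mult_right_zero[symmetric]) (simp add: mult_ac)
    finally show ?thesis .
  qed
  ultimately show ?thesis by simp
qed

definition taylor_quotient :: "(complex \<Rightarrow> complex) \<Rightarrow> complex \<Rightarrow> complex" where
  "taylor_quotient f z = (if z = 0 then deriv f 0 else (f z - f 0) / z)"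

lemma taylor_quotient_eq: "f z = f 0 + z * taylor_quotient f z"
  by (simp add: taylor_quotient_def)

lemma fock_space_const: "\<alpha> > 0 \<Longrightarrow> (\<lambda>_. c) \<in> fock_space \<alpha>"
  by (intro fock_space_tame tame_const) auto

lemma taylor_quotient_holomorphic:
  "f holomorphic_on UNIV \<Longrightarrow> taylor_quotient f holomorphic_on UNIV"
  using pole_lemma_open[of f UNIV 0] unfolding taylor_quotient_def[abs_def] diff_zero by simp

lemma fock_space_taylor_quotient:
  assumes \<alpha>: "\<alpha> > 0" and f: "f \<in> fock_space \<alpha>"
  shows "taylor_quotient f \<in> fock_space \<alpha>"
  unfolding fock_space_iff
proof
  have hol: "f holomorphic_on UNIV" using f by (simp add: fock_space_iff)
  show h: "taylor_quotient f holomorphic_on UNIV" by (rule taylor_quotient_holomorphic[OF hol])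
  note [measurable] = holomorphic_measurable[OF h] holomorphic_measurable[OF hol]
  have "bounded (taylor_quotient f ` cball 0 1)"
    by (intro compact_imp_bounded compact_continuous_image holomorphic_on_imp_continuous_on
        holomorphic_on_subset[OF h]) auto
  then obtain M where "\<forall>z\<in>cball 0 1. cmod (taylor_quotient f z) \<le> M"
    unfolding bounded_iff by blast
  then have M: "\<And>z. cmod z \<le> 1 \<Longrightarrow> cmod (taylor_quotient f z) \<le> M" by simp
  have d: "integrable lborel (\<lambda>z. (cmod (f z - f 0))\<^sup>2 * gauss \<alpha> z)"
    using fock_space_diff[OF f fock_space_const[OF \<alpha>]] by (simp add: fock_space_iff)
  show "integrable lborel (\<lambda>z. (cmod (taylor_quotient f z))\<^sup>2 * gauss \<alpha> z)"
  proof (rule Bochner_Integration.integrable_bound)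
    show "integrable lborel (\<lambda>z. M\<^sup>2 * gauss \<alpha> z + (cmod (f z - f 0))\<^sup>2 * gauss \<alpha> z)"
      by (intro Bochner_Integration.integrable_add integrable_mult_right integrable_gauss \<alpha> d)
    show "AE z in lborel. norm ((cmod (taylor_quotient f z))\<^sup>2 * gauss \<alpha> z)
        \<le> norm (M\<^sup>2 * gauss \<alpha> z + (cmod (f z - f 0))\<^sup>2 * gauss \<alpha> z)"
    proof (rule AE_I2)
      fix z
      have "(cmod (taylor_quotient f z))\<^sup>2 \<le> M\<^sup>2 + (cmod (f z - f 0))\<^sup>2"
      proof (cases "cmod z \<le> 1")
        case True
        then have "(cmod (taylor_quotient f z))\<^sup>2 \<le> M\<^sup>2" by (intro power_mono M) auto
        then show ?thesis by (smt (verit) zero_le_power2)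
      next
        case False
        then have "cmod (taylor_quotient f z) \<le> cmod (f z - f 0)"
          using mult_left_mono[of 1 "cmod z" "cmod (f z - f 0)"]
          by (auto simp: taylor_quotient_def norm_divide divide_le_eq)
        then have "(cmod (taylor_quotient f z))\<^sup>2 \<le> (cmod (f z - f 0))\<^sup>2" by (intro power_mono) auto
        then show ?thesis by (smt (verit) zero_le_power2)
      qed
      then have "(cmod (taylor_quotient f z))\<^sup>2 * gauss \<alpha> z \<le> (M\<^sup>2 + (cmod (f z - f 0))\<^sup>2) * gauss \<alpha> z"
        by (intro mult_right_mono) auto
      then show "norm ((cmod (taylor_quotient f z))\<^sup>2 * gauss \<alpha> z)
        \<le> norm (M\<^sup>2 * gauss \<alpha> z + (cmod (f z - f 0))\<^sup>2 * gauss \<alpha> z)"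
        by (simp add: distrib_right)
    qed
  qed measurable
qed

lemma fps_expansion_taylor_quotient:
  assumes "f holomorphic_on UNIV"
  shows "fps_expansion f 0 = fps_const (f 0) + fps_X * fps_expansion (taylor_quotient f) 0"
proof -
  have "(\<lambda>z. f 0 + z * taylor_quotient f z) has_fps_expansion
      fps_const (f 0) + fps_X * fps_expansion (taylor_quotient f) 0"
    using taylor_quotient_holomorphic[OF assms]
    by (intro has_fps_expansion_add has_fps_expansion_mult has_fps_expansion_const
        has_fps_expansion_fps_X has_fps_expansion_fps_expansion[of UNIV]) auto
  then have "f has_fps_expansion fps_const (f 0) + fps_X * fps_expansion (taylor_quotient f) 0"
    by (simp flip: taylor_quotient_eq)
  moreover have "f has_fps_expansion fps_expansion f 0"
    by (rule has_fps_expansion_fps_expansion[of UNIV]) (use assms in auto)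
  ultimately show ?thesis using fps_expansion_unique_complex by blast
qed

text \<open>Splitting \<open>f z = f 0 + z * h z\<close> and moving the factor \<open>z\<close> to the other side by adjointness lowers
  the exponent by one while shifting the Taylor coefficients of \<open>f\<close>.\<close>
lemma integral_cnj_power:
  assumes \<alpha>: "\<alpha> > 0" and f: "f \<in> fock_space \<alpha>"
  shows "(LINT z|lborel. f z * cnj z ^ k * of_real (gauss \<alpha> z))
    = of_real (pi / \<alpha> * (fact k / \<alpha> ^ k)) * fps_nth (fps_expansion f 0) k"
  using f
proof (induction k arbitrary: f)
  case 0
  note f = 0
  define h where "h = taylor_quotient f"
  have h: "h \<in> fock_space \<alpha>" unfolding h_def by (rule fock_space_taylor_quotient[OF \<alpha> f])
  have f_eq: "f z = f 0 + z * h z" for z unfolding h_def by (rule taylor_quotient_eq)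
  have hol: "f holomorphic_on UNIV" using f by (simp add: fock_space_iff)
  have i: "integrable lborel (\<lambda>z. f 0 * complex_of_real (gauss \<alpha> z))"
    "integrable lborel (\<lambda>z. (f z - f 0) * complex_of_real (gauss \<alpha> z))"
    using fock_inner_integrable[OF fock_space_diff[OF f fock_space_const[OF \<alpha>]] fock_space_const[OF \<alpha>, of 1]]
    by (auto intro!: tame_integrable_gauss[OF \<alpha> tame_const])
  have "(LINT z|lborel. f z * of_real (gauss \<alpha> z))
      = (LINT z|lborel. f 0 * complex_of_real (gauss \<alpha> z) + (f z - f 0) * complex_of_real (gauss \<alpha> z))"
    by (simp add: algebra_simps)
  also have "\<dots> = (LINT z|lborel. f 0 * complex_of_real (gauss \<alpha> z)) + (LINT z|lborel. (f z - f 0) * complex_of_real (gauss \<alpha> z))"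
    by (intro Bochner_Integration.integral_add i)
  also have "(LINT z|lborel. f 0 * complex_of_real (gauss \<alpha> z)) = f 0 * of_real (pi / \<alpha>)"
    using integral_gauss[OF \<alpha>] by (simp add: integral_complex_of_real del: of_real_divide)
  also have "(LINT z|lborel. (f z - f 0) * complex_of_real (gauss \<alpha> z)) = (LINT z|lborel. z * h z * cnj z ^ 0 * of_real (gauss \<alpha> z))"
    using f_eq by (metis (no_types, lifting) add_diff_cancel_left' mult.right_neutral power_0)
  also have "\<dots> = 0" using integral_mult_cnj_power[OF \<alpha> h, of 0] \<alpha> by simp
  finally show ?case using fps_expansion_taylor_quotient[OF hol] by simp
next
  case (Suc k)
  note f = Suc.prems
  define h where "h = taylor_quotient f"
  have h: "h \<in> fock_space \<alpha>" unfolding h_def by (rule fock_space_taylor_quotient[OF \<alpha> f])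
  have f_eq: "f z = f 0 + z * h z" for z unfolding h_def by (rule taylor_quotient_eq)
  have hol: "f holomorphic_on UNIV" using f by (simp add: fock_space_iff)
  have zf: "(\<lambda>z. z ^ n) \<in> fock_space \<alpha>" for n
    by (intro fock_space_tame[OF \<alpha>] tame_power tame_ident) (auto intro: holomorphic_intros)
  have i: "integrable lborel (\<lambda>z. f 0 * cnj z ^ Suc k * complex_of_real (gauss \<alpha> z))"
    "integrable lborel (\<lambda>z. (f z - f 0) * cnj z ^ Suc k * complex_of_real (gauss \<alpha> z))"
    using fock_inner_integrable[OF fock_space_diff[OF f fock_space_const[OF \<alpha>, of "f 0"]] zf[of "Suc k"]]
      fock_inner_integrable[OF fock_space_const[OF \<alpha>, of "f 0"] zf[of "Suc k"]]
    by simp_all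
  have z0: "(LINT z|lborel. cnj z ^ Suc k * complex_of_real (gauss \<alpha> z)) = 0"
  proof -
    have "of_real \<alpha> * (LINT z|lborel. z * z ^ k * cnj z ^ 0 * of_real (gauss \<alpha> z)) = 0"
      using integral_mult_cnj_power[OF \<alpha> zf[of k], of 0] by simp
    then have "(LINT z|lborel. z ^ Suc k * complex_of_real (gauss \<alpha> z)) = 0" using \<alpha> by simp
    then show ?thesis using Bochner_Integration.integral_cnj[of lborel "\<lambda>z. z ^ Suc k * complex_of_real (gauss \<alpha> z)"] by simp
  qed
  have "(LINT z|lborel. f z * cnj z ^ Suc k * of_real (gauss \<alpha> z))
      = (LINT z|lborel. f 0 * cnj z ^ Suc k * complex_of_real (gauss \<alpha> z) + (f z - f 0) * cnj z ^ Suc k * complex_of_real (gauss \<alpha> z))"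
    by (simp add: algebra_simps)
  also have "\<dots> = (LINT z|lborel. f 0 * cnj z ^ Suc k * complex_of_real (gauss \<alpha> z))
      + (LINT z|lborel. (f z - f 0) * cnj z ^ Suc k * complex_of_real (gauss \<alpha> z))"
    by (intro Bochner_Integration.integral_add i)
  also have "(LINT z|lborel. f 0 * cnj z ^ Suc k * complex_of_real (gauss \<alpha> z)) = 0"
    using z0 by (simp add: mult.assoc del: power_Suc)
  also have "(LINT z|lborel. (f z - f 0) * cnj z ^ Suc k * complex_of_real (gauss \<alpha> z))
      = (LINT z|lborel. z * h z * cnj z ^ Suc k * of_real (gauss \<alpha> z))"
    using f_eq by (metis (no_types, lifting) add_diff_cancel_left')
  also have "\<dots> = of_nat (Suc k) / of_real \<alpha> * (LINT z|lborel. h z * cnj z ^ k * of_real (gauss \<alpha> z))"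
    using integral_mult_cnj_power[OF \<alpha> h, of "Suc k"] \<alpha> by (simp add: field_simps)
  also have "\<dots> = of_nat (Suc k) / of_real \<alpha> * (of_real (pi / \<alpha> * (fact k / \<alpha> ^ k)) * fps_nth (fps_expansion h 0) k)"
    by (simp only: Suc.IH[OF h])
  also have "\<dots> = of_real (pi / \<alpha> * (fact (Suc k) / \<alpha> ^ Suc k)) * fps_nth (fps_expansion h 0) k"
    using \<alpha> by (simp add: field_simps)
  also have "fps_nth (fps_expansion h 0) k = fps_nth (fps_expansion f 0) (Suc k)"
    using fps_expansion_taylor_quotient[OF hol] by (simp add: h_def)
  finally show ?case by simp
qed

section \<open>Expansion in the orthonormal basis\<close>

lemma fock_basis_in_fock_space: "\<alpha> > 0 \<Longrightarrow> fock_basis \<alpha> k \<in> fock_space \<alpha>"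
  unfolding fock_basis_def[abs_def]
  by (intro fock_space_tame tame_mult tame_const tame_power tame_ident) (auto intro!: holomorphic_intros)

lemma fock_inner_basis:
  assumes \<alpha>: "\<alpha> > 0" and f: "f \<in> fock_space \<alpha>"
  shows "fock_inner \<alpha> f (fock_basis \<alpha> k) = of_real (sqrt (fact k) / sqrt (\<alpha> ^ k)) * fps_nth (fps_expansion f 0) k"
proof -
  have "(LINT z|lborel. f z * cnj (fock_basis \<alpha> k z) * of_real (gauss \<alpha> z))
      = of_real (sqrt (\<alpha> ^ k) / sqrt (fact k)) * (LINT z|lborel. f z * cnj z ^ k * of_real (gauss \<alpha> z))"
    by (subst integral_mult_right_zero[symmetric]) (simp add: fock_basis_def mult_ac)
  also have "\<dots> = of_real (sqrt (\<alpha> ^ k) / sqrt (fact k) * (pi / \<alpha> * (fact k / \<alpha> ^ k))) * fps_nth (fps_expansion f 0) k"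
    by (subst integral_cnj_power[OF \<alpha> f]) simp
  finally have "fock_inner \<alpha> f (fock_basis \<alpha> k)
      = of_real (\<alpha> / pi * (sqrt (\<alpha> ^ k) / sqrt (fact k) * (pi / \<alpha> * (fact k / \<alpha> ^ k)))) * fps_nth (fps_expansion f 0) k"
    unfolding fock_inner_gauss by simp
  also have "\<alpha> / pi * (sqrt (\<alpha> ^ k) / sqrt (fact k) * (pi / \<alpha> * (fact k / \<alpha> ^ k))) = sqrt (fact k) / sqrt (\<alpha> ^ k)"
  proof -
    have *: "x / y * (y\<^sup>2 / x\<^sup>2) = y / x" if "x > 0" "y > 0" for x y :: real
      using that by (simp add: power2_eq_square)
    have "\<alpha> / pi * (sqrt (\<alpha> ^ k) / sqrt (fact k) * (pi / \<alpha> * (fact k / \<alpha> ^ k))) = sqrt (\<alpha> ^ k) / sqrt (fact k) * (fact k / \<alpha> ^ k)"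
      using \<alpha> by simp
    also have "\<dots> = sqrt (\<alpha> ^ k) / sqrt (fact k) * ((sqrt (fact k))\<^sup>2 / (sqrt (\<alpha> ^ k))\<^sup>2)"
      using \<alpha> by (simp del: real_sqrt_power)
    also have "\<dots> = sqrt (fact k) / sqrt (\<alpha> ^ k)" using \<alpha> by (intro *) auto
    finally show ?thesis .
  qed
  finally show ?thesis .
qed

lemma fock_basis_orthonormal:
  assumes \<alpha>: "\<alpha> > 0"
  shows "fock_inner \<alpha> (fock_basis \<alpha> j) (fock_basis \<alpha> k) = (if j = k then 1 else 0)"
proof -
  define c where "c = complex_of_real (sqrt (\<alpha> ^ j) / sqrt (fact j))"
  have "fock_basis \<alpha> j has_fps_expansion fps_const c * fps_X ^ j"
    unfolding fock_basis_def[abs_def] c_def[symmetric]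
    by (intro has_fps_expansion_mult has_fps_expansion_const has_fps_expansion_power has_fps_expansion_fps_X)
  moreover have "fock_basis \<alpha> j has_fps_expansion fps_expansion (fock_basis \<alpha> j) 0"
    using fock_basis_in_fock_space[OF \<alpha>, of j]
    by (intro has_fps_expansion_fps_expansion[of UNIV]) (auto simp: fock_space_iff)
  ultimately have e: "fps_expansion (fock_basis \<alpha> j) 0 = fps_const c * fps_X ^ j"
    using fps_expansion_unique_complex by blast
  have "complex_of_real (sqrt (fact j) / sqrt (\<alpha> ^ j)) * c = of_real (sqrt (fact j) / sqrt (\<alpha> ^ j) * (sqrt (\<alpha> ^ j) / sqrt (fact j)))"
    unfolding c_def by (simp only: of_real_mult)
  also have "sqrt (fact j) / sqrt (\<alpha> ^ j) * (sqrt (\<alpha> ^ j) / sqrt (fact j)) = 1" using \<alpha> by simp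
  finally have "complex_of_real (sqrt (fact j) / sqrt (\<alpha> ^ j)) * c = 1" by simp
  then show ?thesis
    unfolding fock_inner_basis[OF \<alpha> fock_basis_in_fock_space[OF \<alpha>]] e
    by (auto simp only: fps_mult_left_const_nth fps_X_power_nth mult_1_right mult_zero_right split: if_splits)
qed

lemma fock_expansion:
  assumes \<alpha>: "\<alpha> > 0" and f: "f \<in> fock_space \<alpha>"
  shows "(\<lambda>k. fock_inner \<alpha> f (fock_basis \<alpha> k) * fock_basis \<alpha> k z) sums f z"
proof -
  have "f holomorphic_on ball 0 (cmod z + 1)"
    using f by (auto simp: fock_space_iff intro: holomorphic_on_subset)
  then have "(\<lambda>k. (deriv ^^ k) f 0 / fact k * (z - 0) ^ k) sums f z"
    by (rule holomorphic_power_series) simp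
  moreover have "fock_inner \<alpha> f (fock_basis \<alpha> k) * fock_basis \<alpha> k z = (deriv ^^ k) f 0 / fact k * (z - 0) ^ k" for k
  proof -
    have "complex_of_real (sqrt (fact k) / sqrt (\<alpha> ^ k)) * complex_of_real (sqrt (\<alpha> ^ k) / sqrt (fact k)) = 1"
      unfolding of_real_mult[symmetric] using \<alpha> by simp
    then have "complex_of_real (sqrt (fact k) / sqrt (\<alpha> ^ k)) * w * (complex_of_real (sqrt (\<alpha> ^ k) / sqrt (fact k)) * v) = w * v" for w v
      by (metis (no_types, lifting) mult.assoc mult.left_commute mult_1)
    then show ?thesis
      unfolding fock_inner_basis[OF \<alpha> f] fock_basis_def by (simp only: fps_expansion_def fps_nth_Abs_fps diff_zero)
  qed
  ultimately show ?thesis by simp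
qed

lemma fock_bessel:
  assumes \<alpha>: "\<alpha> > 0" and f: "f \<in> fock_space \<alpha>" and I: "finite I"
    and e: "\<And>i. i \<in> I \<Longrightarrow> e i \<in> fock_space \<alpha>"
    and orth: "\<And>i j. i \<in> I \<Longrightarrow> j \<in> I \<Longrightarrow> fock_inner \<alpha> (e i) (e j) = (if i = j then 1 else 0)"
  shows "(\<Sum>i\<in>I. (cmod (fock_inner \<alpha> f (e i)))\<^sup>2) \<le> fock_normsq \<alpha> f"
proof -
  define c where "c = (\<lambda>i. fock_inner \<alpha> f (e i))"
  define s where "s = (\<lambda>z. \<Sum>i\<in>I. c i * e i z)"
  have s: "s \<in> fock_space \<alpha>" unfolding s_def by (intro fock_space_sum fock_space_cmult e)
  define S where "S = complex_of_real (\<Sum>i\<in>I. (cmod (c i))\<^sup>2)"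
  have fs: "fock_inner \<alpha> f s = S"
    unfolding s_def S_def by (subst fock_inner_sum_right) (use e f in \<open>auto simp: c_def complex_norm_square mult.commute simp del: of_real_power\<close>)
  have se: "fock_inner \<alpha> s (e j) = c j" if "j \<in> I" for j
  proof -
    have "fock_inner \<alpha> s (e j) = (\<Sum>i\<in>I. c i * fock_inner \<alpha> (e i) (e j))"
      unfolding s_def by (rule fock_inner_sum_left) (use e that in auto)
    also have "\<dots> = (\<Sum>i\<in>I. if i = j then c i else 0)"
      by (intro sum.cong) (use orth that in auto)
    finally show ?thesis using I that by simp
  qed
  have ss: "fock_inner \<alpha> s s = S"
  proof -
    have "fock_inner \<alpha> s (\<lambda>z. \<Sum>i\<in>I. c i * e i z) = (\<Sum>i\<in>I. cnj (c i) * fock_inner \<alpha> s (e i))"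
      by (rule fock_inner_sum_right) (use e s in auto)
    then show ?thesis unfolding S_def
      by (simp add: s_def[symmetric] se complex_norm_square mult.commute del: of_real_power)
  qed
  have d: "(\<lambda>z. f z - s z) \<in> fock_space \<alpha>" by (intro fock_space_diff f s)
  have "of_real (fock_normsq \<alpha> (\<lambda>z. f z - s z)) = fock_inner \<alpha> f (\<lambda>z. f z - s z) - fock_inner \<alpha> s (\<lambda>z. f z - s z)"
    unfolding fock_inner_self[symmetric] by (intro fock_inner_diff_left f s d)
  also have "fock_inner \<alpha> f (\<lambda>z. f z - s z) = cnj (fock_inner \<alpha> f f - fock_inner \<alpha> s f)"
    by (subst fock_inner_commute) (simp only: fock_inner_diff_left[OF f s f])
  also have "fock_inner \<alpha> s (\<lambda>z. f z - s z) = cnj (fock_inner \<alpha> f s - fock_inner \<alpha> s s)"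
    by (subst fock_inner_commute) (simp only: fock_inner_diff_left[OF f s s])
  also have "cnj (fock_inner \<alpha> f f - fock_inner \<alpha> s f) - cnj (fock_inner \<alpha> f s - fock_inner \<alpha> s s)
      = of_real (fock_normsq \<alpha> f) - S"
    unfolding fock_inner_self[of \<alpha> f] fock_inner_commute[of \<alpha> s f] fs ss by (simp add: S_def)
  finally have "fock_normsq \<alpha> (\<lambda>z. f z - s z) = fock_normsq \<alpha> f - (\<Sum>i\<in>I. (cmod (c i))\<^sup>2)"
    unfolding S_def of_real_diff[symmetric] of_real_eq_iff .
  then show ?thesis using fock_normsq_nonneg[OF \<alpha>, of "\<lambda>z. f z - s z"] by (simp add: c_def)
qed

lemma cmod_fock_basis:
  assumes "\<alpha> > 0"
  shows "(cmod (fock_basis \<alpha> k z))\<^sup>2 = (\<alpha> * (cmod z)\<^sup>2) ^ k / fact k"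
proof -
  have "cmod (fock_basis \<alpha> k z) = sqrt (\<alpha> ^ k) / sqrt (fact k) * cmod z ^ k"
    using assms by (simp add: fock_basis_def norm_mult norm_power norm_divide del: real_sqrt_power of_real_power)
  then show ?thesis using assms
    by (simp add: power_mult_distrib power_divide power_mult[symmetric] mult.commute del: real_sqrt_power)
qed

text \<open>Truncating the expansion costs at most the mass of the discarded part of the
reproducing kernel.\<close>
lemma fock_truncation:
  assumes \<alpha>: "\<alpha> > 0" and f: "f \<in> fock_space \<alpha>"
    and T: "\<And>n. (\<Sum>k=m..<n. (cmod (fock_basis \<alpha> k z))\<^sup>2) \<le> T"
  shows "(cmod (f z - (\<Sum>k<m. fock_inner \<alpha> f (fock_basis \<alpha> k) * fock_basis \<alpha> k z)))\<^sup>2 \<le> fock_normsq \<alpha> f * T"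
proof -
  define c where "c = (\<lambda>k. fock_inner \<alpha> f (fock_basis \<alpha> k))"
  define u where "u = (\<lambda>k. c k * fock_basis \<alpha> k z)"
  have "(\<lambda>n. \<Sum>k<n. u k) \<longlonglongrightarrow> f z"
    using fock_expansion[OF \<alpha> f, of z] by (simp add: sums_def u_def c_def)
  then have lim: "(\<lambda>n. (cmod ((\<Sum>k<n. u k) - (\<Sum>k<m. u k)))\<^sup>2) \<longlonglongrightarrow> (cmod (f z - (\<Sum>k<m. u k)))\<^sup>2"
    by (intro tendsto_intros)
  have "(cmod ((\<Sum>k<n. u k) - (\<Sum>k<m. u k)))\<^sup>2 \<le> fock_normsq \<alpha> f * T" if "n \<ge> m" for n
  proof -
    have "(\<Sum>k<n. u k) - (\<Sum>k<m. u k) = (\<Sum>k=m..<n. u k)"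
      using that by (simp add: sum_diff_nat_ivl lessThan_atLeast0)
    then have "cmod ((\<Sum>k<n. u k) - (\<Sum>k<m. u k)) \<le> (\<Sum>k=m..<n. cmod (c k) * cmod (fock_basis \<alpha> k z))"
      using norm_sum[of u "{m..<n}"] by (simp add: u_def norm_mult)
    then have "(cmod ((\<Sum>k<n. u k) - (\<Sum>k<m. u k)))\<^sup>2 \<le> (\<Sum>k=m..<n. cmod (c k) * cmod (fock_basis \<alpha> k z))\<^sup>2"
      by (intro power_mono) auto
    also have "\<dots> \<le> (\<Sum>k=m..<n. (cmod (c k))\<^sup>2) * (\<Sum>k=m..<n. (cmod (fock_basis \<alpha> k z))\<^sup>2)"
      by (rule Cauchy_Schwarz_ineq_sum)
    also have "\<dots> \<le> fock_normsq \<alpha> f * T"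
      unfolding c_def
      by (intro mult_mono T fock_bessel fock_basis_in_fock_space fock_basis_orthonormal \<alpha> f fock_normsq_nonneg sum_nonneg) auto
    finally show ?thesis .
  qed
  then show ?thesis
    using LIMSEQ_le_const2[OF lim] unfolding u_def c_def by blast
qed

lemma exp_sum_le:
  fixes x :: real
  assumes "x \<ge> 0" "finite I"
  shows "(\<Sum>k\<in>I. x ^ k / fact k) \<le> exp x"
proof -
  have "(\<lambda>k. x ^ k / fact k) sums exp x"
    using exp_converges[of x] by (simp add: inverse_eq_divide)
  then show ?thesis
    using assms sum_le_suminf[of "\<lambda>k. x ^ k / fact k" I] by (simp add: sums_iff)
qed

lemma fock_pointwise_bound:
  assumes \<alpha>: "\<alpha> > 0" and f: "f \<in> fock_space \<alpha>"
  shows "(cmod (f z))\<^sup>2 \<le> fock_normsq \<alpha> f * exp (\<alpha> * (cmod z)\<^sup>2)"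
proof -
  have "(\<Sum>k=0..<n. (cmod (fock_basis \<alpha> k z))\<^sup>2) \<le> exp (\<alpha> * (cmod z)\<^sup>2)" for n
    unfolding cmod_fock_basis[OF \<alpha>] using \<alpha> by (intro exp_sum_le) auto
  from fock_truncation[OF \<alpha> f this] show ?thesis by simp
qed

section \<open>Translations\<close>

lemma gauss_translate:
  "gauss \<alpha> (z + l) = gauss \<alpha> z * exp (- \<alpha> * (2 * Re (cnj l * z) + (cmod l)\<^sup>2))"
proof -
  have "(cmod (z + l))\<^sup>2 = (cmod z)\<^sup>2 + (2 * Re (cnj l * z) + (cmod l)\<^sup>2)"
    unfolding cmod_power2 by (simp add: power2_eq_square algebra_simps)
  then show ?thesis by (simp add: gauss_def exp_add[symmetric] algebra_simps)
qed

text \<open>Translations act isometrically already at the level of weighted moduli.\<close>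
lemma cmod_fock_translation:
  "(cmod (fock_translation \<alpha> l f z))\<^sup>2 * gauss \<alpha> z = (cmod (f (z - l)))\<^sup>2 * gauss \<alpha> (z - l)"
proof -
  have "(cmod (fock_translation \<alpha> l f z))\<^sup>2
    = (exp (Re (of_real \<alpha> * cnj l * z - of_real (\<alpha> / 2 * (cmod l)\<^sup>2))))\<^sup>2 * (cmod (f (z - l)))\<^sup>2"
    by (simp only: fock_translation_def norm_mult norm_exp_eq_Re power_mult_distrib)
  also have "(exp (Re (of_real \<alpha> * cnj l * z - of_real (\<alpha> / 2 * (cmod l)\<^sup>2))))\<^sup>2
      = exp (- \<alpha> * (2 * Re (cnj (- l) * z) + (cmod (- l))\<^sup>2))"
    by (simp add: exp_double[symmetric] algebra_simps)
  finally show ?thesis using gauss_translate[of \<alpha> z "- l"] by simp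
qed

lemma fock_translation_inverse: "fock_translation \<alpha> (- l) (fock_translation \<alpha> l f) = f"
proof
  fix z
  have "of_real \<alpha> * cnj (- l) * z - of_real (\<alpha> / 2 * (cmod (- l))\<^sup>2)
      + (of_real \<alpha> * cnj l * (z - - l) - of_real (\<alpha> / 2 * (cmod l)\<^sup>2)) = complex_of_real \<alpha> * (cnj l * l - of_real ((cmod l)\<^sup>2))"
    by (simp add: algebra_simps)
  also have "\<dots> = 0" by (simp add: complex_norm_square mult.commute del: of_real_power)
  finally show "fock_translation \<alpha> (- l) (fock_translation \<alpha> l f) z = f z"
    unfolding fock_translation_def mult.assoc[symmetric] exp_add[symmetric] by simp
qed

lemma fock_space_translation:
  assumes "f \<in> fock_space \<alpha>"
  shows "fock_translation \<alpha> l f \<in> fock_space \<alpha>"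
  unfolding fock_space_iff cmod_fock_translation
proof
  have h: "f holomorphic_on UNIV" using assms by (simp add: fock_space_iff)
  have "f \<circ> (\<lambda>z. z - l) holomorphic_on UNIV"
    by (rule holomorphic_on_compose_gen[OF _ h]) (auto intro!: holomorphic_intros)
  then have "(\<lambda>z. f (z - l)) holomorphic_on UNIV" by (simp add: o_def)
  then show "fock_translation \<alpha> l f holomorphic_on UNIV"
    unfolding fock_translation_def by (intro holomorphic_intros)
  note [measurable] = fock_space_measurable[OF assms]
  show "integrable lborel (\<lambda>z. (cmod (f (z - l)))\<^sup>2 * gauss \<alpha> (z - l))"
    using lborel_translation(1)[of "\<lambda>z. (cmod (f z))\<^sup>2 * gauss \<alpha> z" "- l"] assms
    by (simp add: fock_space_iff)
qed

lemma fock_normsq_translation: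
  assumes "f \<in> fock_space \<alpha>"
  shows "fock_normsq \<alpha> (fock_translation \<alpha> l f) = fock_normsq \<alpha> f"
proof -
  note [measurable] = fock_space_measurable[OF assms]
  show ?thesis unfolding fock_normsq_def cmod_fock_translation
    using lborel_translation(2)[of "\<lambda>z. (cmod (f z))\<^sup>2 * gauss \<alpha> z" "- l"] by simp
qed

text \<open>The adjoint of a translation is the inverse translation, so jets at \<open>l\<close> become jets at the origin.\<close>
lemma fock_inner_translation:
  assumes "f \<in> fock_space \<alpha>" "g \<in> fock_space \<alpha>"
  shows "fock_inner \<alpha> f (fock_translation \<alpha> l g) = fock_inner \<alpha> (fock_translation \<alpha> (- l) f) g"
proof -
  note [measurable] = assms[THEN fock_space_measurable]
    fock_space_measurable[OF fock_space_translation[OF assms(2)], of l]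
  have "(LINT z|lborel. f z * cnj (fock_translation \<alpha> l g z) * of_real (gauss \<alpha> z))
      = (LINT z|lborel. f (z + l) * cnj (fock_translation \<alpha> l g (z + l)) * of_real (gauss \<alpha> (z + l)))"
    by (subst lborel_translation(2)[of "\<lambda>z. f z * cnj (fock_translation \<alpha> l g z) * of_real (gauss \<alpha> z)", symmetric]) simp_all
  also have "\<dots> = (LINT z|lborel. fock_translation \<alpha> (- l) f z * cnj (g z) * of_real (gauss \<alpha> z))"
  proof (rule Bochner_Integration.integral_cong[OF refl])
    fix z :: complex
    have "cnj (of_real \<alpha> * cnj l * (z + l) - of_real (\<alpha> / 2 * (cmod l)\<^sup>2)) + of_real (- \<alpha> * (2 * Re (cnj l * z) + (cmod l)\<^sup>2))
      = of_real \<alpha> * (l * cnj z + l * cnj l - of_real (2 * Re (cnj l * z)) - of_real ((cmod l)\<^sup>2)) - of_real (\<alpha> / 2 * (cmod l)\<^sup>2)"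
      by (simp add: algebra_simps)
    also have "of_real (2 * Re (cnj l * z)) = cnj l * z + l * cnj z"
      using complex_add_cnj[of "cnj l * z"] by simp
    also have "of_real ((cmod l)\<^sup>2) = l * cnj l" by (rule complex_norm_square)
    also have "of_real \<alpha> * (l * cnj z + l * cnj l - (cnj l * z + l * cnj z) - l * cnj l) - of_real (\<alpha> / 2 * (cmod l)\<^sup>2)
        = of_real \<alpha> * cnj (- l) * z - complex_of_real (\<alpha> / 2 * (cmod (- l))\<^sup>2)"
      by (simp add: algebra_simps)
    finally have e: "exp (cnj (of_real \<alpha> * cnj l * (z + l) - of_real (\<alpha> / 2 * (cmod l)\<^sup>2))) * exp (of_real (- \<alpha> * (2 * Re (cnj l * z) + (cmod l)\<^sup>2)))
      = exp (of_real \<alpha> * cnj (- l) * z - complex_of_real (\<alpha> / 2 * (cmod (- l))\<^sup>2))"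
      by (simp only: exp_add[symmetric])
    have "f (z + l) * cnj (fock_translation \<alpha> l g (z + l)) * of_real (gauss \<alpha> (z + l))
      = f (z + l) * cnj (g z) * of_real (gauss \<alpha> z) * (exp (cnj (of_real \<alpha> * cnj l * (z + l) - of_real (\<alpha> / 2 * (cmod l)\<^sup>2))) * exp (of_real (- \<alpha> * (2 * Re (cnj l * z) + (cmod l)\<^sup>2))))"
      unfolding fock_translation_def gauss_translate complex_cnj_mult exp_cnj exp_of_real of_real_mult[of "gauss \<alpha> z"]
      by (simp only: add_diff_cancel_right' mult_ac)
    then show "f (z + l) * cnj (fock_translation \<alpha> l g (z + l)) * of_real (gauss \<alpha> (z + l))
        = fock_translation \<alpha> (- l) f z * cnj (g z) * of_real (gauss \<alpha> z)"
      unfolding e by (simp add: fock_translation_def mult_ac)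
  qed
  finally show ?thesis unfolding fock_inner_gauss by simp
qed

lemma fock_translation_basis_orthonormal:
  assumes "\<alpha> > 0"
  shows "fock_inner \<alpha> (fock_translation \<alpha> l (fock_basis \<alpha> j)) (fock_translation \<alpha> l (fock_basis \<alpha> k)) = (if j = k then 1 else 0)"
  using fock_basis_in_fock_space[OF assms]
  by (simp add: fock_inner_translation fock_space_translation fock_translation_inverse fock_basis_orthonormal[OF assms])

section \<open>Overlapping discs obstruct interpolation\<close>

text \<open>Chernoff's bound: with $x = m/\mu \ge 1$ the tail is at most $x^{-m} e^{x\mu}$. The exponent is
  simplified with $\ln(\sqrt\mu/\sqrt m) \le \sqrt\mu/\sqrt m - 1$, which turns it into the square of the
  difference of the roots.\<close>
lemma poisson_tail:
  fixes \<mu> c :: real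
  assumes \<mu>: "\<mu> \<ge> 0" and c: "c \<ge> 0" and gap: "sqrt \<mu> \<le> sqrt (real m) - c"
    and I: "finite I" "I \<subseteq> {m..}"
  shows "(\<Sum>k\<in>I. \<mu> ^ k / fact k) \<le> exp \<mu> * exp (- c\<^sup>2)"
proof (cases "m = 0")
  case True
  then have "c = 0" using gap c real_sqrt_ge_zero[OF \<mu>] by (simp del: real_sqrt_ge_0_iff)
  then show ?thesis using exp_sum_le[OF \<mu> I(1)] by simp
next
  case m: False
  show ?thesis
  proof (cases "\<mu> = 0")
    case True
    then have "(\<Sum>k\<in>I. \<mu> ^ k / fact k) = 0"
      using m I(2) by (intro sum.neutral) (auto simp: power_0_left)
    then show ?thesis by simp
  next
    case False
    define r s where "r = sqrt (real m)" and "s = sqrt \<mu>"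
    have rs: "r > 0" "s > 0" "r\<^sup>2 = real m" "s\<^sup>2 = \<mu>" "s + c \<le> r"
      using m False \<mu> gap by (auto simp: r_def s_def)
    define x where "x = real m / \<mu>"
    have x: "x \<ge> 1"
    proof -
      have "s\<^sup>2 \<le> r\<^sup>2" using rs c by (intro power_mono) auto
      then show ?thesis using rs False \<mu> by (simp add: x_def)
    qed
    have "(\<Sum>k\<in>I. \<mu> ^ k / fact k) \<le> (\<Sum>k\<in>I. (1 / x ^ m) * (real m ^ k / fact k))"
    proof (rule sum_mono)
      fix k assume "k \<in> I"
      then have "x ^ m \<le> x ^ k" using x I(2) by (intro power_increasing) auto
      then have "\<mu> ^ k * x ^ m \<le> \<mu> ^ k * x ^ k" using \<mu> by (intro mult_left_mono) auto
      also have "\<mu> ^ k * x ^ k = real m ^ k"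
        using False by (simp add: x_def power_mult_distrib[symmetric])
      finally show "\<mu> ^ k / fact k \<le> (1 / x ^ m) * (real m ^ k / fact k)"
        using x by (simp add: field_simps)
    qed
    also have "\<dots> \<le> (1 / x ^ m) * exp (real m)"
      unfolding sum_distrib_left[symmetric] using x I(1) by (intro mult_left_mono exp_sum_le) auto
    also have "1 / x ^ m = exp (- (real m * ln x))"
      using x by (simp add: exp_minus exp_of_nat_mult inverse_eq_divide)
    also have "exp (- (real m * ln x)) * exp (real m) = exp (real m - real m * ln x)"
      by (simp add: exp_add[symmetric])
    also have "\<dots> \<le> exp (\<mu> - c\<^sup>2)"
    proof -
      have "ln (s / r) \<le> s / r - 1" using rs by (intro ln_le_minus_one) auto
      moreover have "ln x = - 2 * ln (s / r)"
      proof -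
        have "x = (r / s)\<^sup>2" using rs by (simp add: x_def power_divide)
        then have "ln x = 2 * ln (r / s)" using rs by (simp add: ln_realpow)
        then show ?thesis using rs by (simp add: ln_div)
      qed
      ultimately have "r\<^sup>2 * ln x \<ge> r\<^sup>2 * (2 * (1 - s / r))" by (intro mult_left_mono) auto
      moreover have "r\<^sup>2 * (2 * (1 - s / r)) = 2 * r\<^sup>2 - 2 * r * s"
        using rs by (simp add: field_simps power2_eq_square)
      moreover have "c\<^sup>2 \<le> (r - s)\<^sup>2" using rs c by (intro power_mono) auto
      ultimately show ?thesis using rs by (simp add: power2_diff)
    qed
    also have "\<dots> = exp \<mu> * exp (- c\<^sup>2)" by (simp add: exp_add[symmetric])
    finally show ?thesis .
  qed
qed

lemma fock_basis_tail:
  assumes \<alpha>: "\<alpha> > 0" and C: "C \<ge> 0" and z: "cmod z \<le> sqrt (real m / \<alpha>) - C"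
    and I: "finite I" "I \<subseteq> {m..}"
  shows "(\<Sum>k\<in>I. (cmod (fock_basis \<alpha> k z))\<^sup>2) \<le> exp (\<alpha> * (cmod z)\<^sup>2) * exp (- \<alpha> * C\<^sup>2)"
proof -
  have "sqrt (\<alpha> * (cmod z)\<^sup>2) = sqrt \<alpha> * cmod z" by (simp add: real_sqrt_mult)
  also have "\<dots> \<le> sqrt \<alpha> * (sqrt (real m / \<alpha>) - C)" using z \<alpha> by (intro mult_left_mono) auto
  also have "\<dots> = sqrt (real m) - sqrt \<alpha> * C" using \<alpha> by (simp add: right_diff_distrib real_sqrt_divide)
  finally have "sqrt (\<alpha> * (cmod z)\<^sup>2) \<le> sqrt (real m) - sqrt \<alpha> * C" .
  from poisson_tail[OF _ _ this I] show ?thesis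
    using \<alpha> C by (simp add: cmod_fock_basis[OF \<alpha>] power_mult_distrib)
qed

text \<open>The weighted squares of all basis functions add up to 1, and the tail beyond \<open>m\<close> is at most a half.\<close>
lemma sum_fock_basis_ge_half:
  assumes \<alpha>: "\<alpha> > 0" and C: "C \<ge> 0" and z: "cmod z \<le> sqrt (real m / \<alpha>) - C"
    and half: "exp (- \<alpha> * C\<^sup>2) \<le> 1 / 2"
  shows "(\<Sum>k<m. (cmod (fock_basis \<alpha> k z))\<^sup>2) * gauss \<alpha> z \<ge> 1 / 2"
proof -
  let ?e = "\<lambda>k. (cmod (fock_basis \<alpha> k z))\<^sup>2" and ?x = "\<alpha> * (cmod z)\<^sup>2"
  have "?e sums exp ?x"
    using exp_converges[of ?x] unfolding cmod_fock_basis[OF \<alpha>] by (simp add: inverse_eq_divide)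
  then have "(\<lambda>n. \<Sum>k<n. ?e k) \<longlonglongrightarrow> exp ?x" by (simp add: sums_def)
  moreover have "(\<Sum>k<n. ?e k) \<le> (\<Sum>k<m. ?e k) + exp ?x * exp (- \<alpha> * C\<^sup>2)" if "n \<ge> m" for n
  proof -
    have "(\<Sum>k<n. ?e k) = (\<Sum>k<m. ?e k) + (\<Sum>k=m..<n. ?e k)"
      using that by (simp add: lessThan_atLeast0 sum.atLeastLessThan_concat)
    then show ?thesis using fock_basis_tail[OF \<alpha> C z, of "{m..<n}"] by fastforce
  qed
  ultimately have "exp ?x \<le> (\<Sum>k<m. ?e k) + exp ?x * exp (- \<alpha> * C\<^sup>2)"
    using LIMSEQ_le_const2 by blast
  also have "\<dots> \<le> (\<Sum>k<m. ?e k) + exp ?x * (1 / 2)"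
    using half by (intro add_left_mono mult_left_mono) auto
  finally have "exp ?x * (1 / 2) \<le> (\<Sum>k<m. ?e k)" by simp
  then have "exp ?x * (1 / 2) * gauss \<alpha> z \<le> (\<Sum>k<m. ?e k) * gauss \<alpha> z"
    by (rule mult_right_mono) simp
  moreover have "exp ?x * (1 / 2) * gauss \<alpha> z = 1 / 2"
    by (simp add: gauss_def exp_minus)
  ultimately show ?thesis by simp
qed

text \<open>Both sides are weighted by the square root of the Gaussian, the scale on which
  \<open>fock_pointwise_bound\<close> is uniform; this makes the values seen from different centres comparable.\<close>
lemma jet_determines_value:
  assumes \<alpha>: "\<alpha> > 0" and C: "C \<ge> 0" and z: "cmod (w - l) \<le> sqrt (real m / \<alpha>) - C"
    and f: "f \<in> fock_space \<alpha>"
  defines "g \<equiv> fock_translation \<alpha> (- l) f"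
  shows "cmod (g (w - l)) * sqrt (gauss \<alpha> (w - l)) = cmod (f w) * sqrt (gauss \<alpha> w)"
    and "cmod (g (w - l) - (\<Sum>k<m. fock_inner \<alpha> f (fock_translation \<alpha> l (fock_basis \<alpha> k)) * fock_basis \<alpha> k (w - l)))
        * sqrt (gauss \<alpha> (w - l)) \<le> sqrt (fock_normsq \<alpha> f) * exp (- \<alpha> * C\<^sup>2 / 2)"
proof -
  have "sqrt ((cmod (g (w - l)))\<^sup>2 * gauss \<alpha> (w - l)) = sqrt ((cmod (f w))\<^sup>2 * gauss \<alpha> w)"
    unfolding g_def cmod_fock_translation by simp
  then show "cmod (g (w - l)) * sqrt (gauss \<alpha> (w - l)) = cmod (f w) * sqrt (gauss \<alpha> w)"
    by (simp add: real_sqrt_mult)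
  let ?d = "g (w - l) - (\<Sum>k<m. fock_inner \<alpha> f (fock_translation \<alpha> l (fock_basis \<alpha> k)) * fock_basis \<alpha> k (w - l))"
  have g: "g \<in> fock_space \<alpha>" unfolding g_def by (rule fock_space_translation[OF f])
  have "(cmod ?d)\<^sup>2 \<le> fock_normsq \<alpha> g * (exp (\<alpha> * (cmod (w - l))\<^sup>2) * exp (- \<alpha> * C\<^sup>2))"
    unfolding g_def fock_inner_translation[OF f fock_basis_in_fock_space[OF \<alpha>]]
    by (intro fock_truncation[OF \<alpha> fock_space_translation[OF f]] fock_basis_tail[OF \<alpha> C z]) auto
  then have "(cmod ?d)\<^sup>2 * gauss \<alpha> (w - l)
      \<le> fock_normsq \<alpha> g * (exp (\<alpha> * (cmod (w - l))\<^sup>2) * exp (- \<alpha> * C\<^sup>2)) * gauss \<alpha> (w - l)"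
    by (intro mult_right_mono) auto
  also have "\<dots> = fock_normsq \<alpha> f * (exp (- \<alpha> * C\<^sup>2 / 2))\<^sup>2"
  proof -
    have "exp (\<alpha> * (cmod (w - l))\<^sup>2) * gauss \<alpha> (w - l) = 1" by (simp add: gauss_def exp_minus)
    moreover have "(exp (- \<alpha> * C\<^sup>2 / 2))\<^sup>2 = exp (- \<alpha> * C\<^sup>2)" by (simp add: exp_double[symmetric])
    ultimately show ?thesis
      unfolding g_def fock_normsq_translation[OF f] by (simp add: mult_ac)
  qed
  finally have "sqrt ((cmod ?d)\<^sup>2 * gauss \<alpha> (w - l)) \<le> sqrt (fock_normsq \<alpha> f * (exp (- \<alpha> * C\<^sup>2 / 2))\<^sup>2)"
    by (rule real_sqrt_le_mono)
  then show "cmod ?d * sqrt (gauss \<alpha> (w - l)) \<le> sqrt (fock_normsq \<alpha> f) * exp (- \<alpha> * C\<^sup>2 / 2)"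
    by (simp add: real_sqrt_mult)
qed

text \<open>The jet prescribed at \<open>l\<close> is that of a multiple of the reproducing kernel at \<open>w\<close>, the datum
  that makes the value at \<open>w\<close> as large as its norm permits; the zero jet at \<open>l'\<close> makes the same value tiny.\<close>
lemma overlap_forces_large_norm:
  assumes \<alpha>: "\<alpha> > 0" and C: "C \<ge> 0" and half: "exp (- \<alpha> * C\<^sup>2) \<le> 1 / 2" and t: "t \<ge> 0"
    and f: "f \<in> fock_space \<alpha>"
    and w: "cmod (w - l) \<le> sqrt (real m / \<alpha>) - C" "cmod (w - l') \<le> sqrt (real m' / \<alpha>) - C"
    and v: "\<And>k. k < m \<Longrightarrow> fock_inner \<alpha> f (fock_translation \<alpha> l (fock_basis \<alpha> k))
        = of_real (t * sqrt (gauss \<alpha> (w - l))) * cnj (fock_basis \<alpha> k (w - l))"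
    and v': "\<And>k. k < m' \<Longrightarrow> fock_inner \<alpha> f (fock_translation \<alpha> l' (fock_basis \<alpha> k)) = 0"
  shows "t \<le> 4 * sqrt (fock_normsq \<alpha> f) * exp (- \<alpha> * C\<^sup>2 / 2)"
proof -
  let ?R = "sqrt (fock_normsq \<alpha> f) * exp (- \<alpha> * C\<^sup>2 / 2)" and ?z = "w - l"
  let ?g = "fock_translation \<alpha> (- l) f ?z"
  let ?S = "\<Sum>k<m. (cmod (fock_basis \<alpha> k ?z))\<^sup>2"
  have small: "cmod (f w) * sqrt (gauss \<alpha> w) \<le> ?R"
    using jet_determines_value[OF \<alpha> C w(2) f] v' by simp
  have "(\<Sum>k<m. fock_inner \<alpha> f (fock_translation \<alpha> l (fock_basis \<alpha> k)) * fock_basis \<alpha> k ?z)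
      = (\<Sum>k<m. of_real (t * sqrt (gauss \<alpha> ?z)) * (cnj (fock_basis \<alpha> k ?z) * fock_basis \<alpha> k ?z))"
    by (intro sum.cong) (simp_all add: v mult.assoc)
  also have "\<dots> = of_real (t * sqrt (gauss \<alpha> ?z) * ?S)"
    unfolding sum_distrib_left[symmetric]
    by (simp add: complex_norm_square mult.commute del: of_real_power)
  finally have "cmod (?g - of_real (t * sqrt (gauss \<alpha> ?z) * ?S)) * sqrt (gauss \<alpha> ?z) \<le> ?R"
    using jet_determines_value(2)[OF \<alpha> C w(1) f] by simp
  moreover have "t * sqrt (gauss \<alpha> ?z) * ?S \<le> cmod ?g + cmod (?g - of_real (t * sqrt (gauss \<alpha> ?z) * ?S))"
  proof -
    have "0 \<le> t * sqrt (gauss \<alpha> ?z) * ?S" using t by (intro mult_nonneg_nonneg sum_nonneg) auto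
    then have "cmod (of_real (t * sqrt (gauss \<alpha> ?z) * ?S)) = t * sqrt (gauss \<alpha> ?z) * ?S"
      by (simp only: norm_of_real abs_of_nonneg)
    then show ?thesis
      using norm_triangle_sub[of "of_real (t * sqrt (gauss \<alpha> ?z) * ?S)" ?g]
      by (simp only: norm_minus_commute)
  qed
  then have "t * sqrt (gauss \<alpha> ?z) * ?S * sqrt (gauss \<alpha> ?z)
      \<le> (cmod ?g + cmod (?g - of_real (t * sqrt (gauss \<alpha> ?z) * ?S))) * sqrt (gauss \<alpha> ?z)"
    by (rule mult_right_mono) simp
  moreover have "t * sqrt (gauss \<alpha> ?z) * ?S * sqrt (gauss \<alpha> ?z) = t * (?S * gauss \<alpha> ?z)"
    by (simp add: mult_ac)
  moreover have "t * (?S * gauss \<alpha> ?z) \<ge> t * (1 / 2)"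
    using sum_fock_basis_ge_half[OF \<alpha> C w(1) half] t by (intro mult_left_mono) auto
  ultimately have "t * (1 / 2) \<le> cmod ?g * sqrt (gauss \<alpha> ?z) + ?R"
    by (simp add: distrib_right)
  then show ?thesis using small jet_determines_value(1)[OF \<alpha> C w(1) f] by simp
qed

text \<open>The parameters \<open>C\<close> are chosen recursively so that $\alpha C^2$ exceeds all earlier multiplicities.
  Since the points of a pair that is bad for \<open>C\<close> have multiplicity above $\alpha C^2$, the pairs chosen at
  different stages consist of different points and the prescribed data do not interfere.\<close>
theorem interpolating_imp_disjoint:
  assumes \<alpha>: "\<alpha> > 0" and int: "interpolating_divisor \<alpha> \<Lambda> m"
  shows "\<exists>C>0. disjoint_family_on (\<lambda>l. ball l (sqrt (real (m l) / \<alpha>) - C)) {l \<in> \<Lambda>. real (m l) > \<alpha> * C\<^sup>2}"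
proof (rule ccontr)
  assume contra: "\<not> ?thesis"
  define bad where "bad = (\<lambda>C l l' w. l \<in> \<Lambda> \<and> l' \<in> \<Lambda> \<and> l \<noteq> l' \<and> real (m l) > \<alpha> * C\<^sup>2 \<and> real (m l') > \<alpha> * C\<^sup>2
     \<and> cmod (w - l) \<le> sqrt (real (m l) / \<alpha>) - C \<and> cmod (w - l') \<le> sqrt (real (m l') / \<alpha>) - C)"
  have ex: "\<exists>C l l' w. C \<ge> 1 \<and> \<alpha> * C\<^sup>2 \<ge> K \<and> bad C l l' w" for K
  proof -
    \<comment> \<open>\<open>C \<ge> 1\<close> gives \<open>C\<^sup>2 \<ge> C\<close>, so this choice makes \<open>\<alpha> * C\<^sup>2 \<ge> K\<close>\<close>
    define C where "C = max 1 (K / \<alpha>)"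
    have C: "C \<ge> 1" by (simp add: C_def)
    have "K / \<alpha> \<le> C" by (simp add: C_def)
    also have "C \<le> C\<^sup>2" using C by (simp add: self_le_power)
    finally have CK: "\<alpha> * C\<^sup>2 \<ge> K" using \<alpha> by (simp add: pos_divide_le_eq mult.commute)
    have "C > 0" using C by simp
    then have "\<not> disjoint_family_on (\<lambda>l. ball l (sqrt (real (m l) / \<alpha>) - C)) {l \<in> \<Lambda>. real (m l) > \<alpha> * C\<^sup>2}"
      using contra by blast
    then obtain l l' w where "l \<in> {l \<in> \<Lambda>. real (m l) > \<alpha> * C\<^sup>2}" "l' \<in> {l \<in> \<Lambda>. real (m l) > \<alpha> * C\<^sup>2}" "l \<noteq> l'"
      "w \<in> ball l (sqrt (real (m l) / \<alpha>) - C)" "w \<in> ball l' (sqrt (real (m l') / \<alpha>) - C)"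
      unfolding disjoint_family_on_def by blast
    then have "bad C l l' w"
      unfolding bad_def by (auto simp: dist_norm norm_minus_commute less_imp_le)
    then show ?thesis using C CK by blast
  qed
  \<comment> \<open>the growth \<open>4 * Suc n\<close> makes the error at stage \<open>n\<close> at most \<open>(1 / 4) ^ Suc n\<close>, far below the size \<open>(1 / 2) ^ n\<close> of the data\<close>
  define P where "P = (\<lambda>(n::nat) (C, l, l', w). C \<ge> 1 \<and> \<alpha> * C\<^sup>2 \<ge> 4 * real (Suc n) \<and> bad C l l' w)"
  define Q where "Q = (\<lambda>(n::nat) (C::real, l, l', w::complex) (C', k::complex, k'::complex, w'::complex).
      \<alpha> * C'\<^sup>2 \<ge> max (real (m l)) (real (m l')))"
  have "\<exists>s. \<forall>n. P n (s n) \<and> Q n (s n) (s (Suc n))"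
  proof (rule dependent_nat_choice)
    show "\<exists>x. P 0 x" using ex[of 4] by (auto simp: P_def)
  next
    fix x :: "real \<times> complex \<times> complex \<times> complex" and n
    obtain C l l' w where x: "x = (C, l, l', w)" by (metis surj_pair)
    from ex[of "max (4 * real (Suc (Suc n))) (max (real (m l)) (real (m l')))"]
    obtain D k k' u where "D \<ge> 1" "max (4 * real (Suc (Suc n))) (max (real (m l)) (real (m l'))) \<le> \<alpha> * D\<^sup>2" "bad D k k' u"
      by blast
    then have "P (Suc n) (D, k, k', u) \<and> Q n x (D, k, k', u)" by (simp add: P_def Q_def x)
    then show "\<exists>y. P (Suc n) y \<and> Q n x y" by blast
  qed
  then obtain s where s: "\<And>n. P n (s n)" "\<And>n. Q n (s n) (s (Suc n))" by blast
  define C l l' w where "C = (\<lambda>n. fst (s n))" and "l = (\<lambda>n. fst (snd (s n)))"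
    and "l' = (\<lambda>n. fst (snd (snd (s n))))" and "w = (\<lambda>n. snd (snd (snd (s n))))"
  have C: "C n \<ge> 1" "\<alpha> * (C n)\<^sup>2 \<ge> 4 * real (Suc n)" "bad (C n) (l n) (l' n) (w n)" for n
    using s(1)[of n] by (auto simp: P_def C_def l_def l'_def w_def split: prod.splits)
  have nxt: "max (real (m (l n))) (real (m (l' n))) \<le> \<alpha> * (C (Suc n))\<^sup>2" for n
    using s(2)[of n] by (auto simp: Q_def C_def l_def l'_def w_def split: prod.splits)
  \<comment> \<open>the multiplicities of stage \<open>n\<close> lie between \<open>lo n\<close> and \<open>hi n\<close>, and these ranges are disjoint and increasing\<close>
  define lo hi where "lo = (\<lambda>n. min (real (m (l n))) (real (m (l' n))))"
    and "hi = (\<lambda>n. max (real (m (l n))) (real (m (l' n))))"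
  have step: "hi n < lo (Suc n)" for n
    using nxt[of n] C(3)[of "Suc n"] by (auto simp: lo_def hi_def bad_def)
  have "lo n \<le> hi n" for n by (simp add: lo_def hi_def)
  then have "lo n \<le> lo (Suc n)" for n using step[of n] by (meson less_imp_le order_trans)
  then have "mono lo" by (simp add: mono_iff_le_Suc)
  then have sep: "hi i < lo j" if "i < j" for i j
    using step[of i] that by (meson Suc_leI less_le_trans monoD)
  have inj: "inj l"
  proof (rule linorder_injI)
    fix i j :: nat assume "i < j"
    from sep[OF this] show "l i \<noteq> l j" by (auto simp: hi_def lo_def)
  qed
  have not_l: "l' j \<notin> range l" for j
  proof
    assume "l' j \<in> range l"
    then obtain i where i: "l' j = l i" by auto
    have "i \<noteq> j" using C(3)[of j] i by (auto simp: bad_def)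
    then show False using sep[of i j] sep[of j i] i by (auto simp: hi_def lo_def neq_iff)
  qed
  define v where "v = (\<lambda>x k. if x \<in> range l then
      of_real ((1 / 2) ^ inv l x * sqrt (gauss \<alpha> (w (inv l x) - x))) * cnj (fock_basis \<alpha> k (w (inv l x) - x)) else 0)"
  have vl: "v (l n) k = of_real ((1 / 2) ^ n * sqrt (gauss \<alpha> (w n - l n))) * cnj (fock_basis \<alpha> k (w n - l n))" for n k
    by (simp add: v_def inv_f_f[OF inj])
  have "(\<lambda>x. \<Sum>k<m x. (cmod (v x k))\<^sup>2) summable_on \<Lambda>"
  proof -
    have bd: "(\<Sum>k<m (l n). (cmod (v (l n) k))\<^sup>2) \<le> (1 / 4) ^ n" for n
    proof -
      have "(\<Sum>k<m (l n). (cmod (v (l n) k))\<^sup>2)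
          = (\<Sum>k<m (l n). ((1 / 4) ^ n * gauss \<alpha> (w n - l n)) * (cmod (fock_basis \<alpha> k (w n - l n)))\<^sup>2)"
      proof (intro sum.cong refl)
        fix k
        have q: "((1 / 2) ^ n)\<^sup>2 = (1 / 4 :: real) ^ n"
          by (simp add: power2_eq_square power_mult_distrib[symmetric])
        have "cmod (v (l n) k) = (1 / 2) ^ n * sqrt (gauss \<alpha> (w n - l n)) * cmod (fock_basis \<alpha> k (w n - l n))"
          unfolding vl norm_mult norm_of_real complex_mod_cnj by (simp add: abs_mult)
        then show "(cmod (v (l n) k))\<^sup>2 = ((1 / 4) ^ n * gauss \<alpha> (w n - l n)) * (cmod (fock_basis \<alpha> k (w n - l n)))\<^sup>2"
          by (simp only: power_mult_distrib q real_sqrt_pow2 gauss_nonneg)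
      qed
      also have "\<dots> \<le> ((1 / 4) ^ n * gauss \<alpha> (w n - l n)) * exp (\<alpha> * (cmod (w n - l n))\<^sup>2)"
        unfolding sum_distrib_left[symmetric] cmod_fock_basis[OF \<alpha>]
        using \<alpha> by (intro mult_left_mono exp_sum_le) auto
      also have "\<dots> = (1 / 4) ^ n" by (simp add: gauss_def exp_minus)
      finally show ?thesis .
    qed
    have "(\<lambda>n. \<Sum>k<m (l n). (cmod (v (l n) k))\<^sup>2) summable_on UNIV"
    proof (rule norm_summable_imp_summable_on)
      show "summable (\<lambda>n. norm (\<Sum>k<m (l n). (cmod (v (l n) k))\<^sup>2))"
        by (rule summable_comparison_test'[of "\<lambda>n. (1 / 4) ^ n" 0])
           (use bd in \<open>auto simp: sum_nonneg intro!: summable_geometric\<close>)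
    qed
    then have "(\<lambda>x. \<Sum>k<m x. (cmod (v x k))\<^sup>2) summable_on range l"
      using summable_on_reindex[OF inj, of "\<lambda>x. \<Sum>k<m x. (cmod (v x k))\<^sup>2"] by (simp add: o_def)
    moreover have "range l \<subseteq> \<Lambda>" using C(3) by (auto simp: bad_def)
    ultimately show ?thesis
      by (subst summable_on_cong_neutral[where T="range l"]) (auto simp: v_def)
  qed
  then obtain f where f: "f \<in> fock_space \<alpha>"
    and fv: "\<And>x k. x \<in> \<Lambda> \<Longrightarrow> k < m x \<Longrightarrow> fock_inner \<alpha> f (fock_translation \<alpha> x (fock_basis \<alpha> k)) = v x k"
    using int unfolding interpolating_divisor_def by blast
  define N where "N = sqrt (fock_normsq \<alpha> f)"
  have e4: "exp (- 2) \<le> (1 / 4 :: real)"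
  proof -
    have "(2::real) ^ 2 \<le> exp 1 ^ 2" using exp_ge_add_one_self[of 1] by (intro power_mono) auto
    also have "exp 1 ^ 2 = exp (2::real)" by (simp add: exp_double[symmetric])
    finally have "4 \<le> exp (2::real)" by simp
    then show ?thesis by (simp add: exp_minus field_simps)
  qed
  have "2 ^ n \<le> N" for n
  proof -
    note b = C(3)[of n, unfolded bad_def]
    have small: "exp (- \<alpha> * (C n)\<^sup>2 / 2) \<le> (1 / 4) ^ Suc n"
    proof -
      have "exp (- \<alpha> * (C n)\<^sup>2 / 2) \<le> exp (real (Suc n) * (- 2))" using C(2)[of n] by simp
      also have "\<dots> = exp (- 2) ^ Suc n" by (rule exp_of_nat_mult)
      also have "\<dots> \<le> (1 / 4) ^ Suc n" by (intro power_mono e4) auto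
      finally show ?thesis .
    qed
    have half: "exp (- \<alpha> * (C n)\<^sup>2) \<le> 1 / 2"
    proof -
      have "exp (- \<alpha> * (C n)\<^sup>2) \<le> exp (- 2)" using C(2)[of n] by simp
      then show ?thesis using e4 by linarith
    qed
    have "(1 / 2) ^ n \<le> 4 * sqrt (fock_normsq \<alpha> f) * exp (- \<alpha> * (C n)\<^sup>2 / 2)"
    proof (rule overlap_forces_large_norm[OF \<alpha> _ half _ f, where w="w n" and l="l n" and l'="l' n"
          and m="m (l n)" and m'="m (l' n)"])
      show "0 \<le> C n" using C(1)[of n] by simp
      show "fock_inner \<alpha> f (fock_translation \<alpha> (l n) (fock_basis \<alpha> k))
        = of_real ((1 / 2) ^ n * sqrt (gauss \<alpha> (w n - l n))) * cnj (fock_basis \<alpha> k (w n - l n))" if "k < m (l n)" for k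
        using fv[of "l n" k] that b vl by simp
      show "fock_inner \<alpha> f (fock_translation \<alpha> (l' n) (fock_basis \<alpha> k)) = 0" if "k < m (l' n)" for k
        using fv[of "l' n" k] that b not_l[of n] by (simp add: v_def)
    qed (use b in auto)
    also have "\<dots> \<le> 4 * N * (1 / 4) ^ Suc n"
      unfolding N_def using small fock_normsq_nonneg[OF \<alpha>, of f] by (intro mult_left_mono) auto
    also have "\<dots> = N * (1 / 4) ^ n" by simp
    finally have "(1 / 2) ^ n * 4 ^ n \<le> N * (1 / 4) ^ n * 4 ^ n" by (rule mult_right_mono) simp
    moreover have "(1 / 2) ^ n * 4 ^ n = (2::real) ^ n" "N * (1 / 4) ^ n * 4 ^ n = N"
      by (simp_all add: power_mult_distrib[symmetric] mult.assoc)
    ultimately show ?thesis by simp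
  qed
  moreover obtain n where "N < 2 ^ n" using real_arch_pow[of 2 N] by auto
  ultimately show False by (meson not_le)
qed

section \<open>Radial weights\<close>

lemma tame_radial:
  fixes \<phi> :: "real \<Rightarrow> real"
  assumes "\<And>s. s \<ge> 0 \<Longrightarrow> \<bar>\<phi> s\<bar> \<le> M"
    and "\<And>s t. s \<ge> 0 \<Longrightarrow> t \<ge> 0 \<Longrightarrow> \<bar>\<phi> s - \<phi> t\<bar> \<le> K * \<bar>s - t\<bar>" and "K \<ge> 0"
  shows "tame (\<lambda>z. of_real (\<phi> ((cmod z)\<^sup>2)))"
proof (rule tameI)
  fix z show "cmod (of_real (\<phi> ((cmod z)\<^sup>2))) \<le> M * exp (0 * cmod z)"
    using assms(1)[of "(cmod z)\<^sup>2"] by simp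
next
  fix z w :: complex assume zw: "cmod (z - w) \<le> 1"
  have "\<bar>(cmod z)\<^sup>2 - (cmod w)\<^sup>2\<bar> = \<bar>cmod z - cmod w\<bar> * (cmod z + cmod w)"
    by (simp add: power2_eq_square square_diff_square_factored abs_mult mult.commute)
  also have "\<dots> \<le> cmod (z - w) * (1 + 2 * cmod z)"
    using norm_triangle_ineq3[of z w] zw norm_triangle_sub[of w z]
    by (intro mult_mono) (auto simp: norm_minus_commute)
  also have "\<dots> \<le> cmod (z - w) * exp (2 * cmod z)"
    by (intro mult_left_mono exp_ge_add_one_self) auto
  finally have d: "\<bar>(cmod z)\<^sup>2 - (cmod w)\<^sup>2\<bar> \<le> cmod (z - w) * exp (2 * cmod z)" .
  have "cmod (of_real (\<phi> ((cmod z)\<^sup>2)) - of_real (\<phi> ((cmod w)\<^sup>2))) = \<bar>\<phi> ((cmod z)\<^sup>2) - \<phi> ((cmod w)\<^sup>2)\<bar>"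
    by (simp flip: of_real_diff)
  also have "\<dots> \<le> K * \<bar>(cmod z)\<^sup>2 - (cmod w)\<^sup>2\<bar>" by (rule assms(2)) auto
  also have "\<dots> \<le> K * (cmod (z - w) * exp (2 * cmod z))" by (rule mult_left_mono[OF d assms(3)])
  finally show "cmod (of_real (\<phi> ((cmod z)\<^sup>2)) - of_real (\<phi> ((cmod w)\<^sup>2))) \<le> K * exp (2 * cmod z) * cmod (z - w)"
    by (simp add: mult_ac)
qed

lemma tame_translate:
  assumes "tame f" shows "tame (\<lambda>z. f (z - l))"
proof -
  obtain A B where f: "A \<ge> 0" "B \<ge> 0" "\<And>z. cmod (f z) \<le> A * exp (B * cmod z)"
    "\<And>z w. cmod (z - w) \<le> 1 \<Longrightarrow> cmod (f z - f w) \<le> A * exp (B * cmod z) * cmod (z - w)"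
    using assms by (rule tameE) blast
  have e: "A * exp (B * cmod (z - l)) \<le> A * exp (B * cmod l) * exp (B * cmod z)" for z
  proof -
    have "B * cmod (z - l) \<le> B * (cmod z + cmod l)"
      using f(2) by (intro mult_left_mono norm_triangle_ineq4)
    then have "exp (B * cmod (z - l)) \<le> exp (B * cmod l) * exp (B * cmod z)"
      by (simp add: exp_add[symmetric] algebra_simps)
    then show ?thesis using mult_left_mono[OF _ f(1)] by (simp add: mult.assoc)
  qed
  show ?thesis
  proof (rule tameI)
    fix z show "cmod (f (z - l)) \<le> A * exp (B * cmod l) * exp (B * cmod z)"
      using f(3)[of "z - l"] e[of z] by linarith
  next
    fix z w :: complex assume "cmod (z - w) \<le> 1"
    then have "cmod (f (z - l) - f (w - l)) \<le> A * exp (B * cmod (z - l)) * cmod (z - w)"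
      using f(4)[of "z - l" "w - l"] by simp
    also have "\<dots> \<le> A * exp (B * cmod l) * exp (B * cmod z) * cmod (z - w)"
      by (rule mult_right_mono[OF e]) simp
    finally show "cmod (f (z - l) - f (w - l)) \<le> A * exp (B * cmod l) * exp (B * cmod z) * cmod (z - w)" .
  qed
qed

lemma has_wirtinger_translate:
  assumes "has_wirtinger f a b (z - l)" shows "has_wirtinger (\<lambda>z. f (z - l)) a b z"
proof -
  have "((\<lambda>z. z - l) has_derivative (\<lambda>h. h)) (at z)" by (auto intro!: derivative_eq_intros)
  from has_derivative_compose[OF this assms[unfolded has_wirtinger_def]]
  show ?thesis unfolding has_wirtinger_def .
qed

lemma has_dbar_translate:
  "has_dbar f b (z - l) \<Longrightarrow> has_dbar (\<lambda>z. f (z - l)) b z"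
  unfolding has_dbar_def using has_wirtinger_translate by blast

text \<open>The holomorphic derivative of the logarithmic potential of a unit mass spread uniformly over the
  disc of radius \<open>r\<close> (the potential is $\log|z|^2$ outside the disc): it agrees with $1/z$ outside and is continuous across the circle.\<close>
definition rinv :: "real \<Rightarrow> complex \<Rightarrow> complex" where
  "rinv r z = cnj z / of_real (max ((cmod z)\<^sup>2) (r\<^sup>2))"

text \<open>The exponential of minus that potential, normalised so that it is $1/|z|^2$ outside the disc.\<close>
definition wt :: "real \<Rightarrow> complex \<Rightarrow> real" where
  "wt r z = exp (1 - min ((cmod z)\<^sup>2 / r\<^sup>2) 1) / max ((cmod z)\<^sup>2) (r\<^sup>2)"

lemma rinv_outside:
  assumes "0 < r" "r \<le> cmod z" shows "rinv r z = inverse z"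
proof -
  have "r\<^sup>2 \<le> (cmod z)\<^sup>2" using assms by (intro power_mono) auto
  then have "rinv r z = cnj z / (z * cnj z)"
    unfolding rinv_def by (simp add: max_def complex_norm_square del: of_real_power)
  also have "\<dots> = inverse z" using assms by (auto simp: field_simps)
  finally show ?thesis .
qed

lemma rinv_inside:
  assumes "cmod z \<le> r" shows "rinv r z = cnj z / of_real (r\<^sup>2)"
proof -
  have "(cmod z)\<^sup>2 \<le> r\<^sup>2" using assms by (intro power_mono) auto
  then show ?thesis by (simp add: rinv_def max_def)
qed

lemma wt_outside:
  assumes "0 < r" "r \<le> cmod z" shows "wt r z = 1 / (cmod z)\<^sup>2"
proof -
  have "r\<^sup>2 \<le> (cmod z)\<^sup>2" using assms by (intro power_mono) auto
  then show ?thesis using assms by (simp add: wt_def max_def min_def field_simps)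
qed

lemma wt_inside:
  assumes "0 < r" "cmod z \<le> r" shows "wt r z = exp (1 - (cmod z)\<^sup>2 / r\<^sup>2) / r\<^sup>2"
proof -
  have "(cmod z)\<^sup>2 \<le> r\<^sup>2" using assms by (intro power_mono) auto
  then show ?thesis using assms by (simp add: wt_def max_def min_def field_simps)
qed

lemma wt_nonneg: "0 \<le> wt r z"
  by (simp add: wt_def max_def)

text \<open>Inside the disc this is $t e^{1-t} \le 1$: spreading the mass over the disc raises the potential.\<close>
lemma wt_le: assumes "r > 0" shows "(cmod z)\<^sup>2 * wt r z \<le> 1"
proof (cases "r \<le> cmod z")
  case True
  then show ?thesis using wt_outside[OF assms True] assms by auto
next
  case False
  define t where "t = (cmod z)\<^sup>2 / r\<^sup>2"
  have "t * exp (1 - t) \<le> 1"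
  proof -
    have "t * exp (1 - t) \<le> exp (t - 1) * exp (1 - t)"
      using exp_ge_add_one_self[of "t - 1"] by (intro mult_right_mono) auto
    then show ?thesis by (simp add: exp_add[symmetric])
  qed
  then show ?thesis using wt_inside[OF assms, of z] False by (simp add: t_def)
qed

lemma tame_inverse_max: assumes "r > 0" shows "tame (\<lambda>z. of_real (1 / max ((cmod z)\<^sup>2) (r\<^sup>2)))"
proof (rule tame_radial[where M="1 / r\<^sup>2" and K="1 / r ^ 4" and \<phi>="\<lambda>s. 1 / max s (r\<^sup>2)"])
  fix s :: real assume "s \<ge> 0"
  show "\<bar>1 / max s (r\<^sup>2)\<bar> \<le> 1 / r\<^sup>2" using assms by (simp add: frac_le)
next
  fix s t :: real
  have p: "max s (r\<^sup>2) \<ge> r\<^sup>2" "max t (r\<^sup>2) \<ge> r\<^sup>2" "r\<^sup>2 > 0" using assms by auto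
  have "\<bar>1 / max s (r\<^sup>2) - 1 / max t (r\<^sup>2)\<bar> = \<bar>max t (r\<^sup>2) - max s (r\<^sup>2)\<bar> / (max s (r\<^sup>2) * max t (r\<^sup>2))"
  proof -
    have "\<bar>1 / a - 1 / b\<bar> = \<bar>b - a\<bar> / (a * b)" if "a > 0" "b > 0" for a b :: real
      using that by (simp add: diff_frac_eq abs_mult)
    then show ?thesis using p by (meson less_le_trans)
  qed
  also have "\<dots> \<le> \<bar>s - t\<bar> / (r\<^sup>2 * r\<^sup>2)"
  proof -
    have "r\<^sup>2 * r\<^sup>2 \<le> max s (r\<^sup>2) * max t (r\<^sup>2)"
      by (rule mult_mono) (use p in linarith)+
    moreover have "\<bar>max t (r\<^sup>2) - max s (r\<^sup>2)\<bar> \<le> \<bar>s - t\<bar>" by (auto simp: max_def)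
    ultimately show ?thesis using p(3) by (intro frac_le) auto
  qed
  finally show "\<bar>1 / max s (r\<^sup>2) - 1 / max t (r\<^sup>2)\<bar> \<le> 1 / r ^ 4 * \<bar>s - t\<bar>"
    by (simp add: power_add[symmetric])
qed (use assms in auto)

lemma tame_rinv: assumes "r > 0" shows "tame (rinv r)"
  using tame_mult[OF tame_cnj[OF tame_ident] tame_inverse_max[OF assms]]
  by (simp add: rinv_def[abs_def])

lemma tame_wt: assumes "r > 0" shows "tame (\<lambda>z. of_real (wt r z))"
proof -
  have "tame (\<lambda>z. of_real (exp (1 - min ((cmod z)\<^sup>2 / r\<^sup>2) 1)))"
  proof (rule tame_radial[where M="exp 1" and K="exp 1 / r\<^sup>2" and \<phi>="\<lambda>s. exp (1 - min (s / r\<^sup>2) 1)"])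
    fix s :: real assume "s \<ge> 0"
    then show "\<bar>exp (1 - min (s / r\<^sup>2) 1)\<bar> \<le> exp 1" by simp
  next
    fix s t :: real assume st: "s \<ge> 0" "t \<ge> 0"
    let ?u = "1 - min (s / r\<^sup>2) 1" and ?v = "1 - min (t / r\<^sup>2) 1"
    have "\<bar>exp ?u - exp ?v\<bar> \<le> \<bar>?u - ?v\<bar> * exp (max ?u ?v)" by (rule abs_exp_diff_le)
    also have "\<dots> \<le> \<bar>s / r\<^sup>2 - t / r\<^sup>2\<bar> * exp 1"
      using st by (intro mult_mono) (auto simp: min_def max_def)
    also have "\<dots> = exp 1 / r\<^sup>2 * \<bar>s - t\<bar>"
      using assms by (simp add: diff_divide_distrib[symmetric])
    finally show "\<bar>exp ?u - exp ?v\<bar> \<le> exp 1 / r\<^sup>2 * \<bar>s - t\<bar>" .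
  qed simp
  from tame_mult[OF this tame_inverse_max[OF assms]] show ?thesis
    by (simp add: wt_def)
qed

definition dbar_rinv :: "real \<Rightarrow> complex \<Rightarrow> real" where
  "dbar_rinv r z = (if cmod z < r then 1 / r\<^sup>2 else 0)"

lemma dbar_rinv_measurable [measurable]: "dbar_rinv r \<in> borel_measurable borel"
  unfolding dbar_rinv_def[abs_def] by measurable

lemma has_wirtinger_cnj_ident: "has_wirtinger cnj 0 1 z"
  using has_wirtinger_cnj[OF has_wirtinger_ident] by simp

lemma has_dbar_rinv:
  assumes "r > 0" "cmod z \<noteq> r" shows "has_dbar (rinv r) (of_real (dbar_rinv r z)) z"
proof (cases "cmod z < r")
  case True
  have "has_wirtinger (\<lambda>z. of_real (1 / r\<^sup>2) * cnj z) (0 * cnj z + of_real (1 / r\<^sup>2) * 0)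
      (0 * cnj z + of_real (1 / r\<^sup>2) * 1) z"
    by (intro has_wirtinger_mult has_wirtinger_const has_wirtinger_cnj_ident)
  then have "has_dbar (\<lambda>z. of_real (1 / r\<^sup>2) * cnj z) (of_real (dbar_rinv r z)) z"
    unfolding has_dbar_def using True by (auto simp: dbar_rinv_def)
  then show ?thesis
    by (rule has_dbar_eq_near[where U="ball 0 r"]) (use True rinv_inside in auto)
next
  case False
  then have z: "cmod z > r" "z \<noteq> 0" using assms by auto
  have "(inverse has_field_derivative - (inverse z ^ Suc (Suc 0))) (at z)"
    by (rule DERIV_inverse) (rule z)
  then have "has_dbar inverse 0 z" by (rule has_dbar_field_derivative)
  then have "has_dbar (rinv r) 0 z"
    by (rule has_dbar_eq_near[where U="- cball 0 r"]) (use z rinv_outside[OF assms(1)] in auto)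
  then show ?thesis using False by (simp add: dbar_rinv_def)
qed

lemma has_wirtinger_wt:
  assumes "r > 0" "cmod z \<noteq> r"
  shows "has_wirtinger (\<lambda>z. of_real (wt r z)) (- rinv r z * of_real (wt r z)) (- cnj (rinv r z) * of_real (wt r z)) z"
proof (cases "cmod z < r")
  case True
  let ?c = "complex_of_real (1 / r\<^sup>2)"
  have 1: "has_wirtinger (\<lambda>z. 1 + (- ?c) * (z * cnj z)) (0 + (0 * (z * cnj z) + (- ?c) * (1 * cnj z + z * 0)))
      (0 + (0 * (z * cnj z) + (- ?c) * (0 * cnj z + z * 1))) z"
    by (intro has_wirtinger_add has_wirtinger_mult has_wirtinger_const has_wirtinger_cnj_ident has_wirtinger_ident)
  have e: "of_real (wt r w) = ?c * exp (1 + (- ?c) * (w * cnj w))" if "cmod w \<le> r" for w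
  proof -
    have "of_real (wt r w) = ?c * exp (of_real (1 - (cmod w)\<^sup>2 / r\<^sup>2))"
      unfolding wt_inside[OF assms(1) that] exp_of_real by simp
    also have "of_real (1 - (cmod w)\<^sup>2 / r\<^sup>2) = 1 + (- ?c) * (w * cnj w)"
      by (simp flip: complex_norm_square)
    finally show ?thesis .
  qed
  have rz: "rinv r z = ?c * cnj z" using True rinv_inside[of z r] by simp
  have "has_wirtinger (\<lambda>z. ?c * exp (1 + (- ?c) * (z * cnj z))) (- rinv r z * of_real (wt r z)) (- cnj (rinv r z) * of_real (wt r z)) z"
    using has_wirtinger_mult[OF has_wirtinger_const[of ?c] has_wirtinger_holomorphic_compose[OF DERIV_exp 1]] True
    by (simp add: e rz mult_ac)
  then show ?thesis
    by (rule has_wirtinger_eq_near[where U="ball 0 r"]) (use True e in auto)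
next
  case False
  then have z: "cmod z > r" "z \<noteq> 0" using assms by auto
  have d: "(inverse has_field_derivative - (inverse z ^ Suc (Suc 0))) (at z)"
    by (rule DERIV_inverse) (rule z)
  have e: "of_real (wt r w) = inverse w * cnj (inverse w)" if "r < cmod w" for w
  proof -
    have "of_real (wt r w) = inverse (complex_of_real ((cmod w)\<^sup>2))"
      using wt_outside[OF assms(1), of w] that by (simp add: inverse_eq_divide)
    also have "complex_of_real ((cmod w)\<^sup>2) = w * cnj w" by (rule complex_norm_square)
    finally show ?thesis by simp
  qed
  have "has_wirtinger (\<lambda>z. inverse z * cnj (inverse z)) (- rinv r z * of_real (wt r z)) (- cnj (rinv r z) * of_real (wt r z)) z"
    using has_wirtinger_mult[OF has_wirtinger_field_derivative[OF d] has_wirtinger_cnj[OF has_wirtinger_field_derivative[OF d]]]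
      e[OF z(1)] rinv_outside[OF assms(1), of z] z by (simp add: mult_ac)
  then show ?thesis
    by (rule has_wirtinger_eq_near[where U="- cball 0 r"]) (use z e in auto)
qed

text \<open>For a positive function \<open>f\<close>, the number \<open>q\<close> is $-\partial \log f$; the conjugate appears because
  $\log f$ is real.\<close>
definition log_wirtinger :: "(complex \<Rightarrow> complex) \<Rightarrow> complex \<Rightarrow> complex \<Rightarrow> bool" where
  "log_wirtinger f q z \<longleftrightarrow> has_wirtinger f (- q * f z) (- cnj q * f z) z"

lemma log_wirtinger_mult:
  "log_wirtinger f p z \<Longrightarrow> log_wirtinger g q z \<Longrightarrow> log_wirtinger (\<lambda>z. f z * g z) (p + q) z"
  unfolding log_wirtinger_def
  using has_wirtinger_mult[of f "- p * f z" "- cnj p * f z" z g "- q * g z" "- cnj q * g z"]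
  by (simp add: algebra_simps)

lemma log_wirtinger_1: "log_wirtinger (\<lambda>_. 1) 0 z"
  by (simp add: log_wirtinger_def has_wirtinger_const)

lemma log_wirtinger_power:
  "log_wirtinger f q z \<Longrightarrow> log_wirtinger (\<lambda>z. f z ^ n) (of_nat n * q) z"
proof (induction n)
  case (Suc n)
  then show ?case using log_wirtinger_mult[of f q z "\<lambda>z. f z ^ n" "of_nat n * q"]
    by (simp add: algebra_simps)
qed (simp add: log_wirtinger_1)

lemma log_wirtinger_prod:
  "(\<And>i. i \<in> I \<Longrightarrow> log_wirtinger (f i) (q i) z) \<Longrightarrow> log_wirtinger (\<lambda>z. \<Prod>i\<in>I. f i z) (\<Sum>i\<in>I. q i) z"
proof (induction I rule: infinite_finite_induct)
  case (insert x F)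
  then show ?case using log_wirtinger_mult[of "f x" "q x" z "\<lambda>z. \<Prod>i\<in>F. f i z" "\<Sum>i\<in>F. q i"] by simp
qed (simp_all add: log_wirtinger_1)

section \<open>A weighted d-bar inequality\<close>

text \<open>The three companions are $\partial f$, $\bar\partial f$ and the mixed second derivative. The last
  two conditions say that both orders of differentiation give the same mixed derivative.\<close>
definition smooth2 :: "(complex \<Rightarrow> complex) \<Rightarrow> (complex \<Rightarrow> complex) \<Rightarrow> (complex \<Rightarrow> complex) \<Rightarrow> (complex \<Rightarrow> complex) \<Rightarrow> bool" where
  "smooth2 f f1 f2 f12 \<longleftrightarrow> tame f \<and> tame f1 \<and> tame f2 \<and> tame f12 \<and>
     (\<forall>z. has_wirtinger f (f1 z) (f2 z) z \<and> has_dbar f1 (f12 z) z \<and> has_dbar (\<lambda>z. cnj (f2 z)) (cnj (f12 z)) z)"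

lemma has_dbar_const: "has_dbar (\<lambda>_. c) 0 z"
  unfolding has_dbar_def using has_wirtinger_const by blast

lemma smooth2_const: "smooth2 (\<lambda>_. c) (\<lambda>_. 0) (\<lambda>_. 0) (\<lambda>_. 0)"
  unfolding smooth2_def by (simp add: tame_const has_wirtinger_const has_dbar_const)

lemma smooth2_ident: "smooth2 (\<lambda>z. z) (\<lambda>_. 1) (\<lambda>_. 0) (\<lambda>_. 0)"
  unfolding smooth2_def by (simp add: tame_const tame_ident has_wirtinger_ident has_dbar_const)

lemma smooth2_cnj: "smooth2 cnj (\<lambda>_. 0) (\<lambda>_. 1) (\<lambda>_. 0)"
  unfolding smooth2_def using tame_cnj[OF tame_ident]
  by (simp add: tame_const has_wirtinger_cnj_ident has_dbar_const)

lemma smooth2_exp_cnj: "smooth2 (\<lambda>z. exp (c * cnj z)) (\<lambda>_. 0) (\<lambda>z. c * exp (c * cnj z)) (\<lambda>_. 0)"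
proof -
  have t: "tame (\<lambda>z. c * exp (c * cnj z))" by (intro tame_mult tame_const tame_exp_cnj)
  have "has_wirtinger (\<lambda>z. exp (c * cnj z)) 0 (c * exp (c * cnj z)) z" for z
    using has_wirtinger_holomorphic_compose[OF DERIV_exp has_wirtinger_mult[OF has_wirtinger_const[of c] has_wirtinger_cnj_ident]]
    by (simp add: mult.commute)
  moreover have "has_dbar (\<lambda>z. cnj (c * exp (c * cnj z))) 0 z" for z
  proof -
    have "((\<lambda>z. cnj c * exp (cnj c * z)) has_field_derivative cnj c * (exp (cnj c * z) * cnj c)) (at z)"
      by (auto intro!: derivative_eq_intros)
    moreover have "(\<lambda>z. cnj (c * exp (c * cnj z))) = (\<lambda>z. cnj c * exp (cnj c * z))"
      by (simp add: exp_cnj)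
    ultimately show ?thesis using has_dbar_field_derivative by simp
  qed
  ultimately show ?thesis
    unfolding smooth2_def using t tame_exp_cnj by (simp add: tame_const has_dbar_const)
qed

lemma has_dbar_wirtinger: "has_wirtinger f a b z \<Longrightarrow> has_dbar f b z"
  unfolding has_dbar_def by blast

lemma smooth2_add:
  assumes "smooth2 f f1 f2 f12" "smooth2 g g1 g2 g12"
  shows "smooth2 (\<lambda>z. f z + g z) (\<lambda>z. f1 z + g1 z) (\<lambda>z. f2 z + g2 z) (\<lambda>z. f12 z + g12 z)"
  using assms unfolding smooth2_def
  by (auto intro: tame_add has_wirtinger_add has_dbar_add)

lemma smooth2_mult:
  assumes f: "smooth2 f f1 f2 f12" and g: "smooth2 g g1 g2 g12"
  shows "smooth2 (\<lambda>z. f z * g z) (\<lambda>z. f1 z * g z + f z * g1 z) (\<lambda>z. f2 z * g z + f z * g2 z)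
    (\<lambda>z. f12 z * g z + f1 z * g2 z + (f2 z * g1 z + f z * g12 z))"
proof -
  have t: "tame f" "tame f1" "tame f2" "tame f12" "tame g" "tame g1" "tame g2" "tame g12"
    using f g by (auto simp: smooth2_def)
  have w: "has_wirtinger f (f1 z) (f2 z) z" "has_wirtinger g (g1 z) (g2 z) z"
    "has_dbar f1 (f12 z) z" "has_dbar g1 (g12 z) z"
    "has_dbar (\<lambda>z. cnj (f2 z)) (cnj (f12 z)) z" "has_dbar (\<lambda>z. cnj (g2 z)) (cnj (g12 z)) z" for z
    using f g by (auto simp: smooth2_def)
  have 1: "has_dbar (\<lambda>z. f1 z * g z + f z * g1 z) (f12 z * g z + f1 z * g2 z + (f2 z * g1 z + f z * g12 z)) z" for z
    by (intro has_dbar_add has_dbar_mult w has_dbar_wirtinger[OF w(1)] has_dbar_wirtinger[OF w(2)])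
  have "has_dbar (\<lambda>z. cnj (f2 z) * cnj (g z) + cnj (f z) * cnj (g2 z))
     (cnj (f12 z) * cnj (g z) + cnj (f2 z) * cnj (g1 z) + (cnj (f1 z) * cnj (g2 z) + cnj (f z) * cnj (g12 z))) z" for z
    by (intro has_dbar_add has_dbar_mult w has_dbar_wirtinger[OF has_wirtinger_cnj[OF w(1)]] has_dbar_wirtinger[OF has_wirtinger_cnj[OF w(2)]])
  then have 2: "has_dbar (\<lambda>z. cnj (f2 z * g z + f z * g2 z)) (cnj (f12 z * g z + f1 z * g2 z + (f2 z * g1 z + f z * g12 z))) z" for z
    by (simp add: algebra_simps)
  show ?thesis
    unfolding smooth2_def using t w 1 2
    by (auto intro!: tame_add tame_mult has_wirtinger_mult)
qed

text \<open>The commutator $[\bar\partial - \alpha z,\ \partial - Q] = \alpha - \bar\partial Q$ together with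
  two integrations by parts gives
  $\|(\bar\partial - \alpha z)S\|^2 = \|(\partial - Q)S\|^2 + \int(\alpha - \bar\partial Q)|S|^2$ in the
  norm with density $\omega e^{-\alpha|z|^2}$, and the first term on the right is dropped. Conjugating by
  $e^{\alpha|z|^2}$ turns $\bar\partial - \alpha z$ into $\bar\partial$, so this is the basic $L^2$ inequality for
  the weight $\alpha|z|^2 + \log\omega$.\<close>
lemma weighted_dbar_inequality:
  fixes \<omega> \<kappa> :: "complex \<Rightarrow> real"
  assumes \<alpha>: "\<alpha> > 0" and S: "smooth2 S S1 S2 S12" and Q: "tame Q" and w: "tame (\<lambda>z. of_real (\<omega> z))"
    and w0: "\<And>z. 0 \<le> \<omega> z" and [measurable]: "\<kappa> \<in> borel_measurable borel"
    and dw: "AE z in lborel. log_wirtinger (\<lambda>z. of_real (\<omega> z)) (Q z) z"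
    and dQ: "AE z in lborel. has_dbar Q (of_real (\<kappa> z)) z"
  shows "integrable lborel (\<lambda>z. (\<alpha> - \<kappa> z) * (cmod (S z))\<^sup>2 * \<omega> z * gauss \<alpha> z)"
    and "integrable lborel (\<lambda>z. (cmod (S2 z - of_real \<alpha> * z * S z))\<^sup>2 * \<omega> z * gauss \<alpha> z)"
    and "(LINT z|lborel. (\<alpha> - \<kappa> z) * (cmod (S z))\<^sup>2 * \<omega> z * gauss \<alpha> z)
      \<le> (LINT z|lborel. (cmod (S2 z - of_real \<alpha> * z * S z))\<^sup>2 * \<omega> z * gauss \<alpha> z)"
proof -
  have t: "tame S" "tame S1" "tame S2" "tame S12" using S by (auto simp: smooth2_def)
  have s: "has_wirtinger S (S1 z) (S2 z) z" "has_dbar S1 (S12 z) z"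
    "has_dbar (\<lambda>z. cnj (S2 z)) (cnj (S12 z)) z" for z
    using S by (auto simp: smooth2_def)
  note [measurable] = t[THEN tame_measurable] tame_measurable[OF Q] tame_measurable[OF w]
  define D where "D = (\<lambda>z. S2 z - of_real \<alpha> * z * S z)"
  define F where "F = (\<lambda>z. S1 z - Q z * S z)"
  have tD: "tame D" unfolding D_def by (intro tame_diff tame_mult tame_const tame_ident t)
  have tF: "tame F" unfolding F_def by (intro tame_diff tame_mult Q t)
  note [measurable] = tame_measurable[OF tD] tame_measurable[OF tF]
  have wm [measurable]: "\<omega> \<in> borel_measurable borel"
  proof -
    have "(\<lambda>z. Re (of_real (\<omega> z))) \<in> borel_measurable borel" by measurable
    then show ?thesis by simp
  qed
  \<comment> \<open>the conjugate of \<open>D * cnj S * \<omega>\<close>, so that its d-bar derivative is the conjugate of the holomorphic derivative that is wanted\<close>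
  define g1 where "g1 = (\<lambda>z. (cnj (D z) * S z) * of_real (\<omega> z))"
  define b1 where "b1 = (\<lambda>z. ((cnj (S12 z) + (- of_real \<alpha>) * (1 * cnj (S z) + 0 * 0 + cnj z * cnj (S1 z))) * S z + cnj (D z) * S2 z) * of_real (\<omega> z)
      + (cnj (D z) * S z) * (- cnj (Q z) * of_real (\<omega> z)))"
  define g2 where "g2 = (\<lambda>z. (F z * cnj (S z)) * of_real (\<omega> z))"
  define b2 where "b2 = (\<lambda>z. ((S12 z + (- 1) * (of_real (\<kappa> z) * S z + Q z * S2 z)) * cnj (S z) + F z * cnj (S1 z)) * of_real (\<omega> z)
      + (F z * cnj (S z)) * (- cnj (Q z) * of_real (\<omega> z)))"
  have [measurable]: "b1 \<in> borel_measurable borel" "b2 \<in> borel_measurable borel"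
    unfolding b1_def b2_def by measurable
  have dbS: "has_dbar S (S2 z) z" "has_dbar (\<lambda>z. cnj (S z)) (cnj (S1 z)) z" for z
    using has_dbar_wirtinger[OF s(1)] has_dbar_wirtinger[OF has_wirtinger_cnj[OF s(1)]] by blast+
  have dbc: "has_dbar cnj 1 z" for z using has_dbar_wirtinger[OF has_wirtinger_cnj_ident] .
  have dbm: "has_dbar (\<lambda>z. c * f z) (c * b) z" if "has_dbar f b z" for c f b z
    using has_dbar_mult[OF has_dbar_const[of c] that] by simp
  have d1: "AE z in lborel. has_dbar g1 (b1 z) z"
    using dw
  proof eventually_elim
    case (elim z)
    have "has_dbar (\<lambda>z. cnj (S2 z) + (- of_real \<alpha>) * (cnj z * cnj (S z)))
        (cnj (S12 z) + (- of_real \<alpha>) * (1 * cnj (S z) + cnj z * cnj (S1 z))) z"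
      by (intro has_dbar_add dbm has_dbar_mult dbc dbS s)
    then have dD: "has_dbar (\<lambda>z. cnj (D z)) (cnj (S12 z) + (- of_real \<alpha>) * (1 * cnj (S z) + 0 * 0 + cnj z * cnj (S1 z))) z"
      by (simp add: D_def mult.assoc)
    show ?case unfolding g1_def b1_def
      by (intro has_dbar_mult[OF has_dbar_mult[OF dD dbS(1)]] has_dbar_wirtinger[OF elim[unfolded log_wirtinger_def]])
  qed
  have d2: "AE z in lborel. has_dbar g2 (b2 z) z"
    using dw dQ
  proof eventually_elim
    case (elim z)
    have "has_dbar (\<lambda>z. S1 z + (- 1) * (Q z * S z)) (S12 z + (- 1) * (of_real (\<kappa> z) * S z + Q z * S2 z)) z"
      by (intro has_dbar_add dbm has_dbar_mult s dbS elim)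
    then have dF: "has_dbar F (S12 z + (- 1) * (of_real (\<kappa> z) * S z + Q z * S2 z)) z"
      by (simp add: F_def)
    show ?case unfolding g2_def b2_def
      by (intro has_dbar_mult[OF has_dbar_mult[OF dF dbS(2)]] has_dbar_wirtinger[OF elim(1)[unfolded log_wirtinger_def]])
  qed
  have tg: "tame g1" "tame g2"
    unfolding g1_def g2_def by (intro tame_mult tame_cnj tD tF w t)+
  note I1 = integral_dbar_eq_0[OF \<alpha> tg(1) \<open>b1 \<in> borel_measurable borel\<close> d1]
  note I2 = integral_dbar_eq_0[OF \<alpha> tg(2) \<open>b2 \<in> borel_measurable borel\<close> d2]
  define X1 where "X1 = (\<lambda>z. (b1 z - of_real \<alpha> * z * g1 z) * of_real (gauss \<alpha> z))"
  define X2 where "X2 = (\<lambda>z. (b2 z - of_real \<alpha> * z * g2 z) * of_real (gauss \<alpha> z))"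
  define nD where "nD = (\<lambda>z. (cmod (D z))\<^sup>2 * \<omega> z * gauss \<alpha> z)"
  define nF where "nF = (\<lambda>z. (cmod (F z))\<^sup>2 * \<omega> z * gauss \<alpha> z)"
  define nS where "nS = (\<lambda>z. (\<alpha> - \<kappa> z) * (cmod (S z))\<^sup>2 * \<omega> z * gauss \<alpha> z)"
  have key: "cnj (X1 z) - X2 z = of_real (nD z - nF z - nS z)" for z
  proof -
    have "complex_of_real (nD z - nF z - nS z)
      = (D z * cnj (D z) - F z * cnj (F z) - (of_real \<alpha> - of_real (\<kappa> z)) * (S z * cnj (S z))) * of_real (\<omega> z) * of_real (gauss \<alpha> z)"
      unfolding nD_def nF_def nS_def of_real_diff of_real_mult complex_norm_square by (simp add: algebra_simps)
    also have "\<dots> = cnj (X1 z) - X2 z"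
      unfolding X1_def X2_def b1_def b2_def g1_def g2_def D_def F_def by (simp add: algebra_simps)
    finally show ?thesis by simp
  qed
  have tame_int: "integrable lborel (\<lambda>z. (cmod (h z))\<^sup>2 * \<omega> z * gauss \<alpha> z)" if "tame h" for h
  proof -
    have "integrable lborel (\<lambda>z. (h z * cnj (h z)) * of_real (\<omega> z) * of_real (gauss \<alpha> z))"
      by (intro tame_integrable_gauss \<alpha> tame_mult tame_cnj that w)
    then have "integrable lborel (\<lambda>z. complex_of_real ((cmod (h z))\<^sup>2 * \<omega> z * gauss \<alpha> z))"
      by (simp flip: complex_norm_square)
    then show ?thesis by (simp only: complex_of_real_integrable_eq)
  qed
  have iD: "integrable lborel nD" unfolding nD_def by (rule tame_int[OF tD])
  have iF: "integrable lborel nF" unfolding nF_def by (rule tame_int[OF tF])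
  have iX: "integrable lborel X1" "integrable lborel X2" using I1(1) I2(1) by (simp_all add: X1_def X2_def)
  have "integrable lborel (\<lambda>z. cnj (X1 z) - X2 z)" using iX by simp
  then have iR: "integrable lborel (\<lambda>z. nD z - nF z - nS z)" unfolding key complex_of_real_integrable_eq .
  have "integrable lborel (\<lambda>z. nD z - nF z - (nD z - nF z - nS z))"
    by (intro Bochner_Integration.integrable_diff iD iF iR)
  then have iS: "integrable lborel nS" by simp
  have "complex_of_real (LINT z|lborel. nD z - nF z - nS z) = (LINT z|lborel. cnj (X1 z) - X2 z)"
    unfolding key by (rule integral_complex_of_real[symmetric])
  also have "\<dots> = cnj (LINT z|lborel. X1 z) - (LINT z|lborel. X2 z)"
    using iX by simp
  also have "\<dots> = 0" using I1(2) I2(2) by (simp add: X1_def X2_def)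
  finally have "(LINT z|lborel. nD z - nF z - nS z) = 0" by simp
  moreover have "(LINT z|lborel. nD z - nF z - nS z) = (LINT z|lborel. nD z) - (LINT z|lborel. nF z) - (LINT z|lborel. nS z)"
    using iD iF iS by simp
  moreover have "(LINT z|lborel. nF z) \<ge> 0" by (intro Bochner_Integration.integral_nonneg) (simp add: nF_def w0)
  ultimately have "(LINT z|lborel. nS z) \<le> (LINT z|lborel. nD z)" by simp
  then show "integrable lborel (\<lambda>z. (\<alpha> - \<kappa> z) * (cmod (S z))\<^sup>2 * \<omega> z * gauss \<alpha> z)"
    and "integrable lborel (\<lambda>z. (cmod (S2 z - of_real \<alpha> * z * S z))\<^sup>2 * \<omega> z * gauss \<alpha> z)"
    and "(LINT z|lborel. (\<alpha> - \<kappa> z) * (cmod (S z))\<^sup>2 * \<omega> z * gauss \<alpha> z)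
      \<le> (LINT z|lborel. (cmod (S2 z - of_real \<alpha> * z * S z))\<^sup>2 * \<omega> z * gauss \<alpha> z)"
    using iD iS by (simp_all add: nD_def nS_def D_def)
qed

definition nice :: "(complex \<Rightarrow> complex) \<Rightarrow> bool" where
  "nice f \<longleftrightarrow> (\<exists>f1 f2 f12. smooth2 f f1 f2 f12)"

lemma nice_const: "nice (\<lambda>_. c)" unfolding nice_def using smooth2_const by blast
lemma nice_ident: "nice (\<lambda>z. z)" unfolding nice_def using smooth2_ident by blast
lemma nice_cnj: "nice cnj" unfolding nice_def using smooth2_cnj by blast
lemma nice_exp_cnj: "nice (\<lambda>z. exp (c * cnj z))" unfolding nice_def using smooth2_exp_cnj by blast

lemma nice_add: assumes "nice f" "nice g" shows "nice (\<lambda>z. f z + g z)"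
proof -
  obtain f1 f2 f12 g1 g2 g12 where "smooth2 f f1 f2 f12" "smooth2 g g1 g2 g12"
    using assms unfolding nice_def by blast
  from smooth2_add[OF this] show ?thesis unfolding nice_def by (intro exI)
qed

lemma nice_mult: assumes "nice f" "nice g" shows "nice (\<lambda>z. f z * g z)"
proof -
  obtain f1 f2 f12 g1 g2 g12 where "smooth2 f f1 f2 f12" "smooth2 g g1 g2 g12"
    using assms unfolding nice_def by blast
  from smooth2_mult[OF this] show ?thesis unfolding nice_def by (intro exI)
qed

lemma nice_sum: "(\<And>i. i \<in> I \<Longrightarrow> nice (f i)) \<Longrightarrow> nice (\<lambda>z. \<Sum>i\<in>I. f i z)"
  by (induction I rule: infinite_finite_induct) (simp_all add: nice_const nice_add)

lemma nice_prod: "(\<And>i. i \<in> I \<Longrightarrow> nice (f i)) \<Longrightarrow> nice (\<lambda>z. \<Prod>i\<in>I. f i z)"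
  by (induction I rule: infinite_finite_induct) (simp_all add: nice_const nice_mult)

lemma nice_power: "nice f \<Longrightarrow> nice (\<lambda>z. f z ^ n)"
  by (induction n) (simp_all add: nice_const nice_mult)

lemma nice_shift: "nice (\<lambda>z. z - l)" "nice (\<lambda>z. cnj z - l)"
  using nice_add[OF nice_ident nice_const[of "- l"]] nice_add[OF nice_cnj nice_const[of "- l"]] by simp_all

lemma nice_tame: "nice f \<Longrightarrow> tame f"
  by (auto simp: nice_def smooth2_def)

section \<open>Potentials of the basis functions\<close>

definition pexp :: "nat \<Rightarrow> complex \<Rightarrow> complex" where
  "pexp n s = (\<Sum>j<n. s ^ j / fact j)"

lemma has_field_derivative_pexp: "(pexp (Suc n) has_field_derivative pexp n s) (at s)"
proof (induction n)
  case 0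
  then show ?case by (simp add: pexp_def[abs_def])
next
  case (Suc n)
  have "((\<lambda>s. s ^ Suc n / fact (Suc n)) has_field_derivative s ^ n / fact n) (at s)"
    using DERIV_cdivide[OF DERIV_power[OF DERIV_ident, of "Suc n"], of "fact (Suc n)" s UNIV]
    by (simp del: of_nat_Suc add: fact_Suc)
  from DERIV_add[OF Suc this] show ?case by (simp add: pexp_def[abs_def])
qed

definition tbasis :: "real \<Rightarrow> complex \<Rightarrow> nat \<Rightarrow> complex \<Rightarrow> complex" where
  "tbasis \<alpha> l k = fock_translation \<alpha> l (fock_basis \<alpha> k)"

text \<open>Dividing by $(z-l)^{k+1}$ and multiplying by the Gaussian gives a $\bar\partial$-primitive of
  the conjugate basis function times the Gaussian. The truncated exponential is the incomplete Gamma
  function that arises when $s^k e^{-\alpha s}$ is integrated over $s \ge |z-l|^2$.\<close>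
definition pot :: "real \<Rightarrow> complex \<Rightarrow> nat \<Rightarrow> complex \<Rightarrow> complex" where
  "pot \<alpha> l k z = - of_real (fact k / \<alpha> ^ Suc k * (sqrt (\<alpha> ^ k) / sqrt (fact k)) * exp (- (\<alpha> / 2 * (cmod l)\<^sup>2)))
      * exp (of_real \<alpha> * l * cnj z) * pexp (Suc k) (of_real \<alpha> * (z - l) * cnj (z - l))"

lemma nice_pot: "nice (pot \<alpha> l k)"
proof -
  have "nice (\<lambda>z. - of_real (fact k / \<alpha> ^ Suc k * (sqrt (\<alpha> ^ k) / sqrt (fact k)) * exp (- (\<alpha> / 2 * (cmod l)\<^sup>2)))
      * exp (of_real \<alpha> * l * cnj z) * (\<Sum>j<Suc k. (of_real \<alpha> * (z - l) * (cnj z - cnj l)) ^ j * (1 / fact j)))"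
    by (intro nice_mult nice_const nice_exp_cnj nice_sum nice_power nice_shift)
  then show ?thesis by (simp add: pot_def[abs_def] pexp_def)
qed

lemma cnj_tbasis:
  "cnj (tbasis \<alpha> l k z) = of_real (sqrt (\<alpha> ^ k) / sqrt (fact k) * exp (- (\<alpha> / 2 * (cmod l)\<^sup>2)))
     * exp (of_real \<alpha> * l * cnj z) * cnj (z - l) ^ k"
proof -
  have "exp (of_real \<alpha> * l * cnj z - of_real (\<alpha> / 2 * (cmod l)\<^sup>2))
    = exp (of_real \<alpha> * l * cnj z) * of_real (exp (- (\<alpha> / 2 * (cmod l)\<^sup>2)))"
    by (simp only: diff_conv_add_uminus exp_add of_real_minus[symmetric] exp_of_real)
  then show ?thesis
    unfolding tbasis_def fock_translation_def fock_basis_def complex_cnj_mult exp_cnj complex_cnj_diff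
    by (simp add: mult_ac)
qed

text \<open>In $\bar\partial - \alpha z$ the truncated exponentials telescope to a single power of
  $|z-l|^2$.\<close>
lemma has_dbar_pot:
  assumes "\<alpha> > 0"
  shows "has_dbar (pot \<alpha> l k) (of_real \<alpha> * z * pot \<alpha> l k z + (z - l) ^ Suc k * cnj (tbasis \<alpha> l k z)) z"
proof -
  define c where "c = complex_of_real (sqrt (\<alpha> ^ k) / sqrt (fact k) * exp (- (\<alpha> / 2 * (cmod l)\<^sup>2)))"
  define K where "K = complex_of_real (- (fact k / \<alpha> ^ Suc k)) * c"
  define e where "e = (\<lambda>z. exp (of_real \<alpha> * l * cnj z))"
  define u where "u = (\<lambda>z. of_real \<alpha> * (z - l) * cnj (z - l))"
  have pot: "pot \<alpha> l k = (\<lambda>z. (K * e z) * pexp (Suc k) (u z))"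
    unfolding pot_def K_def c_def e_def u_def by (simp add: mult_ac)
  have wz: "has_wirtinger (\<lambda>z. of_real \<alpha> * l * cnj z) 0 (of_real \<alpha> * l) z"
    using has_wirtinger_mult[OF has_wirtinger_const[of "of_real \<alpha> * l"] has_wirtinger_cnj_ident] by simp
  have de: "has_dbar (\<lambda>z. K * e z) (K * (of_real \<alpha> * l * e z)) z"
    using has_dbar_mult[OF has_dbar_const[of K] has_dbar_wirtinger[OF has_wirtinger_holomorphic_compose[OF DERIV_exp wz]]]
    by (simp add: e_def mult_ac)
  have wu: "has_wirtinger u (of_real \<alpha> * cnj (z - l)) (of_real \<alpha> * (z - l)) z"
  proof -
    have "has_wirtinger (\<lambda>z. z * cnj z) (1 * cnj (z - l) + (z - l) * 0) (0 * cnj (z - l) + (z - l) * 1) (z - l)"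
      by (rule has_wirtinger_mult[OF has_wirtinger_ident has_wirtinger_cnj_ident])
    from has_wirtinger_mult[OF has_wirtinger_const[of "of_real \<alpha>"] has_wirtinger_translate[OF this]]
    show ?thesis by (simp add: u_def mult.assoc)
  qed
  have du: "has_dbar (\<lambda>z. pexp (Suc k) (u z)) (pexp k (u z) * (of_real \<alpha> * (z - l))) z"
    by (rule has_dbar_wirtinger[OF has_wirtinger_holomorphic_compose[OF has_field_derivative_pexp wu]])
  have p: "pexp (Suc k) (u z) = pexp k (u z) + u z ^ k / fact k" by (simp add: pexp_def)
  have "K * (of_real \<alpha> * l * e z) * pexp (Suc k) (u z) + K * e z * (pexp k (u z) * (of_real \<alpha> * (z - l)))
      = of_real \<alpha> * z * ((K * e z) * pexp (Suc k) (u z)) + (- K * of_real \<alpha> * (u z ^ k / fact k)) * e z * (z - l)"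
    unfolding p by (simp add: algebra_simps add_divide_distrib diff_divide_distrib)
  also have "- K * of_real \<alpha> * (u z ^ k / fact k) = c * (z - l) ^ k * cnj (z - l) ^ k"
  proof -
    have "complex_of_real (fact k / \<alpha> ^ Suc k) * of_real \<alpha> * (of_real \<alpha> ^ k / fact k) = 1"
      using assms by (simp add: field_simps)
    then have "complex_of_real (fact k / \<alpha> ^ Suc k) * of_real \<alpha> * (of_real \<alpha> ^ k / fact k) * x = x" for x by simp
    moreover have "- K * of_real \<alpha> * (u z ^ k / fact k)
      = complex_of_real (fact k / \<alpha> ^ Suc k) * of_real \<alpha> * (of_real \<alpha> ^ k / fact k) * (c * (z - l) ^ k * cnj (z - l) ^ k)"
      unfolding K_def u_def power_mult_distrib of_real_minus by (simp add: mult_ac)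
    ultimately show ?thesis by simp
  qed
  also have "c * (z - l) ^ k * cnj (z - l) ^ k * e z * (z - l) = (z - l) ^ Suc k * cnj (tbasis \<alpha> l k z)"
    unfolding cnj_tbasis c_def[symmetric] e_def by (simp add: mult_ac)
  finally show ?thesis
    using has_dbar_mult[OF de du] unfolding pot by (simp only:)
qed

lemma tame_tbasis: "tame (tbasis \<alpha> l k)"
proof -
  have "tame (\<lambda>z. cnj (cnj (tbasis \<alpha> l k z)))"
    unfolding cnj_tbasis by (intro tame_cnj tame_mult tame_const tame_exp_cnj tame_power tame_shift)
  then show ?thesis by simp
qed

lemma tbasis_in_fock_space: "\<alpha> > 0 \<Longrightarrow> tbasis \<alpha> l k \<in> fock_space \<alpha>"
  unfolding tbasis_def by (intro fock_space_translation fock_basis_in_fock_space)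

lemma has_dbar_holomorphic:
  assumes "f holomorphic_on UNIV" shows "has_dbar f 0 z"
  using holomorphic_derivI[OF assms, of z] by (intro has_dbar_field_derivative[of f "deriv f z"]) auto

section \<open>The lower bound for separated discs\<close>

locale separated_discs =
  fixes \<alpha> C :: real and L :: "complex set" and m :: "complex \<Rightarrow> nat"
    and c :: "complex \<Rightarrow> nat \<Rightarrow> complex"
  assumes \<alpha>: "\<alpha> > 0" and C: "C > 0" and finite_L: "finite L" and m_pos: "\<And>l. l \<in> L \<Longrightarrow> 0 < m l"
    and disjoint: "disjoint_family_on (\<lambda>l. ball l (sqrt (real (m l) / \<alpha>) + C)) L"
begin

definition rad :: "complex \<Rightarrow> real" where "rad l = sqrt (real (m l) / \<alpha>)"

definition piece :: "complex \<Rightarrow> complex \<Rightarrow> complex" where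
  "piece l z = (\<Sum>k<m l. c l k * tbasis \<alpha> l k z)"

definition combination :: "complex \<Rightarrow> complex" where
  "combination z = (\<Sum>l\<in>L. piece l z)"

definition cofactor :: "complex \<Rightarrow> complex \<Rightarrow> complex" where
  "cofactor l z = (\<Prod>l'\<in>L - {l}. (z - l') ^ m l')"

definition annihilator :: "complex \<Rightarrow> complex" where
  "annihilator z = (\<Prod>l\<in>L. (z - l) ^ m l)"

text \<open>This is \<open>annihilator\<close> times the sum of the potentials with their poles; the powers of \<open>z - l\<close>
  cancel, and a globally smooth function remains.\<close>
definition numerator :: "complex \<Rightarrow> complex" where
  "numerator z = (\<Sum>l\<in>L. \<Sum>k<m l. (cnj (c l k) * cofactor l z * (z - l) ^ (m l - Suc k)) * pot \<alpha> l k z)"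

text \<open>The pole at \<open>l\<close> is regularised by \<open>rinv\<close>, which changes the potential only inside the disc of
  radius \<open>rad l\<close>.\<close>
definition piece_pot :: "complex \<Rightarrow> complex \<Rightarrow> complex" where
  "piece_pot l z = (\<Sum>k<m l. (cnj (c l k) * rinv (rad l) (z - l) ^ Suc k) * pot \<alpha> l k z)"

definition potential :: "complex \<Rightarrow> complex" where
  "potential z = (\<Sum>l\<in>L. piece_pot l z)"

text \<open>Outside the discs this is \<open>1 / (cmod (annihilator z))\<^sup>2\<close>, so that \<open>\<omega>\<close> times the squared modulus of
  \<open>numerator\<close> is the squared modulus of the sum of the potentials.\<close>
definition \<omega> :: "complex \<Rightarrow> real" where
  "\<omega> z = (\<Prod>l\<in>L. wt (rad l) (z - l) ^ m l)"

definition \<kappa> :: "complex \<Rightarrow> real" where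
  "\<kappa> z = (\<Sum>l\<in>L. real (m l) * dbar_rinv (rad l) (z - l))"

definition cutoff :: "complex \<Rightarrow> complex \<Rightarrow> real" where
  "cutoff l z = ramp (rad l) C (z - l)"

definition dbar_cutoff :: "complex \<Rightarrow> complex \<Rightarrow> complex" where
  "dbar_cutoff l z = dbar_ramp (rad l) C (z - l)"

definition outside :: "complex set" where
  "outside = {z. \<forall>l\<in>L. rad l \<le> cmod (z - l)}"

lemma rad_pos: "l \<in> L \<Longrightarrow> rad l > 0"
  using m_pos \<alpha> by (simp add: rad_def)

lemma m_rad: "l \<in> L \<Longrightarrow> real (m l) * (1 / (rad l)\<^sup>2) = \<alpha>"
  using m_pos[of l] \<alpha> by (simp add: rad_def)

lemma far_from_others:
  assumes "l \<in> L" "l' \<in> L" "l \<noteq> l'" "cmod (z - l) < rad l + C"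
  shows "rad l' + C \<le> cmod (z - l')"
proof -
  have "z \<in> ball l (rad l + C)" using assms by (simp add: dist_norm norm_minus_commute)
  moreover have "ball l (rad l + C) \<inter> ball l' (rad l' + C) = {}"
    using disjoint assms unfolding disjoint_family_on_def rad_def by blast
  ultimately have "z \<notin> ball l' (rad l' + C)" by blast
  then show ?thesis by (simp add: dist_norm norm_minus_commute)
qed

text \<open>Each disc of radius \<open>rad l\<close> carries the mass \<open>m l\<close> with density exactly \<open>\<alpha>\<close>, which is where the
  radius comes from: inside the discs the curvature of the weight vanishes, outside it is \<open>\<alpha>\<close>.\<close>
lemma kappa_eq: "\<kappa> z = (if z \<in> outside then 0 else \<alpha>)"
proof (cases "z \<in> outside")
  case True
  then show ?thesis unfolding \<kappa>_def
    by (auto simp: outside_def dbar_rinv_def intro!: sum.neutral)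
next
  case False
  then obtain l where l: "l \<in> L" "cmod (z - l) < rad l" by (auto simp: outside_def not_le)
  have "\<kappa> z = (\<Sum>l'\<in>L. if l' = l then \<alpha> else 0)"
    unfolding \<kappa>_def
  proof (intro sum.cong refl)
    fix l' assume l': "l' \<in> L"
    show "real (m l') * dbar_rinv (rad l') (z - l') = (if l' = l then \<alpha> else 0)"
    proof (cases "l' = l")
      case True then show ?thesis using l m_rad[OF l'] by (simp add: dbar_rinv_def)
    next
      case False
      have "rad l' + C \<le> cmod (z - l')" using far_from_others[OF l(1) l'] False l C by auto
      then show ?thesis using False C by (simp add: dbar_rinv_def)
    qed
  qed
  then show ?thesis using l(1) finite_L False by simp
qed

lemma omega_nonneg: "0 \<le> \<omega> z"
  unfolding \<omega>_def by (intro prod_nonneg) (simp add: wt_nonneg)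

lemma annihilator_omega_eq:
  "(cmod (annihilator z))\<^sup>2 * \<omega> z = (\<Prod>l\<in>L. ((cmod (z - l))\<^sup>2 * wt (rad l) (z - l)) ^ m l)"
  unfolding annihilator_def \<omega>_def
  by (simp add: prod_norm[symmetric] norm_power prod_power_distrib prod.distrib[symmetric] power_mult_distrib
      power_mult[symmetric] mult.commute)

lemma annihilator_omega_le: "(cmod (annihilator z))\<^sup>2 * \<omega> z \<le> 1"
  unfolding annihilator_omega_eq
  by (intro prod_le_1) (auto intro!: power_le_one zero_le_power wt_le rad_pos mult_nonneg_nonneg wt_nonneg)

lemma annihilator_omega_outside:
  assumes "z \<in> outside" shows "(cmod (annihilator z))\<^sup>2 * \<omega> z = 1"
  unfolding annihilator_omega_eq
proof (intro prod.neutral ballI)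
  fix l assume l: "l \<in> L"
  then have "rad l \<le> cmod (z - l)" using assms by (simp add: outside_def)
  then show "((cmod (z - l))\<^sup>2 * wt (rad l) (z - l)) ^ m l = 1"
    using wt_outside[OF rad_pos[OF l]] rad_pos[OF l] by auto
qed

lemma annihilator_cofactor: "l \<in> L \<Longrightarrow> annihilator z = (z - l) ^ m l * cofactor l z"
  unfolding annihilator_def cofactor_def using finite_L by (simp add: prod.remove)

lemma nice_numerator: "nice numerator"
  unfolding numerator_def[abs_def] cofactor_def
  by (intro nice_sum nice_mult nice_const nice_prod nice_power nice_shift nice_pot)

lemma has_dbar_numerator:
  "has_dbar numerator (of_real \<alpha> * z * numerator z + annihilator z * cnj (combination z)) z"
proof -
  define r where "r = (\<lambda>l k z. cnj (c l k) * cofactor l z * (z - l) ^ (m l - Suc k))"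
  have "has_dbar (\<lambda>z. r l k z * pot \<alpha> l k z)
     (of_real \<alpha> * z * (r l k z * pot \<alpha> l k z) + annihilator z * cnj (c l k * tbasis \<alpha> l k z)) z"
    if lk: "l \<in> L" "k < m l" for l k
  proof -
    have "r l k holomorphic_on UNIV"
      unfolding r_def cofactor_def by (intro holomorphic_intros)
    from has_dbar_mult[OF has_dbar_holomorphic[OF this] has_dbar_pot[OF \<alpha>]]
    have "has_dbar (\<lambda>z. r l k z * pot \<alpha> l k z)
      (r l k z * (of_real \<alpha> * z * pot \<alpha> l k z + (z - l) ^ Suc k * cnj (tbasis \<alpha> l k z))) z"
      by simp
    also have "r l k z * (of_real \<alpha> * z * pot \<alpha> l k z + (z - l) ^ Suc k * cnj (tbasis \<alpha> l k z))
      = of_real \<alpha> * z * (r l k z * pot \<alpha> l k z)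
        + cnj (c l k) * cofactor l z * ((z - l) ^ (m l - Suc k) * (z - l) ^ Suc k) * cnj (tbasis \<alpha> l k z)"
      unfolding r_def by (simp add: algebra_simps)
    also have "(z - l) ^ (m l - Suc k) * (z - l) ^ Suc k = (z - l) ^ m l"
      using lk by (simp only: power_add[symmetric]) simp
    also have "cnj (c l k) * cofactor l z * (z - l) ^ m l * cnj (tbasis \<alpha> l k z) = annihilator z * cnj (c l k * tbasis \<alpha> l k z)"
      unfolding annihilator_cofactor[OF lk(1)] by (simp add: mult_ac)
    finally show ?thesis .
  qed
  then have "has_dbar (\<lambda>z. \<Sum>l\<in>L. \<Sum>k<m l. r l k z * pot \<alpha> l k z)
     (\<Sum>l\<in>L. \<Sum>k<m l. of_real \<alpha> * z * (r l k z * pot \<alpha> l k z) + annihilator z * cnj (c l k * tbasis \<alpha> l k z)) z"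
    by (intro has_dbar_sum) auto
  moreover have "(\<Sum>l\<in>L. \<Sum>k<m l. of_real \<alpha> * z * (r l k z * pot \<alpha> l k z) + annihilator z * cnj (c l k * tbasis \<alpha> l k z))
    = of_real \<alpha> * z * numerator z + annihilator z * cnj (combination z)"
    unfolding numerator_def combination_def piece_def r_def sum.distrib sum_distrib_left[symmetric] cnj_sum ..
  ultimately show ?thesis by (simp add: numerator_def[abs_def] r_def)
qed

lemma tame_piece: "tame (piece l)"
  unfolding piece_def[abs_def] by (intro tame_sum tame_mult tame_const tame_tbasis)

lemma tame_combination: "tame combination"
  unfolding combination_def[abs_def] by (intro tame_sum tame_piece)

lemma AE_off_circles:
  "AE z in lborel. \<forall>l\<in>L. cmod (z - l) \<noteq> rad l \<and> cmod (z - l) \<noteq> rad l + C"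
proof -
  have "AE z in lborel. \<forall>l\<in>L. cmod (z - l) \<noteq> rad l" "AE z in lborel. \<forall>l\<in>L. cmod (z - l) \<noteq> rad l + C"
    using finite_L by (auto intro!: AE_finite_allI AE_not_on_circle)
  then show ?thesis by eventually_elim auto
qed

lemma kappa_measurable [measurable]: "\<kappa> \<in> borel_measurable borel"
  unfolding \<kappa>_def[abs_def] by measurable

text \<open>The weighted inequality for \<open>numerator\<close>, whose image under $\bar\partial - \alpha z$ is the annihilator
  times the conjugate of \<open>combination\<close>.\<close>
lemma numerator_estimate:
  shows "integrable lborel (\<lambda>z. (\<alpha> - \<kappa> z) * (cmod (numerator z))\<^sup>2 * \<omega> z * gauss \<alpha> z)"
    and "(LINT z|lborel. (\<alpha> - \<kappa> z) * (cmod (numerator z))\<^sup>2 * \<omega> z * gauss \<alpha> z)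
      \<le> (LINT z|lborel. (cmod (combination z))\<^sup>2 * gauss \<alpha> z)"
proof -
  obtain S1 S2 S12 where S: "smooth2 numerator S1 S2 S12" using nice_numerator unfolding nice_def by blast
  then have "has_dbar numerator (S2 z) z" for z
    unfolding smooth2_def using has_dbar_wirtinger by blast
  then have S2: "S2 z - of_real \<alpha> * z * numerator z = annihilator z * cnj (combination z)" for z
    using has_dbar_unique[OF _ has_dbar_numerator] by (metis add_diff_cancel_left')
  define Q where "Q = (\<lambda>z. \<Sum>l\<in>L. of_nat (m l) * rinv (rad l) (z - l))"
  have tQ: "tame Q" unfolding Q_def by (intro tame_sum tame_mult tame_const tame_translate tame_rinv rad_pos)
  have tw: "tame (\<lambda>z. of_real (\<omega> z))" unfolding \<omega>_def of_real_prod of_real_power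
    by (intro tame_prod tame_power tame_translate[of "\<lambda>z. of_real (wt _ z)"] tame_wt rad_pos)
  have dw: "AE z in lborel. log_wirtinger (\<lambda>z. of_real (\<omega> z)) (Q z) z"
    using AE_off_circles
  proof eventually_elim
    case (elim z)
    show ?case unfolding \<omega>_def Q_def of_real_prod of_real_power
    proof (intro log_wirtinger_prod log_wirtinger_power)
      fix l assume l: "l \<in> L"
      show "log_wirtinger (\<lambda>z. of_real (wt (rad l) (z - l))) (rinv (rad l) (z - l)) z"
        unfolding log_wirtinger_def
        by (rule has_wirtinger_translate[where f="\<lambda>z. of_real (wt (rad l) z)"], rule has_wirtinger_wt)
           (use elim l rad_pos in auto)
    qed
  qed
  have dQ: "AE z in lborel. has_dbar Q (of_real (\<kappa> z)) z"
    using AE_off_circles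
  proof eventually_elim
    case (elim z)
    have "has_dbar Q (\<Sum>l\<in>L. 0 * rinv (rad l) (z - l) + of_nat (m l) * of_real (dbar_rinv (rad l) (z - l))) z"
      unfolding Q_def using elim rad_pos
      by (intro has_dbar_sum has_dbar_mult has_dbar_const has_dbar_translate[where f="rinv _"] has_dbar_rinv) auto
    then show ?case by (simp add: \<kappa>_def)
  qed
  note W = weighted_dbar_inequality[OF \<alpha> S tQ tw omega_nonneg kappa_measurable dw dQ]
  show "integrable lborel (\<lambda>z. (\<alpha> - \<kappa> z) * (cmod (numerator z))\<^sup>2 * \<omega> z * gauss \<alpha> z)" by (rule W(1))
  have "(LINT z|lborel. (cmod (S2 z - of_real \<alpha> * z * numerator z))\<^sup>2 * \<omega> z * gauss \<alpha> z)
     \<le> (LINT z|lborel. (cmod (combination z))\<^sup>2 * gauss \<alpha> z)"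
  proof (rule integral_mono[OF W(2) tame_square_integrable[OF \<alpha> tame_combination]])
    fix z
    have "((cmod (annihilator z))\<^sup>2 * \<omega> z) * ((cmod (combination z))\<^sup>2 * gauss \<alpha> z) \<le> 1 * ((cmod (combination z))\<^sup>2 * gauss \<alpha> z)"
      by (intro mult_right_mono annihilator_omega_le) auto
    then show "(cmod (S2 z - of_real \<alpha> * z * numerator z))\<^sup>2 * \<omega> z * gauss \<alpha> z \<le> (cmod (combination z))\<^sup>2 * gauss \<alpha> z"
      unfolding S2 by (simp add: norm_mult power_mult_distrib mult_ac)
  qed
  with W(3) show "(LINT z|lborel. (\<alpha> - \<kappa> z) * (cmod (numerator z))\<^sup>2 * \<omega> z * gauss \<alpha> z)
      \<le> (LINT z|lborel. (cmod (combination z))\<^sup>2 * gauss \<alpha> z)" by linarith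
qed

end

lemma has_dbar_power_0:
  assumes "has_dbar f 0 z" shows "has_dbar (\<lambda>z. f z ^ n) 0 z"
proof (induction n)
  case (Suc n)
  from has_dbar_mult[OF assms this] show ?case by simp
qed (simp add: has_dbar_const)

context separated_discs
begin

lemma tame_piece_pot: "l \<in> L \<Longrightarrow> tame (piece_pot l)"
  unfolding piece_pot_def[abs_def]
  by (intro tame_sum tame_mult tame_const tame_power tame_translate[OF tame_rinv] rad_pos nice_tame nice_pot)

lemma tame_potential: "tame potential"
  unfolding potential_def[abs_def] by (intro tame_sum tame_piece_pot)

lemma has_dbar_piece_pot:
  assumes l: "l \<in> L" and z: "rad l < cmod (z - l)"
  shows "has_dbar (piece_pot l) (of_real \<alpha> * z * piece_pot l z + cnj (piece l z)) z"
proof -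
  have zl: "z - l \<noteq> 0" using z rad_pos[OF l] by auto
  have ri: "rinv (rad l) (z - l) = inverse (z - l)" using rinv_outside[OF rad_pos[OF l]] z by simp
  have d0: "has_dbar (\<lambda>z. rinv (rad l) (z - l)) 0 z"
    using has_dbar_translate[OF has_dbar_rinv[OF rad_pos[OF l], of "z - l"]] z by (simp add: dbar_rinv_def)
  have "has_dbar (\<lambda>z. (cnj (c l k) * rinv (rad l) (z - l) ^ Suc k) * pot \<alpha> l k z)
     (of_real \<alpha> * z * (cnj (c l k) * rinv (rad l) (z - l) ^ Suc k * pot \<alpha> l k z) + cnj (c l k * tbasis \<alpha> l k z)) z" for k
  proof -
    have "has_dbar (\<lambda>z. (cnj (c l k) * rinv (rad l) (z - l) ^ Suc k) * pot \<alpha> l k z)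
      ((0 * rinv (rad l) (z - l) ^ Suc k + cnj (c l k) * 0) * pot \<alpha> l k z
       + (cnj (c l k) * rinv (rad l) (z - l) ^ Suc k) * (of_real \<alpha> * z * pot \<alpha> l k z + (z - l) ^ Suc k * cnj (tbasis \<alpha> l k z))) z"
      by (intro has_dbar_mult has_dbar_const has_dbar_power_0[OF d0] has_dbar_pot \<alpha>)
    moreover have "(rinv (rad l) (z - l)) ^ Suc k * (z - l) ^ Suc k = 1"
      unfolding ri power_mult_distrib[symmetric] using zl by simp
    then have h: "(cnj (c l k) * rinv (rad l) (z - l) ^ Suc k) * ((z - l) ^ Suc k * cnj (tbasis \<alpha> l k z)) = cnj (c l k * tbasis \<alpha> l k z)"
      by (metis (no_types, lifting) complex_cnj_mult mult.assoc mult.left_neutral)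
    moreover have "x * (a * p + w) = a * (x * p) + x * w" for x a p w :: complex
      by (simp add: algebra_simps)
    ultimately show ?thesis by (simp only: h mult_zero_left mult_zero_right add_0_left)
  qed
  then have "has_dbar (\<lambda>z. \<Sum>k<m l. (cnj (c l k) * rinv (rad l) (z - l) ^ Suc k) * pot \<alpha> l k z)
     (\<Sum>k<m l. of_real \<alpha> * z * (cnj (c l k) * rinv (rad l) (z - l) ^ Suc k * pot \<alpha> l k z) + cnj (c l k * tbasis \<alpha> l k z)) z"
    by (intro has_dbar_sum)
  then show ?thesis
    unfolding piece_pot_def[abs_def] piece_def sum.distrib sum_distrib_left cnj_sum by simp
qed

lemma cutoff_bounds: "0 \<le> cutoff l z" "cutoff l z \<le> 1"
  by (simp_all add: cutoff_def ramp_nonneg ramp_le_1)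

lemma tame_cutoff: "tame (\<lambda>z. of_real (cutoff l z))"
  unfolding cutoff_def by (rule tame_translate[of "\<lambda>z. of_real (ramp (rad l) C z)", OF tame_ramp[OF C]])

lemma dbar_cutoff_measurable [measurable]: "dbar_cutoff l \<in> borel_measurable borel"
  unfolding dbar_cutoff_def[abs_def] by measurable

text \<open>Integrate $\bar\partial$ of $(\chi_l - \delta_{ll'})\, p_l \Psi_{l'}$ against the Gaussian. Subtracting
  $\delta_{ll'}$ makes the first factor vanish near the pole in either case: for $l = l'$ because
  $\chi_l = 1$ on the disc, for $l \neq l'$ because $\chi_l$ vanishes on the disc about $l'$. So the
  product extends by zero across the pole.\<close>
lemma pairing:
  assumes l: "l \<in> L" and l': "l' \<in> L"
  defines "Y \<equiv> \<lambda>z. (dbar_cutoff l z * piece l z * piece_pot l' z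
      + (of_real (cutoff l z) - of_bool (l = l')) * (piece l z * cnj (piece l' z))) * of_real (gauss \<alpha> z)"
  shows "integrable lborel Y" and "(LINT z|lborel. Y z) = 0"
proof -
  define \<delta> :: complex where "\<delta> = of_bool (l = l')"
  define g where "g = (\<lambda>z. ((of_real (cutoff l z) + (- \<delta>)) * piece l z) * piece_pot l' z)"
  define b where "b = (\<lambda>z. ((dbar_cutoff l z + 0) * piece l z + (of_real (cutoff l z) + (- \<delta>)) * 0) * piece_pot l' z
    + ((of_real (cutoff l z) + (- \<delta>)) * piece l z) * (of_real \<alpha> * z * piece_pot l' z + cnj (piece l' z)))"
  note [measurable] = tame_measurable[OF tame_piece] tame_measurable[OF tame_piece_pot[OF l']]
    tame_measurable[OF tame_cutoff]
  have bm: "b \<in> borel_measurable borel" unfolding b_def by measurable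
  have tg: "tame g" unfolding g_def
    by (intro tame_mult tame_add tame_const tame_cutoff tame_piece tame_piece_pot l')
  have hp: "piece l holomorphic_on UNIV"
  proof -
    have "piece l \<in> fock_space \<alpha>" unfolding piece_def[abs_def]
      by (intro fock_space_sum fock_space_cmult tbasis_in_fock_space \<alpha>)
    then show ?thesis by (simp add: fock_space_iff)
  qed
  have "AE z in lborel. has_dbar g (b z) z"
    using AE_off_circles
  proof eventually_elim
    case (elim z)
    show ?case
    proof (cases "rad l' < cmod (z - l')")
      case True
      have dc: "has_dbar (\<lambda>z. of_real (cutoff l z)) (dbar_cutoff l z) z"
        unfolding cutoff_def dbar_cutoff_def
        by (rule has_dbar_translate[where f="\<lambda>z. of_real (ramp (rad l) C z)"], rule has_dbar_ramp)
           (use C rad_pos[OF l] elim l in auto)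
      show ?thesis unfolding g_def b_def
        by (intro has_dbar_mult has_dbar_add has_dbar_const dc has_dbar_holomorphic[OF hp] has_dbar_piece_pot l' True)
    next
      case False
      then have near: "cmod (z - l') < rad l'" using elim l' by (metis linorder_neqE_linordered_idom)
      obtain U where U: "open U" "z \<in> U" "\<And>w. w \<in> U \<Longrightarrow> of_real (cutoff l w) = \<delta>" and dz: "dbar_cutoff l z = 0"
      proof (cases "l = l'")
        case True
        show ?thesis
        proof (rule that)
          show "open (ball l (rad l))" "z \<in> ball l (rad l)"
            using near True by (auto simp: dist_norm norm_minus_commute)
          show "of_real (cutoff l w) = \<delta>" if "w \<in> ball l (rad l)" for w
            using that True ramp_eq_1[OF C, of "w - l" "rad l"]
            by (simp add: cutoff_def \<delta>_def dist_norm norm_minus_commute)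
          show "dbar_cutoff l z = 0" using near True by (simp add: dbar_cutoff_def dbar_ramp_eq_0)
        qed
      next
        case ne: False
        have "rad l + C \<le> cmod (z - l)" using far_from_others[OF l' l] ne near C by auto
        then have far: "rad l + C < cmod (z - l)" using elim l by (metis order_le_less)
        show ?thesis
        proof (rule that)
          show "open (- cball l (rad l + C))" "z \<in> - cball l (rad l + C)"
            using far by (auto simp: dist_norm norm_minus_commute)
          show "of_real (cutoff l w) = \<delta>" if "w \<in> - cball l (rad l + C)" for w
            using that ne ramp_eq_0[OF C, of "rad l" "w - l"]
            by (simp add: cutoff_def \<delta>_def dist_norm norm_minus_commute)
          show "dbar_cutoff l z = 0" using far by (simp add: dbar_cutoff_def dbar_ramp_eq_0)
        qed
      qed
      have "has_dbar g 0 z"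
        by (rule has_dbar_eq_near[OF has_dbar_const[of 0] U(1,2)]) (simp add: g_def U(3))
      moreover have "b z = 0" using U(2,3) dz by (simp add: b_def)
      ultimately show ?thesis by simp
    qed
  qed
  note I = integral_dbar_eq_0[OF \<alpha> tg bm this]
  have "(b z - of_real \<alpha> * z * g z) * of_real (gauss \<alpha> z) = Y z" for z
    unfolding Y_def b_def g_def \<delta>_def[symmetric] by (simp add: algebra_simps)
  then show "integrable lborel Y" and "(LINT z|lborel. Y z) = 0" using I by simp_all
qed

lemma potential_outside:
  assumes z: "z \<in> outside"
  shows "annihilator z * potential z = numerator z"
proof -
  have tm: "annihilator z * (cnj (c l k) * rinv (rad l) (z - l) ^ Suc k * pot \<alpha> l k z)
      = cnj (c l k) * cofactor l z * (z - l) ^ (m l - Suc k) * pot \<alpha> l k z" if l: "l \<in> L" and k: "k < m l" for l k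
  proof -
    have r: "rad l \<le> cmod (z - l)" using z l by (simp add: outside_def)
    then have nz: "z - l \<noteq> 0" using rad_pos[OF l] by auto
    have "(z - l) ^ m l = (z - l) ^ (m l - Suc k) * (z - l) ^ Suc k"
      using k by (simp only: power_add[symmetric]) simp
    moreover have "(z - l) ^ Suc k * rinv (rad l) (z - l) ^ Suc k = 1"
      unfolding rinv_outside[OF rad_pos[OF l] r] power_mult_distrib[symmetric] using nz by simp
    ultimately have h: "(z - l) ^ (m l - Suc k) = (z - l) ^ m l * rinv (rad l) (z - l) ^ Suc k"
      by (simp only: mult.assoc mult_1_right)
    show ?thesis unfolding annihilator_cofactor[OF l] h by (simp only: mult_ac)
  qed
  show ?thesis
    unfolding potential_def piece_pot_def numerator_def sum_distrib_left
    by (intro sum.cong refl tm) auto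
qed

text \<open>By separation, each point \<open>z\<close> lies in at most one of the enlarged discs.\<close>
lemma sum_at_most_one:
  fixes h :: "complex \<Rightarrow> real"
  assumes "\<And>l. l \<in> L \<Longrightarrow> rad l + C \<le> cmod (z - l) \<Longrightarrow> h l = 0"
    and "\<And>l. l \<in> L \<Longrightarrow> h l \<le> B" and "0 \<le> B"
  shows "(\<Sum>l\<in>L. h l) \<le> B"
proof (cases "\<exists>l\<in>L. cmod (z - l) < rad l + C")
  case True
  then obtain l where l: "l \<in> L" "cmod (z - l) < rad l + C" by blast
  have "(\<Sum>l'\<in>L. h l') = (\<Sum>l'\<in>L. if l' = l then h l else 0)"
    using assms(1) far_from_others[OF l(1) _ _ l(2)] by (intro sum.cong) auto
  also have "\<dots> = h l" using finite_L l(1) by simp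
  finally show ?thesis using assms(2)[OF l(1)] by simp
next
  case False
  then have "(\<Sum>l\<in>L. h l) = 0" using assms(1) by (intro sum.neutral) (auto simp: not_less)
  then show ?thesis using assms(3) by simp
qed

text \<open>What is left after half of the weighted \<open>(cmod (piece l z))\<^sup>2\<close> is absorbed in the pairing identity.\<close>
definition remainder :: "complex \<Rightarrow> complex \<Rightarrow> real" where
  "remainder l z = (cmod (dbar_cutoff l z))\<^sup>2 * (cmod (potential z))\<^sup>2 + (cutoff l z)\<^sup>2 * (cmod (combination z))\<^sup>2"

lemma cmod_dbar_cutoff: "(cmod (dbar_cutoff l z))\<^sup>2 \<le> 1 / (4 * C\<^sup>2)"
proof -
  have "(cmod (dbar_cutoff l z))\<^sup>2 \<le> (1 / (2 * C))\<^sup>2"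
    unfolding dbar_cutoff_def by (intro power_mono cmod_dbar_ramp C) simp
  then show ?thesis by (simp add: power_divide power_mult_distrib)
qed

lemma integrable_remainder: "integrable lborel (\<lambda>z. remainder l z * gauss \<alpha> z)"
proof (rule Bochner_Integration.integrable_bound)
  note [measurable] = tame_measurable[OF tame_combination] tame_measurable[OF tame_potential]
  have [measurable]: "cutoff l \<in> borel_measurable borel"
    unfolding cutoff_def[abs_def] ramp_def[abs_def] by measurable
  show "integrable lborel (\<lambda>z. 1 / (4 * C\<^sup>2) * ((cmod (potential z))\<^sup>2 * gauss \<alpha> z) + (cmod (combination z))\<^sup>2 * gauss \<alpha> z)"
    by (intro Bochner_Integration.integrable_add integrable_mult_right tame_square_integrable \<alpha> tame_combination tame_potential)
  show "(\<lambda>z. remainder l z * gauss \<alpha> z) \<in> borel_measurable lborel"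
    unfolding remainder_def by measurable
  show "AE z in lborel. norm (remainder l z * gauss \<alpha> z)
      \<le> norm (1 / (4 * C\<^sup>2) * ((cmod (potential z))\<^sup>2 * gauss \<alpha> z) + (cmod (combination z))\<^sup>2 * gauss \<alpha> z)"
  proof (rule AE_I2)
    fix z
    have "(cutoff l z)\<^sup>2 \<le> 1" using cutoff_bounds[of l z] by (simp add: power_le_one)
    then have "remainder l z \<le> 1 / (4 * C\<^sup>2) * (cmod (potential z))\<^sup>2 + 1 * (cmod (combination z))\<^sup>2"
      unfolding remainder_def by (intro add_mono mult_right_mono cmod_dbar_cutoff) auto
    then have "remainder l z * gauss \<alpha> z \<le> (1 / (4 * C\<^sup>2) * (cmod (potential z))\<^sup>2 + 1 * (cmod (combination z))\<^sup>2) * gauss \<alpha> z"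
      by (rule mult_right_mono) simp
    moreover have "0 \<le> remainder l z * gauss \<alpha> z" by (simp add: remainder_def)
    ultimately show "norm (remainder l z * gauss \<alpha> z)
      \<le> norm (1 / (4 * C\<^sup>2) * ((cmod (potential z))\<^sup>2 * gauss \<alpha> z) + (cmod (combination z))\<^sup>2 * gauss \<alpha> z)"
      by (simp add: algebra_simps)
  qed
qed

text \<open>Summing \<open>pairing\<close> over all \<open>l'\<close> expresses the norm of the piece through \<open>combination\<close> and
  \<open>potential\<close>. Each of the two products is split by $xy \le x^2/4 + y^2$, so that half of the norm of the
  piece can be moved to the left.\<close>
lemma piece_le_remainder:
  assumes l: "l \<in> L"
  shows "(LINT z|lborel. (cmod (piece l z))\<^sup>2 * gauss \<alpha> z) \<le> 2 * (LINT z|lborel. remainder l z * gauss \<alpha> z)"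
proof -
  define Y where "Y = (\<lambda>l' z. (dbar_cutoff l z * piece l z * piece_pot l' z
      + (of_real (cutoff l z) - of_bool (l = l')) * (piece l z * cnj (piece l' z))) * complex_of_real (gauss \<alpha> z))"
  have iY: "integrable lborel (Y l')" "(LINT z|lborel. Y l' z) = 0" if "l' \<in> L" for l'
    using pairing[OF l that] by (simp_all add: Y_def)
  define Z where "Z = (\<lambda>z. \<Sum>l'\<in>L. Y l' z)"
  have iZ: "integrable lborel Z" "(LINT z|lborel. Z z) = 0"
    unfolding Z_def using iY by (simp_all add: Bochner_Integration.integral_sum)
  have Z: "Z z = (dbar_cutoff l z * piece l z * potential z + of_real (cutoff l z) * (piece l z * cnj (combination z))
      - of_real ((cmod (piece l z))\<^sup>2)) * of_real (gauss \<alpha> z)" for z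
  proof -
    have "(\<Sum>l'\<in>L. of_bool (l = l') * (piece l z * cnj (piece l' z))) = (\<Sum>l'\<in>L. if l' = l then piece l z * cnj (piece l z) else 0)"
      by (intro sum.cong) auto
    also have "\<dots> = of_real ((cmod (piece l z))\<^sup>2)"
      using l finite_L by (simp add: complex_norm_square del: of_real_power)
    finally have d: "(\<Sum>l'\<in>L. of_bool (l = l') * (piece l z * cnj (piece l' z))) = of_real ((cmod (piece l z))\<^sup>2)" .
    have "Z z = (\<Sum>l'\<in>L. dbar_cutoff l z * piece l z * piece_pot l' z + of_real (cutoff l z) * (piece l z * cnj (piece l' z))
        - of_bool (l = l') * (piece l z * cnj (piece l' z))) * of_real (gauss \<alpha> z)"
      unfolding Z_def Y_def sum_distrib_right by (intro sum.cong) (simp_all add: algebra_simps)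
    also have "\<dots> = (dbar_cutoff l z * piece l z * potential z + of_real (cutoff l z) * (piece l z * cnj (combination z))
      - of_real ((cmod (piece l z))\<^sup>2)) * of_real (gauss \<alpha> z)"
      unfolding sum_subtractf sum.distrib d potential_def combination_def cnj_sum sum_distrib_left[symmetric] ..
    finally show ?thesis .
  qed
  define N where "N = (LINT z|lborel. (cmod (piece l z))\<^sup>2 * gauss \<alpha> z)"
  have iN: "integrable lborel (\<lambda>z. (cmod (piece l z))\<^sup>2 * gauss \<alpha> z)"
    by (rule tame_square_integrable[OF \<alpha> tame_piece])
  have pt: "(cmod (piece l z))\<^sup>2 * gauss \<alpha> z
      \<le> 1 / 2 * ((cmod (piece l z))\<^sup>2 * gauss \<alpha> z) + remainder l z * gauss \<alpha> z - Re (Z z)" for z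
  proof -
    let ?p = "cmod (piece l z)"
    let ?w = "dbar_cutoff l z * piece l z * potential z + of_real (cutoff l z) * (piece l z * cnj (combination z))"
    have am: "x * y \<le> x\<^sup>2 / 4 + y\<^sup>2" for x y :: real
    proof -
      have "0 \<le> (x / 2 - y)\<^sup>2" by simp
      then show ?thesis by (simp add: power2_diff power_divide)
    qed
    have "Re ?w \<le> cmod ?w" by (rule complex_Re_le_cmod)
    also have "\<dots> \<le> cmod (dbar_cutoff l z * piece l z * potential z) + cmod (of_real (cutoff l z) * (piece l z * cnj (combination z)))"
      by (rule norm_triangle_ineq)
    also have "\<dots> = ?p * (cmod (dbar_cutoff l z) * cmod (potential z)) + ?p * (cutoff l z * cmod (combination z))"
      using cutoff_bounds(1)[of l z] by (simp add: norm_mult)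
    also have "\<dots> \<le> (?p\<^sup>2 / 4 + (cmod (dbar_cutoff l z) * cmod (potential z))\<^sup>2) + (?p\<^sup>2 / 4 + (cutoff l z * cmod (combination z))\<^sup>2)"
      by (intro add_mono am)
    also have "\<dots> = 1 / 2 * ?p\<^sup>2 + remainder l z" by (simp add: remainder_def power_mult_distrib)
    finally have "Re ?w \<le> 1 / 2 * ?p\<^sup>2 + remainder l z" .
    then have "Re ?w * gauss \<alpha> z \<le> (1 / 2 * ?p\<^sup>2 + remainder l z) * gauss \<alpha> z" by (rule mult_right_mono) simp
    moreover have "p * g \<le> 1 / 2 * (p * g) + r * g - (a * g - p * g)" if "a * g \<le> (1 / 2 * p + r) * g" for p g r a :: real
      using that by (simp add: algebra_simps)
    moreover have "Re (Z z) = Re ?w * gauss \<alpha> z - ?p\<^sup>2 * gauss \<alpha> z"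
      unfolding Z by (simp only: Re_complex_of_real times_complex.sel minus_complex.sel Im_complex_of_real mult_zero_right diff_zero left_diff_distrib)
    ultimately show ?thesis by (simp only:)
  qed
  have iRe: "integrable lborel (\<lambda>z. Re (Z z))" "(LINT z|lborel. Re (Z z)) = 0"
    using iZ by (simp_all add: integral_Re)
  have "N \<le> (LINT z|lborel. 1 / 2 * ((cmod (piece l z))\<^sup>2 * gauss \<alpha> z) + remainder l z * gauss \<alpha> z - Re (Z z))"
    unfolding N_def
    by (intro integral_mono pt iN Bochner_Integration.integrable_add Bochner_Integration.integrable_diff
        integrable_mult_right integrable_remainder iRe(1))
  also have "\<dots> = 1 / 2 * N + (LINT z|lborel. remainder l z * gauss \<alpha> z) - 0"
    unfolding N_def iRe(2)[symmetric]
    using iN integrable_remainder[of l] iRe(1) by simp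
  finally show ?thesis unfolding N_def by simp
qed

text \<open>The derivative of a cutoff lives in an annulus that meets none of the discs, and there the sum of the
  potentials is controlled by \<open>numerator\<close> with the full curvature \<open>\<alpha>\<close>.\<close>
lemma sum_remainder_le:
  "(\<Sum>l\<in>L. remainder l z) \<le> 1 / (4 * \<alpha> * C\<^sup>2) * ((\<alpha> - \<kappa> z) * (cmod (numerator z))\<^sup>2 * \<omega> z) + (cmod (combination z))\<^sup>2"
proof -
  let ?B = "1 / (4 * \<alpha> * C\<^sup>2) * ((\<alpha> - \<kappa> z) * (cmod (numerator z))\<^sup>2 * \<omega> z)"
  have B0: "0 \<le> ?B" using kappa_eq[of z] \<alpha> omega_nonneg by simp
  have "(\<Sum>l\<in>L. (cmod (dbar_cutoff l z))\<^sup>2 * (cmod (potential z))\<^sup>2) \<le> ?B"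
  proof (rule sum_at_most_one[where z=z, OF _ _ B0])
    fix l assume l: "l \<in> L"
    show "(cmod (dbar_cutoff l z))\<^sup>2 * (cmod (potential z))\<^sup>2 = 0" if "rad l + C \<le> cmod (z - l)"
      using that by (simp add: dbar_cutoff_def dbar_ramp_eq_0)
    show "(cmod (dbar_cutoff l z))\<^sup>2 * (cmod (potential z))\<^sup>2 \<le> ?B"
    proof (cases "dbar_cutoff l z = 0")
      case True then show ?thesis using B0 by simp
    next
      case False
      then have an: "rad l < cmod (z - l)" "cmod (z - l) < rad l + C"
        by (auto simp: dbar_cutoff_def dbar_ramp_def split: if_splits)
      have out: "z \<in> outside"
        unfolding outside_def
      proof (intro CollectI ballI)
        fix l' assume l': "l' \<in> L"
        show "rad l' \<le> cmod (z - l')"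
          using far_from_others[OF l l' _ an(2)] an(1) C by (cases "l = l'") auto
      qed
      have "(cmod (potential z))\<^sup>2 = ((cmod (annihilator z))\<^sup>2 * \<omega> z) * (cmod (potential z))\<^sup>2"
        unfolding annihilator_omega_outside[OF out] by simp
      also have "\<dots> = (cmod (annihilator z * potential z))\<^sup>2 * \<omega> z"
        by (simp add: norm_mult power_mult_distrib)
      finally have tp: "(cmod (potential z))\<^sup>2 = (cmod (numerator z))\<^sup>2 * \<omega> z"
        unfolding potential_outside[OF out] .
      have "(cmod (dbar_cutoff l z))\<^sup>2 * (cmod (potential z))\<^sup>2 \<le> 1 / (4 * C\<^sup>2) * (cmod (potential z))\<^sup>2"
        by (intro mult_right_mono cmod_dbar_cutoff) simp
      also have "\<dots> = ?B" unfolding tp using out kappa_eq[of z] \<alpha> by simp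
      finally show ?thesis .
    qed
  qed
  moreover have "(\<Sum>l\<in>L. (cutoff l z)\<^sup>2 * (cmod (combination z))\<^sup>2) \<le> (cmod (combination z))\<^sup>2"
  proof (rule sum_at_most_one[where z=z])
    fix l assume "l \<in> L"
    show "(cutoff l z)\<^sup>2 * (cmod (combination z))\<^sup>2 = 0" if "rad l + C \<le> cmod (z - l)"
      using that ramp_eq_0[OF C] by (simp add: cutoff_def)
    show "(cutoff l z)\<^sup>2 * (cmod (combination z))\<^sup>2 \<le> (cmod (combination z))\<^sup>2"
      using cutoff_bounds[of l z] by (intro mult_left_le_one_le) (auto simp: power_le_one)
  qed simp
  ultimately show ?thesis unfolding remainder_def sum.distrib by linarith
qed

lemma piece_normsq: "fock_normsq \<alpha> (piece l) = (\<Sum>k<m l. (cmod (c l k))\<^sup>2)"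
proof -
  have e: "tbasis \<alpha> l k \<in> fock_space \<alpha>" for k by (rule tbasis_in_fock_space[OF \<alpha>])
  have pd: "piece l = (\<lambda>z. \<Sum>k<m l. c l k * tbasis \<alpha> l k z)" by (simp add: piece_def fun_eq_iff)
  have p: "piece l \<in> fock_space \<alpha>"
    unfolding pd by (intro fock_space_sum fock_space_cmult e)
  have b: "fock_inner \<alpha> (piece l) (tbasis \<alpha> l j) = c l j" if j: "j < m l" for j
  proof -
    have "fock_inner \<alpha> (piece l) (tbasis \<alpha> l j) = (\<Sum>k<m l. c l k * fock_inner \<alpha> (tbasis \<alpha> l k) (tbasis \<alpha> l j))"
      unfolding pd by (rule fock_inner_sum_left) (rule e)+
    also have "\<dots> = (\<Sum>k<m l. if k = j then c l k else 0)"
      by (intro sum.cong) (simp_all add: tbasis_def fock_translation_basis_orthonormal[OF \<alpha>])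
    finally show ?thesis using j by simp
  qed
  have "complex_of_real (fock_normsq \<alpha> (piece l)) = fock_inner \<alpha> (piece l) (piece l)"
    by (rule fock_inner_self[symmetric])
  also have "\<dots> = fock_inner \<alpha> (piece l) (\<lambda>z. \<Sum>k<m l. c l k * tbasis \<alpha> l k z)"
    by (subst (2) pd) (rule refl)
  also have "\<dots> = (\<Sum>k<m l. cnj (c l k) * fock_inner \<alpha> (piece l) (tbasis \<alpha> l k))"
    by (rule fock_inner_sum_right) (rule e p)+
  also have "\<dots> = (\<Sum>k<m l. complex_of_real ((cmod (c l k))\<^sup>2))"
    by (intro sum.cong refl) (simp add: b complex_norm_square mult.commute del: of_real_power)
  also have "\<dots> = of_real (\<Sum>k<m l. (cmod (c l k))\<^sup>2)" by simp
  finally show ?thesis unfolding of_real_eq_iff .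
qed

theorem riesz_lower_bound:
  "(\<Sum>l\<in>L. \<Sum>k<m l. (cmod (c l k))\<^sup>2) \<le> (2 + 1 / (2 * \<alpha> * C\<^sup>2)) * fock_normsq \<alpha> combination"
proof -
  let ?K = "1 / (4 * \<alpha> * C\<^sup>2)"
  let ?f = "LINT z|lborel. (cmod (combination z))\<^sup>2 * gauss \<alpha> z"
  note nint = numerator_estimate
  have it: "integrable lborel (\<lambda>z. (cmod (combination z))\<^sup>2 * gauss \<alpha> z)"
    by (rule tame_square_integrable[OF \<alpha> tame_combination])
  have "(\<Sum>l\<in>L. (LINT z|lborel. remainder l z * gauss \<alpha> z)) = (LINT z|lborel. (\<Sum>l\<in>L. remainder l z * gauss \<alpha> z))"
    by (rule Bochner_Integration.integral_sum[symmetric]) (rule integrable_remainder)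
  also have "\<dots> \<le> (LINT z|lborel. ?K * ((\<alpha> - \<kappa> z) * (cmod (numerator z))\<^sup>2 * \<omega> z * gauss \<alpha> z) + (cmod (combination z))\<^sup>2 * gauss \<alpha> z)"
  proof (rule integral_mono)
    show "integrable lborel (\<lambda>z. \<Sum>l\<in>L. remainder l z * gauss \<alpha> z)"
      by (intro Bochner_Integration.integrable_sum integrable_remainder)
    show "integrable lborel (\<lambda>z. ?K * ((\<alpha> - \<kappa> z) * (cmod (numerator z))\<^sup>2 * \<omega> z * gauss \<alpha> z) + (cmod (combination z))\<^sup>2 * gauss \<alpha> z)"
      by (intro Bochner_Integration.integrable_add integrable_mult_right nint(1) it)
    fix z
    have "(\<Sum>l\<in>L. remainder l z) * gauss \<alpha> z
      \<le> (?K * ((\<alpha> - \<kappa> z) * (cmod (numerator z))\<^sup>2 * \<omega> z) + (cmod (combination z))\<^sup>2) * gauss \<alpha> z"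
      by (rule mult_right_mono[OF sum_remainder_le]) simp
    then show "(\<Sum>l\<in>L. remainder l z * gauss \<alpha> z)
      \<le> ?K * ((\<alpha> - \<kappa> z) * (cmod (numerator z))\<^sup>2 * \<omega> z * gauss \<alpha> z) + (cmod (combination z))\<^sup>2 * gauss \<alpha> z"
      unfolding sum_distrib_right[symmetric] by (simp add: distrib_right mult.assoc)
  qed
  also have "\<dots> = ?K * (LINT z|lborel. (\<alpha> - \<kappa> z) * (cmod (numerator z))\<^sup>2 * \<omega> z * gauss \<alpha> z) + ?f"
    using nint(1) it by simp
  also have "\<dots> \<le> ?K * ?f + ?f"
    using nint(2) \<alpha> by (intro add_right_mono mult_left_mono) auto
  finally have rem: "(\<Sum>l\<in>L. (LINT z|lborel. remainder l z * gauss \<alpha> z)) \<le> ?K * ?f + ?f" .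
  have "(\<Sum>l\<in>L. \<Sum>k<m l. (cmod (c l k))\<^sup>2) = (\<Sum>l\<in>L. \<alpha> / pi * (LINT z|lborel. (cmod (piece l z))\<^sup>2 * gauss \<alpha> z))"
    by (intro sum.cong) (simp_all add: piece_normsq[symmetric] fock_normsq_def)
  also have "\<dots> \<le> (\<Sum>l\<in>L. \<alpha> / pi * (2 * (LINT z|lborel. remainder l z * gauss \<alpha> z)))"
    using \<alpha> by (intro sum_mono mult_left_mono piece_le_remainder) auto
  also have "\<dots> = 2 * (\<alpha> / pi) * (\<Sum>l\<in>L. (LINT z|lborel. remainder l z * gauss \<alpha> z))"
    by (simp add: sum_distrib_left mult_ac)
  also have "\<dots> \<le> 2 * (\<alpha> / pi) * (?K * ?f + ?f)"
    using rem \<alpha> by (intro mult_left_mono) auto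
  also have "\<dots> = (2 + 1 / (2 * \<alpha> * C\<^sup>2)) * fock_normsq \<alpha> combination"
    unfolding fock_normsq_def by (simp add: algebra_simps add_divide_distrib)
  finally show ?thesis .
qed

end

section \<open>From the lower bound to interpolation\<close>

text \<open>Gram-Schmidt: by induction the last vector can be made orthogonal to the others, and by independence
  what remains of it has positive norm.\<close>
lemma gram_solvable:
  assumes "finite I" and "\<And>i. i \<in> I \<Longrightarrow> e i \<in> fock_space \<alpha>"
    and "\<And>d. fock_normsq \<alpha> (\<lambda>z. \<Sum>i\<in>I. d i * e i z) = 0 \<Longrightarrow> \<forall>i\<in>I. d i = 0"
  shows "\<exists>d. \<forall>j\<in>I. fock_inner \<alpha> (\<lambda>z. \<Sum>i\<in>I. d i * e i z) (e j) = v j"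
  using assms
proof (induction I arbitrary: v rule: finite_induct)
  case empty
  then show ?case by simp
next
  case (insert x J)
  have e: "e x \<in> fock_space \<alpha>" "\<And>i. i \<in> J \<Longrightarrow> e i \<in> fock_space \<alpha>" using insert.prems by auto
  define S where "S = (\<lambda>d z. \<Sum>i\<in>J. d i * e i z)"
  have S: "S d \<in> fock_space \<alpha>" for d
    unfolding S_def by (intro fock_space_sum fock_space_cmult e)
  have ins: "(\<lambda>z. \<Sum>i\<in>insert x J. d i * e i z) = (\<lambda>z. d x * e x z + S d z)" for d
    using insert.hyps by (simp add: S_def)
  have indep: "\<forall>i\<in>J. d i = 0" if z: "fock_normsq \<alpha> (\<lambda>z. \<Sum>i\<in>J. d i * e i z) = 0" for d
  proof -
    have "S (d(x := 0)) = S d" unfolding S_def using insert.hyps by (intro ext sum.cong) auto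
    then have "fock_normsq \<alpha> (\<lambda>z. \<Sum>i\<in>insert x J. (d(x := 0)) i * e i z) = 0"
      using z unfolding ins by (simp add: S_def)
    from insert.prems(2)[OF this] have "(d(x := 0)) i = 0" if "i \<in> J" for i using that by blast
    then show ?thesis using insert.hyps(2) by (metis fun_upd_other)
  qed
  obtain a where a: "\<And>j. j \<in> J \<Longrightarrow> fock_inner \<alpha> (S a) (e j) = fock_inner \<alpha> (e x) (e j)"
    using insert.IH[OF e(2) indep, of "\<lambda>j. fock_inner \<alpha> (e x) (e j)"] unfolding S_def by blast
  obtain b where b: "\<And>j. j \<in> J \<Longrightarrow> fock_inner \<alpha> (S b) (e j) = v j"
    using insert.IH[OF e(2) indep, of v] unfolding S_def by blast
  \<comment> \<open>the component of \<open>e x\<close> orthogonal to the other vectors\<close>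
  define h where "h = (\<lambda>z. e x z - S a z)"
  have h: "h \<in> fock_space \<alpha>" unfolding h_def by (intro fock_space_diff e S)
  have hj: "fock_inner \<alpha> h (e j) = 0" if "j \<in> J" for j
    unfolding h_def using fock_inner_diff_left[OF e(1) S e(2)[OF that]] a[OF that] by simp
  have hS: "fock_inner \<alpha> h (S a) = 0"
  proof -
    have "fock_inner \<alpha> h (\<lambda>z. \<Sum>i\<in>J. a i * e i z) = (\<Sum>i\<in>J. cnj (a i) * fock_inner \<alpha> h (e i))"
      by (rule fock_inner_sum_right) (use e h in auto)
    then show ?thesis unfolding S_def using hj by simp
  qed
  have "fock_inner \<alpha> h h = cnj (fock_inner \<alpha> (e x) h - fock_inner \<alpha> (S a) h)"
    using fock_inner_diff_left[OF e(1) S h, of a] fock_inner_commute[of \<alpha> h h] by (simp add: h_def)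
  also have "\<dots> = fock_inner \<alpha> h (e x)"
    using fock_inner_commute[of \<alpha> h "e x"] fock_inner_commute[of \<alpha> h "S a"] hS by simp
  finally have hx: "fock_inner \<alpha> h (e x) = of_real (fock_normsq \<alpha> h)" by (simp add: fock_inner_self)
  have nz: "fock_inner \<alpha> h (e x) \<noteq> 0"
  proof
    assume "fock_inner \<alpha> h (e x) = 0"
    then have n0: "fock_normsq \<alpha> h = 0" using hx by simp
    define a' where "a' = (\<lambda>i. - a i)(x := 1)"
    have ax: "a' x = 1" by (simp add: a'_def)
    have "S a' z = - S a z" for z
      unfolding S_def sum_negf[symmetric] a'_def using insert.hyps by (intro sum.cong) auto
    then have "(\<lambda>z. \<Sum>i\<in>insert x J. a' i * e i z) = h" unfolding ins h_def ax by simp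
    then have "\<forall>i\<in>insert x J. a' i = 0" using insert.prems(2)[of a'] n0 by simp
    then show False using ax by simp
  qed
  define t where "t = (v x - fock_inner \<alpha> (S b) (e x)) / fock_inner \<alpha> h (e x)"
  define d where "d = (\<lambda>i. b i - t * a i)(x := t)"
  have d: "(\<lambda>z. \<Sum>i\<in>insert x J. d i * e i z) = (\<lambda>z. S b z - (- t) * h z)"
  proof
    fix z
    have "S d z = (\<Sum>i\<in>J. b i * e i z - t * (a i * e i z))"
      unfolding S_def d_def using insert.hyps by (intro sum.cong) (auto simp: algebra_simps)
    then show "(\<Sum>i\<in>insert x J. d i * e i z) = S b z - (- t) * h z"
      unfolding fun_cong[OF ins] h_def S_def
      by (simp add: d_def sum_subtractf sum_distrib_left[symmetric] algebra_simps)
  qed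
  have scale: "fock_inner \<alpha> (\<lambda>z. s * h z) g = s * fock_inner \<alpha> h g" for s g
    unfolding fock_inner_gauss by (simp add: mult.assoc)
  have "fock_inner \<alpha> (\<lambda>z. \<Sum>i\<in>insert x J. d i * e i z) (e j) = v j" if j: "j \<in> insert x J" for j
  proof -
    have ej: "e j \<in> fock_space \<alpha>" using j insert.prems by auto
    have val: "fock_inner \<alpha> (\<lambda>z. \<Sum>i\<in>insert x J. d i * e i z) (e j)
        = fock_inner \<alpha> (S b) (e j) + t * fock_inner \<alpha> h (e j)"
      unfolding d fock_inner_diff_left[OF S fock_space_cmult[OF h] ej] scale by simp
    show ?thesis
    proof (cases "j = x")
      case True
      then show ?thesis using val nz by (simp add: t_def)
    next
      case False
      then show ?thesis using val j b hj by simp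
    qed
  qed
  then show ?case by blast
qed

text \<open>The solution is sought in the span of the functionals, where its norm is the pairing of its coefficients
  with the data; the lower bound for coefficients then bounds the norm by the data.\<close>
lemma finite_interpolation:
  assumes \<alpha>: "\<alpha> > 0" and C: "C > 0" and L: "finite L" and m: "\<And>l. l \<in> L \<Longrightarrow> 0 < m l"
    and disj: "disjoint_family_on (\<lambda>l. ball l (sqrt (real (m l) / \<alpha>) + C)) L"
  defines "K \<equiv> 2 + 1 / (2 * \<alpha> * C\<^sup>2)"
  shows "\<exists>f\<in>fock_space \<alpha>. (\<forall>l\<in>L. \<forall>k<m l. fock_inner \<alpha> f (tbasis \<alpha> l k) = v l k)
    \<and> fock_normsq \<alpha> f \<le> K * (\<Sum>l\<in>L. \<Sum>k<m l. (cmod (v l k))\<^sup>2)"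
proof -
  define I where "I = Sigma L (\<lambda>l. {..<m l})"
  define e where "e = (\<lambda>(l, k). tbasis \<alpha> l k)"
  have I: "finite I" unfolding I_def using L by auto
  have e: "e i \<in> fock_space \<alpha>" for i
    unfolding e_def by (cases i) (simp add: tbasis_in_fock_space[OF \<alpha>])
  have sumI: "(\<Sum>i\<in>I. g i) = (\<Sum>l\<in>L. \<Sum>k<m l. g (l, k))" for g :: "complex \<times> nat \<Rightarrow> 'a :: comm_monoid_add"
    unfolding I_def using L by (subst sum.Sigma) auto
  have riesz: "(\<Sum>i\<in>I. (cmod (d i))\<^sup>2) \<le> K * fock_normsq \<alpha> (\<lambda>z. \<Sum>i\<in>I. d i * e i z)" for d
  proof -
    interpret separated_discs \<alpha> C L m "\<lambda>l k. d (l, k)"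
      by unfold_locales (use assms in auto)
    have "combination = (\<lambda>z. \<Sum>i\<in>I. d i * e i z)"
      unfolding sumI combination_def[abs_def] piece_def e_def by simp
    then show ?thesis using riesz_lower_bound unfolding sumI K_def by simp
  qed
  have K: "K > 0" unfolding K_def using \<alpha> C by (intro add_pos_pos) auto
  have indep: "\<forall>i\<in>I. d i = 0" if "fock_normsq \<alpha> (\<lambda>z. \<Sum>i\<in>I. d i * e i z) = 0" for d
  proof -
    have "(\<Sum>i\<in>I. (cmod (d i))\<^sup>2) = 0"
      using riesz[of d] that by (intro antisym sum_nonneg) auto
    then show ?thesis using I by (simp add: sum_nonneg_eq_0_iff)
  qed
  obtain d where d: "\<And>j. j \<in> I \<Longrightarrow> fock_inner \<alpha> (\<lambda>z. \<Sum>i\<in>I. d i * e i z) (e j) = (case j of (l, k) \<Rightarrow> v l k)"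
    using gram_solvable[where I=I and e=e and v="\<lambda>(l, k). v l k", OF I] e indep by blast
  define f where "f = (\<lambda>z. \<Sum>i\<in>I. d i * e i z)"
  have f: "f \<in> fock_space \<alpha>" unfolding f_def by (intro fock_space_sum fock_space_cmult e)
  define N V where "N = fock_normsq \<alpha> f" and "V = (\<Sum>i\<in>I. (cmod (case i of (l, k) \<Rightarrow> v l k))\<^sup>2)"
  have N0: "N \<ge> 0" unfolding N_def by (rule fock_normsq_nonneg[OF \<alpha>])
  have V0: "V \<ge> 0" unfolding V_def by (intro sum_nonneg) auto
  have "complex_of_real N = fock_inner \<alpha> f f" by (simp add: N_def fock_inner_self)
  also have "\<dots> = (\<Sum>i\<in>I. cnj (d i) * fock_inner \<alpha> f (e i))"
    by (subst (2) f_def) (rule fock_inner_sum_right[OF e f])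
  also have "\<dots> = (\<Sum>i\<in>I. cnj (d i) * (case i of (l, k) \<Rightarrow> v l k))"
    by (intro sum.cong) (simp_all add: d f_def)
  finally have "N = cmod (\<Sum>i\<in>I. cnj (d i) * (case i of (l, k) \<Rightarrow> v l k))" using N0 by (metis abs_of_nonneg norm_of_real)
  also have "\<dots> \<le> (\<Sum>i\<in>I. cmod (d i) * cmod (case i of (l, k) \<Rightarrow> v l k))"
    by (rule order_trans[OF norm_sum]) (simp add: norm_mult)
  finally have "N\<^sup>2 \<le> (\<Sum>i\<in>I. cmod (d i) * cmod (case i of (l, k) \<Rightarrow> v l k))\<^sup>2"
    using N0 by (intro power_mono)
  also have "\<dots> \<le> (\<Sum>i\<in>I. (cmod (d i))\<^sup>2) * V"
    unfolding V_def by (rule Cauchy_Schwarz_ineq_sum)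
  also have "\<dots> \<le> (K * N) * V"
    using riesz[of d] V0 unfolding N_def f_def by (rule mult_right_mono)
  finally have "N * N \<le> N * (K * V)" by (simp add: power2_eq_square mult_ac)
  moreover have "0 \<le> K * V" using K V0 by simp
  ultimately have "N \<le> K * V" using N0 by (cases "N = 0") auto
  then have "fock_normsq \<alpha> f \<le> K * (\<Sum>l\<in>L. \<Sum>k<m l. (cmod (v l k))\<^sup>2)"
    unfolding N_def V_def sumI by simp
  moreover have "fock_inner \<alpha> f (tbasis \<alpha> l k) = v l k" if "l \<in> L" "k < m l" for l k
    using d[of "(l, k)"] that by (simp add: I_def f_def e_def)
  ultimately show ?thesis using f by blast
qed

text \<open>Bounded sequences are locally bounded by the pointwise estimate, so Montel's theorem gives a locally
  uniform limit; Fatou's lemma keeps it in the space. The pointwise estimate is also the majorant for the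
  convergence of inner products, because the product with a tame function is dominated by a Gaussian of half
  the rate.\<close>
lemma fock_weak_limit:
  assumes \<alpha>: "\<alpha> > 0" and f: "\<And>n. f n \<in> fock_space \<alpha>" and B: "\<And>n. fock_normsq \<alpha> (f n) \<le> B"
  shows "\<exists>g r. g \<in> fock_space \<alpha> \<and> strict_mono (r :: nat \<Rightarrow> nat) \<and>
    (\<forall>h. tame h \<longrightarrow> (\<lambda>n. fock_inner \<alpha> (f (r n)) h) \<longlonglongrightarrow> fock_inner \<alpha> g h)"
proof -
  have B0: "B \<ge> 0" using fock_normsq_nonneg[OF \<alpha>, of "f 0"] B[of 0] by linarith
  have pw: "(cmod (f n z))\<^sup>2 \<le> B * exp (\<alpha> * (cmod z)\<^sup>2)" for n z
    by (rule order_trans[OF fock_pointwise_bound[OF \<alpha> f]]) (intro mult_right_mono B, simp)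
  have hol: "f n holomorphic_on UNIV" for n using f by (simp add: fock_space_iff)
  obtain g r where g: "g holomorphic_on UNIV" and r: "strict_mono (r :: nat \<Rightarrow> nat)"
    and lim: "\<And>z. z \<in> UNIV \<Longrightarrow> (\<lambda>n. f (r n) z) \<longlonglongrightarrow> g z"
  proof (rule Montel[of UNIV "range f" f])
    fix K :: "complex set" assume "compact K" "K \<subseteq> UNIV"
    then obtain R where R: "\<And>z. z \<in> K \<Longrightarrow> cmod z \<le> R"
      using compact_imp_bounded[of K] unfolding bounded_iff by blast
    have "cmod (f n z) \<le> sqrt (B * exp (\<alpha> * R\<^sup>2))" if z: "z \<in> K" for n z
    proof (rule real_le_rsqrt)
      have "(cmod z)\<^sup>2 \<le> R\<^sup>2" using R[OF z] by (intro power_mono) auto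
      then have "B * exp (\<alpha> * (cmod z)\<^sup>2) \<le> B * exp (\<alpha> * R\<^sup>2)"
        using \<alpha> B0 by (intro mult_left_mono) auto
      then show "(cmod (f n z))\<^sup>2 \<le> B * exp (\<alpha> * R\<^sup>2)" using pw[of n z] by linarith
    qed
    then show "\<exists>M. \<forall>h\<in>range f. \<forall>z\<in>K. norm (h z) \<le> M" by blast
  qed (use hol in auto)
  have [measurable]: "f n \<in> borel_measurable borel" "g \<in> borel_measurable borel" for n
    by (auto intro: holomorphic_measurable hol g)
  have gF: "g \<in> fock_space \<alpha>"
    unfolding fock_space_iff
  proof (intro conjI g integrableI_bounded)
    have "(\<integral>\<^sup>+z. ennreal (norm ((cmod (g z))\<^sup>2 * gauss \<alpha> z)) \<partial>lborel)
        = (\<integral>\<^sup>+z. liminf (\<lambda>n. ennreal ((cmod (f (r n) z))\<^sup>2 * gauss \<alpha> z)) \<partial>lborel)"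
    proof (intro nn_integral_cong)
      fix z
      have "(\<lambda>n. ennreal ((cmod (f (r n) z))\<^sup>2 * gauss \<alpha> z)) \<longlonglongrightarrow> ennreal ((cmod (g z))\<^sup>2 * gauss \<alpha> z)"
        using lim[of z] by (intro tendsto_intros) auto
      from lim_imp_Liminf[OF _ this]
      show "ennreal (norm ((cmod (g z))\<^sup>2 * gauss \<alpha> z)) = liminf (\<lambda>n. ennreal ((cmod (f (r n) z))\<^sup>2 * gauss \<alpha> z))"
        by simp
    qed
    also have "\<dots> \<le> liminf (\<lambda>n. \<integral>\<^sup>+z. ennreal ((cmod (f (r n) z))\<^sup>2 * gauss \<alpha> z) \<partial>lborel)"
      by (rule nn_integral_liminf) measurable
    also have "\<dots> \<le> ennreal (pi / \<alpha> * B)"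
    proof -
      have "(\<integral>\<^sup>+z. ennreal ((cmod (f n z))\<^sup>2 * gauss \<alpha> z) \<partial>lborel) \<le> ennreal (pi / \<alpha> * B)" for n
      proof -
        have "(\<integral>\<^sup>+z. ennreal ((cmod (f n z))\<^sup>2 * gauss \<alpha> z) \<partial>lborel) = ennreal (LINT z|lborel. (cmod (f n z))\<^sup>2 * gauss \<alpha> z)"
          using f[of n] by (intro nn_integral_eq_integral) (auto simp: fock_space_iff)
        also have "(LINT z|lborel. (cmod (f n z))\<^sup>2 * gauss \<alpha> z) = pi / \<alpha> * fock_normsq \<alpha> (f n)"
          using \<alpha> by (simp add: fock_normsq_def)
        also have "\<dots> \<le> pi / \<alpha> * B" using \<alpha> B by (intro mult_left_mono) auto
        finally show ?thesis by (simp add: ennreal_leI)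
      qed
      then have "liminf (\<lambda>n. \<integral>\<^sup>+z. ennreal ((cmod (f (r n) z))\<^sup>2 * gauss \<alpha> z) \<partial>lborel) \<le> liminf (\<lambda>n. ennreal (pi / \<alpha> * B))"
        by (intro Liminf_mono) auto
      then show ?thesis by (simp add: Liminf_const)
    qed
    also have "\<dots> < \<infinity>" by simp
    finally show "(\<integral>\<^sup>+z. ennreal (norm ((cmod (g z))\<^sup>2 * gauss \<alpha> z)) \<partial>lborel) < \<infinity>" .
  qed measurable
  have "(\<lambda>n. fock_inner \<alpha> (f (r n)) h) \<longlonglongrightarrow> fock_inner \<alpha> g h" if h: "tame h" for h
    unfolding fock_inner_gauss
  proof (intro tendsto_intros integral_dominated_convergence)
    note [measurable] = tame_measurable[OF h]
    show "(\<lambda>z. g z * cnj (h z) * of_real (gauss \<alpha> z)) \<in> borel_measurable lborel"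
      "(\<lambda>z. f (r n) z * cnj (h z) * of_real (gauss \<alpha> z)) \<in> borel_measurable lborel" for n
      by measurable
    show "integrable lborel (\<lambda>z. sqrt B * cmod (h z * of_real (gauss (\<alpha> / 2) z)))"
      using \<alpha> by (intro integrable_mult_right integrable_norm tame_integrable_gauss h) auto
    show "AE z in lborel. (\<lambda>n. f (r n) z * cnj (h z) * of_real (gauss \<alpha> z)) \<longlonglongrightarrow> g z * cnj (h z) * of_real (gauss \<alpha> z)"
      using lim by (intro AE_I2 tendsto_intros) auto
    show "AE z in lborel. norm (f (r n) z * cnj (h z) * of_real (gauss \<alpha> z)) \<le> sqrt B * cmod (h z * of_real (gauss (\<alpha> / 2) z))" for n
    proof (rule AE_I2)
      fix z
      have "(cmod (f (r n) z))\<^sup>2 \<le> (sqrt B * exp (\<alpha> / 2 * (cmod z)\<^sup>2))\<^sup>2"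
        using pw[of "r n" z] B0 by (simp add: power_mult_distrib exp_double[symmetric])
      then have "cmod (f (r n) z) \<le> sqrt B * exp (\<alpha> / 2 * (cmod z)\<^sup>2)"
        by (rule power2_le_imp_le) (use B0 in auto)
      then have "cmod (f (r n) z) * (cmod (h z) * gauss \<alpha> z) \<le> sqrt B * exp (\<alpha> / 2 * (cmod z)\<^sup>2) * (cmod (h z) * gauss \<alpha> z)"
        by (intro mult_right_mono) auto
      also have "\<dots> = sqrt B * (cmod (h z) * (exp (\<alpha> / 2 * (cmod z)\<^sup>2) * gauss \<alpha> z))"
        by (simp add: mult_ac)
      also have "exp (\<alpha> / 2 * (cmod z)\<^sup>2) * gauss \<alpha> z = gauss (\<alpha> / 2) z"
        by (simp add: gauss_def exp_add[symmetric])
      finally show "norm (f (r n) z * cnj (h z) * of_real (gauss \<alpha> z)) \<le> sqrt B * cmod (h z * of_real (gauss (\<alpha> / 2) z))"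
        by (simp add: norm_mult mult.assoc)
    qed
  qed
  with gF r show ?thesis by blast
qed

theorem disjoint_imp_interpolating:
  assumes \<alpha>: "\<alpha> > 0" and div: "is_divisor \<Lambda> m" and C: "C > 0"
    and disj: "disjoint_family_on (\<lambda>l. ball l (sqrt (real (m l) / \<alpha>) + C)) \<Lambda>"
  shows "interpolating_divisor \<alpha> \<Lambda> m"
  unfolding interpolating_divisor_def
proof (intro allI impI)
  fix v :: "complex \<Rightarrow> nat \<Rightarrow> complex"
  define V where "V = (\<lambda>l. \<Sum>k<m l. (cmod (v l k))\<^sup>2)"
  assume "(\<lambda>l. \<Sum>k<m l. (cmod (v l k))\<^sup>2) summable_on \<Lambda>"
  then have V: "V summable_on \<Lambda>" by (simp add: V_def[abs_def])
  define K where "K = 2 + 1 / (2 * \<alpha> * C\<^sup>2)"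
  have K: "K > 0" unfolding K_def using \<alpha> C by (intro add_pos_pos) auto
  define L where "L = (\<lambda>n. {l \<in> \<Lambda>. to_nat_on \<Lambda> l < n})"
  have fin: "finite (L n)" for n
  proof (rule inj_on_finite)
    show "inj_on (to_nat_on \<Lambda>) (L n)"
      using div inj_on_to_nat_on[of \<Lambda>] by (auto simp: is_divisor_def L_def intro: inj_on_subset)
    show "to_nat_on \<Lambda> ` L n \<subseteq> {..<n}" by (auto simp: L_def)
  qed simp
  have "\<exists>f\<in>fock_space \<alpha>. (\<forall>l\<in>L n. \<forall>k<m l. fock_inner \<alpha> f (tbasis \<alpha> l k) = v l k)
    \<and> fock_normsq \<alpha> f \<le> K * (\<Sum>l\<in>L n. \<Sum>k<m l. (cmod (v l k))\<^sup>2)" for n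
    unfolding K_def
  proof (rule finite_interpolation[OF \<alpha> C fin])
    show "disjoint_family_on (\<lambda>l. ball l (sqrt (real (m l) / \<alpha>) + C)) (L n)"
      by (rule disjoint_family_on_mono[OF _ disj]) (auto simp: L_def)
    show "0 < m l" if "l \<in> L n" for l using div that by (auto simp: L_def is_divisor_def)
  qed
  then have "\<forall>n. \<exists>f. f \<in> fock_space \<alpha> \<and> (\<forall>l\<in>L n. \<forall>k<m l. fock_inner \<alpha> f (tbasis \<alpha> l k) = v l k)
    \<and> fock_normsq \<alpha> f \<le> K * (\<Sum>l\<in>L n. V l)"
    unfolding V_def by blast
  from choice[OF this] obtain f where f: "\<And>n. f n \<in> fock_space \<alpha>"
    and fv: "\<And>n l k. l \<in> L n \<Longrightarrow> k < m l \<Longrightarrow> fock_inner \<alpha> (f n) (tbasis \<alpha> l k) = v l k"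
    and fN: "\<And>n. fock_normsq \<alpha> (f n) \<le> K * (\<Sum>l\<in>L n. V l)"
    by blast
  have bound: "fock_normsq \<alpha> (f n) \<le> K * infsum V \<Lambda>" for n
  proof -
    have "(\<Sum>l\<in>L n. V l) \<le> infsum V \<Lambda>"
      by (rule finite_sum_le_infsum[OF V fin]) (auto simp: L_def V_def intro: sum_nonneg)
    then have "K * (\<Sum>l\<in>L n. V l) \<le> K * infsum V \<Lambda>" using K by (intro mult_left_mono) auto
    then show ?thesis using fN[of n] by linarith
  qed
  obtain g r where g: "g \<in> fock_space \<alpha>" and r: "strict_mono (r :: nat \<Rightarrow> nat)"
    and lim: "\<And>h. tame h \<Longrightarrow> (\<lambda>n. fock_inner \<alpha> (f (r n)) h) \<longlonglongrightarrow> fock_inner \<alpha> g h"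
    using fock_weak_limit[where f=f, OF \<alpha> f bound] by blast
  have "fock_inner \<alpha> g (tbasis \<alpha> l k) = v l k" if l: "l \<in> \<Lambda>" and k: "k < m l" for l k
  proof (rule LIMSEQ_unique[OF lim[OF tame_tbasis]])
    have "fock_inner \<alpha> (f (r n)) (tbasis \<alpha> l k) = v l k" if "n > to_nat_on \<Lambda> l" for n
    proof (rule fv[OF _ k])
      have "n \<le> r n" by (rule seq_suble[OF r])
      then show "l \<in> L (r n)" using l that by (simp add: L_def)
    qed
    then show "(\<lambda>n. fock_inner \<alpha> (f (r n)) (tbasis \<alpha> l k)) \<longlonglongrightarrow> v l k"
      by (intro tendsto_eventually eventually_mono[OF eventually_gt_at_top])
  qed
  then show "\<exists>f\<in>fock_space \<alpha>. \<forall>l\<in>\<Lambda>. \<forall>k<m l. fock_inner \<alpha> f (fock_translation \<alpha> l (fock_basis \<alpha> k)) = v l k"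
    using g unfolding tbasis_def by blast
qed

theorem theorem2:
  fixes \<alpha> :: real and \<Lambda> :: "complex set" and m :: "complex \<Rightarrow> nat"
  assumes "\<alpha> > 0" and "is_divisor \<Lambda> m"
  shows "(interpolating_divisor \<alpha> \<Lambda> m \<longrightarrow>
            (\<exists>C>0. disjoint_family_on (\<lambda>l. ball l (sqrt (real (m l) / \<alpha>) - C))
                     {l \<in> \<Lambda>. real (m l) > \<alpha> * C\<^sup>2})) \<and>
         ((\<exists>C>0. disjoint_family_on (\<lambda>l. ball l (sqrt (real (m l) / \<alpha>) + C)) \<Lambda>) \<longrightarrow>
            interpolating_divisor \<alpha> \<Lambda> m)"
  using interpolating_imp_disjoint[OF assms(1)] disjoint_imp_interpolating[OF assms] by blast

end
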